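(* There exist absolute constants $c>0$ and $n_0$ such that for every field $\mathbb{F}$ and every even $n\ge n_0$ the following holds. Let $g=g_{1,n}\in\mathbb{G}[x_1,\ldots,x_n]$ be the explicit multilinear Raz–Yehudayoff polynomial defined in the context, where $\mathbb{G}=\mathbb{F}(\mathcal{W})$. Then every strict circular-interval ABP (over $\mathbb{G}$) computing $g$ has size at least $2^{c\sqrt n/\log n}$; that is, any strict circular-interval ABP computing $g$ requires size $2^{\Omega(\sqrt n/\log n)}$.
   Context: Polynomial $g$. Let $n$ be even, $\mathcal{W}=\{w_{i,k,j}\}_{i,k,j\in[n]}$ a set of distinct variables, and $\mathbb{G}=\mathbb{F}(\mathcal{W})$ the field of rational functions. For integers $i,j$, let $[i,j]=\{k: i\le k\le j\}$ and $|[i,j]|=j-i+1$. For every $[i,j]$ with $|[i,j]|$ even define $g_{i,j}\in\mathbb{G}[x_1,\ldots,x_n]$ recursively: $g_{i,j}=1$ if $|[i,j]|=0$, and if $|[i,j]|>0$, $$g_{i,j}=(1+x_ix_j)\,g_{i+1,j-1}+\sum_{k}w_{i,k,j}\,g_{i,k}\,g_{k+1,j},$$ where the sum is over $k\in[i+1,j-2]$ with $|[i,k]|$ even. Put $g=g_{1,n}$. ABPs. Let $X=\{x_1,\ldots,x_n\}$. An algebraic branching program (ABP) over a field $\mathbb{K}$ is a directed acyclic graph whose vertices are partitioned into layers $L_0,\ldots,L_\ell$, with edges only from $L_i$ to $L_{i+1}$; $L_0=\{s\}$ (source, the one vertex of in-degree 0) and $L_\ell=\{t\}$ (sink, the one vertex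 of out-degree 0). Each edge is labeled by an element of $X\cup\mathbb{K}$. The size is the number of nodes. The polynomial computed is the sum over all $s$-to-$t$ paths of the product of the edge labels. It is syntactic multilinear if every variable occurs at most once on every $s$-to-$t$ path. For nodes $u,v$, $X_{u,v}$ is the set of all variables occurring as labels on some $u$-to-$v$ path. Strict circular-interval ABPs. Let $\pi\in S_n$. An interval $I=[i,j]$ in $\{1,\ldots,n\}$ is a circular $\pi$-interval if $I=\{\pi(i),\pi(i+1),\ldots,\pi(j)\}$ for some $i,j\in[n]$ with $i<j$, or $I=\{\pi(i),\pi(i+1),\ldots,\pi(n),\pi(1),\ldots,\pi(j)\}$ for some $i,j\in[n]$ with $i>j$. Every such circular interval $[i,j]$ is viewed as a chord on a circle containing $n$ points (the chord joining the $i$-th and the $j$-th point). Two circular intervals are overlapping if the corresponding chords in the circle intersect, and non-overlapping otherwise. A syntactic multilinear ABP $P$ is a strict $\pi$-circular-interval ABP if (1) for any pair of nodes $u,v$ in $P$, the index set of $X_{u,v}$ is contained in some circular $\pi$-interval $I_{uv}$ in $[1,n]$; and (2) for any nodes $u,a,v$ in $P$, the circular $\pi$-intervals $I_{ua}$ and $I_{av}$ are non-overlapping. $P$ is a strict circular-interval ABP if it is a strict $\pi$-circular-interval ABP for some permutation $\pi\in S_n$.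
   Formalization: Non-overlapping circular intervals are taken to be disjoint as sets, not merely to have non-intersecting chords; with chords alone, full-circle intervals with disjoint chords make every small syntactic multilinear ABP strict and the claim false. One-point intervals are allowed; empty X_uv are ignored. *)

theory Defs
  imports
    Complex_Main
    "HOL-Library.Multiset"
    "HOL-Algebra.Algebra"
    "HOL-Combinatorics.Permutations"
begin

section \<open>Polynomial rings and rational function fields\<close>

text \<open>
  Fields are HOL-Algebra structures, not instances of a type class, so that a
  statement can bind constants before it quantifies over all fields.
  Polynomials are the functions from monomials (multisets of variables) to
  coefficients of \<^theory>\<open>HOL-Algebra.Indexed_Polynomials\<close>; the ring operations
  are collected here in a record.
\<close>

definition mpoly_ring :: "('a, 'm) ring_scheme \<Rightarrow> 'v set \<Rightarrow> ('v multiset \<Rightarrow> 'a) ring" where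
  "mpoly_ring R V =
    \<lparr>carrier = ring.indexed_pset R V (carrier R),
     monoid.mult = (\<lambda>p q m. \<Oplus>\<^bsub>R\<^esub>m' \<in> {m'. m' \<subseteq># m}. p m' \<otimes>\<^bsub>R\<^esub> q (m - m')),
     one = ring.indexed_const R \<one>\<^bsub>R\<^esub>,
     ring.zero = ring.indexed_const R \<zero>\<^bsub>R\<^esub>,
     ring.add = ring.indexed_padd R\<rparr>"

text \<open>The field of fractions of a domain: equivalence classes of pairs (numerator, denominator).\<close>

definition frac_rel :: "('a, 'm) ring_scheme \<Rightarrow> (('a \<times> 'a) \<times> ('a \<times> 'a)) set" where
  "frac_rel D =
    {((a, b), (c, d)). a \<in> carrier D \<and> b \<in> carrier D - {\<zero>\<^bsub>D\<^esub>} \<and>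
       c \<in> carrier D \<and> d \<in> carrier D - {\<zero>\<^bsub>D\<^esub>} \<and> a \<otimes>\<^bsub>D\<^esub> d = c \<otimes>\<^bsub>D\<^esub> b}"

definition frac :: "('a, 'm) ring_scheme \<Rightarrow> 'a \<Rightarrow> 'a \<Rightarrow> ('a \<times> 'a) set" where
  "frac D a b = frac_rel D `` {(a, b)}"

definition frac_field :: "('a, 'm) ring_scheme \<Rightarrow> ('a \<times> 'a) set ring" where
  "frac_field D =
    \<lparr>carrier = (carrier D \<times> (carrier D - {\<zero>\<^bsub>D\<^esub>})) // frac_rel D,
     monoid.mult = (\<lambda>p q. \<Union>(a, b)\<in>p. \<Union>(c, d)\<in>q. frac D (a \<otimes>\<^bsub>D\<^esub> c) (b \<otimes>\<^bsub>D\<^esub> d)),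
     one = frac D \<one>\<^bsub>D\<^esub> \<one>\<^bsub>D\<^esub>,
     ring.zero = frac D \<zero>\<^bsub>D\<^esub> \<one>\<^bsub>D\<^esub>,
     ring.add = (\<lambda>p q. \<Union>(a, b)\<in>p. \<Union>(c, d)\<in>q.
              frac D (a \<otimes>\<^bsub>D\<^esub> d \<oplus>\<^bsub>D\<^esub> c \<otimes>\<^bsub>D\<^esub> b) (b \<otimes>\<^bsub>D\<^esub> d))\<rparr>"

type_synonym wvar = "nat \<times> nat \<times> nat"
type_synonym 'a wpoly = "wvar multiset \<Rightarrow> 'a"
type_synonym 'a wfrac = "('a wpoly \<times> 'a wpoly) set"

definition Wring :: "('a, 'm) ring_scheme \<Rightarrow> nat \<Rightarrow> 'a wpoly ring" where
  "Wring F n = mpoly_ring F ({1..n} \<times> {1..n} \<times> {1..n})"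

definition Wfield :: "('a, 'm) ring_scheme \<Rightarrow> nat \<Rightarrow> 'a wfrac ring" where
  "Wfield F n = frac_field (Wring F n)"

definition wgen :: "('a, 'm) ring_scheme \<Rightarrow> nat \<Rightarrow> nat \<Rightarrow> nat \<Rightarrow> nat \<Rightarrow> 'a wfrac" where
  "wgen F n i k j = frac (Wring F n) (ring.indexed_var F (i, k, j)) \<one>\<^bsub>Wring F n\<^esub>"


section \<open>The Raz--Yehudayoff polynomial\<close>

text \<open>Needed only for the termination proof of the recursion below.\<close>

lemma foldSetD_cong_imp:
  assumes "(A, x) \<in> foldSetD D f e" and "\<And>y. y \<in> A \<Longrightarrow> f y = g y"
  shows "(A, x) \<in> foldSetD D g e"
  using assms
proof (induction rule: foldSetD.induct)
  case emptyI
  then show ?case by (simp add: foldSetD.emptyI)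
next
  case (insertI x A y)
  then have "(A, y) \<in> foldSetD D g e" and "f x = g x" by auto
  then show ?case
    using insertI.hyps by (auto intro: foldSetD.insertI)
qed

lemma finsum_fundef_cong [fundef_cong]:
  assumes "R = S" and "A = B" and "\<And>x. x \<in> B \<Longrightarrow> f x = g x"
  shows "finsum R f A = finsum S g B"
proof -
  have "(B, z) \<in> foldSetD D (h \<circ> f) e \<longleftrightarrow> (B, z) \<in> foldSetD D (h \<circ> g) e"
    for z D e and h :: "'a \<Rightarrow> 'a \<Rightarrow> 'a"
    using foldSetD_cong_imp[of B z D "h \<circ> f" e "h \<circ> g"]
      foldSetD_cong_imp[of B z D "h \<circ> g" e "h \<circ> f"] assms(3) by auto
  then show ?thesis
    using assms(1,2) by (simp add: finsum_def finprod_def foldD_def)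
qed

text \<open>
  Here \<open>ry_poly K n w i j\<close> is the polynomial attached to the interval \<open>[i,j]\<close>, over
  the field \<open>K\<close> and with parameters \<open>w i k j \<in> K\<close>. Only intervals with
  \<open>1 \<le> i\<close>, \<open>j \<le> n\<close> and an even number \<open>j + 1 - i\<close> of elements are relevant; the
  recursion started on such an interval meets no others.
\<close>

function ry_poly ::
  "('a, 'm) ring_scheme \<Rightarrow> nat \<Rightarrow> (nat \<Rightarrow> nat \<Rightarrow> nat \<Rightarrow> 'a) \<Rightarrow> nat \<Rightarrow> nat \<Rightarrow> (nat multiset \<Rightarrow> 'a)"
where
  "ry_poly K n w i j =
    (if j < i then \<one>\<^bsub>mpoly_ring K {1..n}\<^esub>
     else
       (\<one>\<^bsub>mpoly_ring K {1..n}\<^esub>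
          \<oplus>\<^bsub>mpoly_ring K {1..n}\<^esub>
        ring.indexed_var K i \<otimes>\<^bsub>mpoly_ring K {1..n}\<^esub> ring.indexed_var K j)
          \<otimes>\<^bsub>mpoly_ring K {1..n}\<^esub> ry_poly K n w (i + 1) (j - 1)
       \<oplus>\<^bsub>mpoly_ring K {1..n}\<^esub>
       (\<Oplus>\<^bsub>mpoly_ring K {1..n}\<^esub>k \<in> {k \<in> {i + 1..j - 2}. even (k + 1 - i)}.
          ring.indexed_const K (w i k j)
            \<otimes>\<^bsub>mpoly_ring K {1..n}\<^esub> ry_poly K n w i k
            \<otimes>\<^bsub>mpoly_ring K {1..n}\<^esub> ry_poly K n w (k + 1) j))"
  by pat_completeness auto
termination
  by (relation "measure (\<lambda>(K, n, w, i, j). Suc j - i)") auto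

declare ry_poly.simps [simp del]

definition RY :: "('a, 'm) ring_scheme \<Rightarrow> nat \<Rightarrow> (nat multiset \<Rightarrow> 'a wfrac)" where
  "RY F n = ry_poly (Wfield F n) n (wgen F n) 1 n"


section \<open>Algebraic branching programs\<close>

datatype 'a label = Var nat | Const 'a

text \<open>
  The vertex names are natural numbers; every finite graph has such a copy.
\<close>

record 'a abp =
  depth :: nat
  layer :: "nat \<Rightarrow> nat set"
  edges :: "(nat \<times> nat) set"
  lab :: "nat \<Rightarrow> nat \<Rightarrow> 'a label"
  source :: nat
  sink :: nat

definition nodes :: "'a abp \<Rightarrow> nat set" where
  "nodes P = (\<Union>l\<le>depth P. layer P l)"

definition abp_size :: "'a abp \<Rightarrow> nat" where
  "abp_size P = card (nodes P)"

definition is_abp :: "('a, 'm) ring_scheme \<Rightarrow> nat \<Rightarrow> 'a abp \<Rightarrow> bool" where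
  "is_abp K n P \<longleftrightarrow>
     finite (nodes P) \<and>
     (\<forall>l\<le>depth P. \<forall>l'\<le>depth P. l \<noteq> l' \<longrightarrow> layer P l \<inter> layer P l' = {}) \<and>
     layer P 0 = {source P} \<and>
     layer P (depth P) = {sink P} \<and>
     edges P \<subseteq> (\<Union>l<depth P. layer P l \<times> layer P (Suc l)) \<and>
     (\<forall>v\<in>nodes P. (\<nexists>u. (u, v) \<in> edges P) \<longleftrightarrow> v = source P) \<and>
     (\<forall>v\<in>nodes P. (\<nexists>u. (v, u) \<in> edges P) \<longleftrightarrow> v = sink P) \<and>
     (\<forall>(u, v)\<in>edges P. lab P u v \<in> Var ` {1..n} \<union> Const ` carrier K)"

definition paths :: "'a abp \<Rightarrow> nat \<Rightarrow> nat \<Rightarrow> nat list set" where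
  "paths P u v =
     {p. p \<noteq> [] \<and> hd p = u \<and> last p = v \<and> set p \<subseteq> nodes P \<and>
         successively (\<lambda>a b. (a, b) \<in> edges P) p}"

definition path_labels :: "'a abp \<Rightarrow> nat list \<Rightarrow> 'a label list" where
  "path_labels P p = map (\<lambda>(a, b). lab P a b) (zip p (tl p))"

fun label_poly :: "('a, 'm) ring_scheme \<Rightarrow> 'a label \<Rightarrow> (nat multiset \<Rightarrow> 'a)" where
  "label_poly K (Var i) = ring.indexed_var K i"
| "label_poly K (Const c) = ring.indexed_const K c"

definition path_poly ::
  "('a, 'm) ring_scheme \<Rightarrow> nat \<Rightarrow> 'a abp \<Rightarrow> nat list \<Rightarrow> (nat multiset \<Rightarrow> 'a)" where
  "path_poly K n P p =
     foldr (\<lambda>l q. label_poly K l \<otimes>\<^bsub>mpoly_ring K {1..n}\<^esub> q) (path_labels P p)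
       \<one>\<^bsub>mpoly_ring K {1..n}\<^esub>"

definition abp_poly :: "('a, 'm) ring_scheme \<Rightarrow> nat \<Rightarrow> 'a abp \<Rightarrow> (nat multiset \<Rightarrow> 'a)" where
  "abp_poly K n P =
     (\<Oplus>\<^bsub>mpoly_ring K {1..n}\<^esub>p \<in> paths P (source P) (sink P). path_poly K n P p)"

definition syntactic_multilinear :: "'a abp \<Rightarrow> bool" where
  "syntactic_multilinear P \<longleftrightarrow>
     (\<forall>p\<in>paths P (source P) (sink P). \<forall>i. count_list (path_labels P p) (Var i) \<le> 1)"

definition vars_between :: "'a abp \<Rightarrow> nat \<Rightarrow> nat \<Rightarrow> nat set" where
  "vars_between P u v = {i. \<exists>p\<in>paths P u v. Var i \<in> set (path_labels P p)}"


section \<open>Strict circular-interval programs\<close>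

text \<open>
  A circular interval is given by the pair \<open>(i, j)\<close> of its end positions on a circle
  with \<open>n\<close> points. The pair, and not only the set of positions, is kept because the
  set \<open>{1..n}\<close> belongs to \<open>n\<close> different chords. The case \<open>i = j\<close> is the one-element
  interval, needed for sets consisting of a single variable.
\<close>

definition arc :: "nat \<Rightarrow> nat \<times> nat \<Rightarrow> nat set" where
  "arc n = (\<lambda>(i, j). if i \<le> j then {i..j} else {i..n} \<union> {1..j})"

definition circular_interval :: "nat \<Rightarrow> (nat \<Rightarrow> nat) \<Rightarrow> nat \<times> nat \<Rightarrow> nat set" where
  "circular_interval n \<pi> I = \<pi> ` arc n I"

text \<open>
  Two closed chords of a circle meet iff they share an end point or their end points
  interleave.
\<close>

definition chords_meet :: "nat \<times> nat \<Rightarrow> nat \<times> nat \<Rightarrow> bool" where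
  "chords_meet = (\<lambda>(i, j) (k, l).
     {i, j} \<inter> {k, l} \<noteq> {} \<or>
     (k \<in> {min i j<..<max i j}) \<noteq> (l \<in> {min i j<..<max i j}))"

text \<open>
  A chord stands for the interval it cuts off, so two intervals with a common point
  overlap also when one chord lies on the inner side of the other. Without the second
  disjunct the notion would be void: \<open>(2, 1)\<close>, \<open>(4, 3)\<close>, \<open>(6, 5)\<close>, \dots\ all cut off the
  whole circle by pairwise disjoint chords, and distributing about \<open>2 log\<^sub>2 N\<close> of
  them over the pairs of nodes would make every syntactic multilinear program with \<open>N\<close>
  nodes strict.
\<close>

definition overlapping :: "nat \<Rightarrow> nat \<times> nat \<Rightarrow> nat \<times> nat \<Rightarrow> bool" where
  "overlapping n I J \<longleftrightarrow> chords_meet I J \<or> arc n I \<inter> arc n J \<noteq> {}"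

text \<open>
  \<open>Ivl u v\<close> is the interval chosen for the pair of nodes \<open>u, v\<close>. It plays no role if no
  variable occurs between \<open>u\<close> and \<open>v\<close>, in particular if \<open>v\<close> is not reachable from \<open>u\<close>
  or \<open>u = v\<close>.
\<close>

definition strict_circular_interval_wrt ::
  "nat \<Rightarrow> (nat \<Rightarrow> nat) \<Rightarrow> 'a abp \<Rightarrow> bool" where
  "strict_circular_interval_wrt n \<pi> P \<longleftrightarrow>
     (\<exists>Ivl :: nat \<Rightarrow> nat \<Rightarrow> nat \<times> nat.
        (\<forall>u\<in>nodes P. \<forall>v\<in>nodes P.
           vars_between P u v \<noteq> {} \<longrightarrow>
           Ivl u v \<in> {1..n} \<times> {1..n} \<and>
           vars_between P u v \<subseteq> circular_interval n \<pi> (Ivl u v)) \<and>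
        (\<forall>u\<in>nodes P. \<forall>a\<in>nodes P. \<forall>v\<in>nodes P.
           vars_between P u a \<noteq> {} \<and> vars_between P a v \<noteq> {} \<longrightarrow>
           \<not> overlapping n (Ivl u a) (Ivl a v)))"

definition strict_circular_interval_abp ::
  "('a, 'm) ring_scheme \<Rightarrow> nat \<Rightarrow> 'a abp \<Rightarrow> bool" where
  "strict_circular_interval_abp K n P \<longleftrightarrow>
     is_abp K n P \<and> syntactic_multilinear P \<and>
     (\<exists>\<pi>. \<pi> permutes {1..n} \<and> strict_circular_interval_wrt n \<pi> P)"

end

theory Submission
  imports Defs "HOL-Library.Multiset_Order" "HOL-Library.Product_Lexorder"
begin

text \<open>
  Split the positions on the circle into two half circles, which gives a balanced partition
  \<open>Y \<union> Z\<close> of the variables, and consider the matrix of coefficients at the monomials \<open>S \<union> T\<close> with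
  \<open>S \<subseteq> Y\<close>, \<open>T \<subseteq> Z\<close>. For the Raz--Yehudayoff polynomial it is nonsingular for every balanced
  partition: for a suitable weighting of the \<open>w\<^sub>i\<^sub>,\<^sub>k\<^sub>,\<^sub>j\<close> the part of top weight is a single
  \<open>w\<close>-monomial times \<open>\<Prod>(1 + x\<^sub>y x\<^bsub>\<tau> y\<^esub>)\<close> over a perfect matching \<open>\<tau>\<close> of \<open>Y\<close> with \<open>Z\<close>, whose
  matrix is a permutation matrix.

  A program of size \<open>s\<close> is cut along two edges of every path into at most \<open>2 s\<^sup>4\<close> products of three
  path sums with at most \<open>n / 3\<close> variables each. By strictness, three consecutive pieces cannot all
  meet both half circles, since the half circles touch in two points only. A piece inside a half
  circle has rank one, each of the others has rank at most \<open>2\<^bsup>n/6\<^esup>\<close>. Hence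
  \<open>2\<^bsup>n/2\<^esup> \<le> 2 s\<^sup>4 2\<^bsup>n/3\<^esup>\<close>, which is even exponential in \<open>n\<close>.
\<close>

section \<open>Polynomial rings\<close>

text \<open>The half circles are taken in the order \<open>\<pi>\<close> of the given program, so
  the partition cannot be fixed in advance; hence nonsingularity is proved for every balanced
  partition. A linear relation between the rows has coefficients that again involve the
  \<open>w\<close>. Denominators are cleared, so that these become polynomials, and the parts of top
  weight are compared. In them the matrix of the polynomial is a permutation matrix, whatever the
  characteristic. On the program side, cutting into two halves would give nothing: two complementary
  arcs may both meet both half circles, and the bound would be n/4 + n/4 = n/2 in the exponent.
  Three pieces of n/3 variables give n/6 each, again n/2 in total; the whole gain comes from the one
  piece that strictness pushes into a half circle. It leaves the gap n/2 - n/3 = n/6. The factor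
  \<open>2 s\<^sup>4\<close> bounds the number of choices of one or two cut edges, there being at
  most \<open>s\<^sup>2\<close> edges.\<close>

lemma finite_submultisets [simp]: "finite {m'. m' \<subseteq># m}"
proof (induction m)
  case (add x m)
  have "{m'. m' \<subseteq># add_mset x m} \<subseteq> {m'. m' \<subseteq># m} \<union> add_mset x ` {m'. m' \<subseteq># m}"
  proof
    fix k assume "k \<in> {m'. m' \<subseteq># add_mset x m}"
    then have k: "k \<subseteq># add_mset x m" by simp
    show "k \<in> {m'. m' \<subseteq># m} \<union> add_mset x ` {m'. m' \<subseteq># m}"
    proof (cases "x \<in># k")
      case True
      then obtain k' where "k = add_mset x k'" by (meson multi_member_split)
      then show ?thesis using k by auto
    next
      case False
      then show ?thesis using k
        by (metis UnI1 add_mset_remove_trivial diff_single_trivial mem_Collect_eq subset_eq_diff_conv add_mset_add_single)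
    qed
  qed
  then show ?case using add finite_subset by fast
qed simp

lemma mset_diff_diff: "m' \<subseteq># m \<Longrightarrow> m - (m - m') = m'"
  by (metis add_diff_cancel_right' subset_mset.add_diff_inverse)

section \<open>Rearranging finite sums\<close>

context abelian_monoid
begin

lemmas finsum_zeroI = add.finprod_one_eqI
lemmas finsum_UN_disjoint = add.finprod_UN_disjoint
lemmas finsum_mono_neutral_left = add.finprod_mono_neutral_cong_left

lemma finsum_swap:
  assumes "finite A" "finite B" "\<And>x y. x \<in> A \<Longrightarrow> y \<in> B \<Longrightarrow> f x y \<in> carrier G"
  shows "(\<Oplus>x\<in>A. \<Oplus>y\<in>B. f x y) = (\<Oplus>y\<in>B. \<Oplus>x\<in>A. f x y)"
  using assms(1,3)
proof (induction A rule: finite_induct)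
  case empty
  then show ?case by (simp add: finsum_zeroI)
next
  case (insert a A)
  have "(\<Oplus>x\<in>insert a A. \<Oplus>y\<in>B. f x y) = (\<Oplus>y\<in>B. f a y) \<oplus> (\<Oplus>y\<in>B. \<Oplus>x\<in>A. f x y)"
    using insert by (subst finsum_insert) (auto intro!: finsum_closed)
  also have "\<dots> = (\<Oplus>y\<in>B. f a y \<oplus> (\<Oplus>x\<in>A. f x y))"
    using insert by (subst finsum_addf) (auto intro!: finsum_closed)
  also have "\<dots> = (\<Oplus>y\<in>B. \<Oplus>x\<in>insert a A. f x y)"
    using insert by (intro finsum_cong') (auto intro!: finsum_closed)
  finally show ?case .
qed

lemma finsum_single:
  assumes "finite A" "i \<in> A" "f i \<in> carrier G" "\<And>j. j \<in> A \<Longrightarrow> j \<noteq> i \<Longrightarrow> f j = \<zero>"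
  shows "finsum G f A = f i"
proof -
  have "finsum G f {i} = finsum G f A"
    using assms by (intro finsum_mono_neutral_left) (auto simp: Pi_iff, metis zero_closed)
  then show ?thesis using assms by simp
qed

lemma finsum_nonzeroE:
  assumes "finsum G f A \<noteq> \<zero>"
  obtains x where "x \<in> A" "f x \<noteq> \<zero>"
  using assms finsum_zeroI by metis

lemma finsum_group:
  assumes "finite A" "finite B" "\<phi> ` A \<subseteq> B" "f \<in> A \<rightarrow> carrier G"
  shows "finsum G f A = (\<Oplus>b\<in>B. finsum G f {a \<in> A. \<phi> a = b})"
proof -
  have "A = (\<Union>b\<in>B. {a \<in> A. \<phi> a = b})" using assms by auto
  then have "finsum G f A = finsum G f (\<Union>b\<in>B. {a \<in> A. \<phi> a = b})" by simp
  also have "\<dots> = (\<Oplus>b\<in>B. finsum G f {a \<in> A. \<phi> a = b})"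
    using assms by (intro finsum_UN_disjoint) (auto simp: pairwise_def disjnt_def)
  finally show ?thesis .
qed

end

section \<open>Polynomial arithmetic in terms of coefficients\<close>

context ring
begin

lemma mpoly_mult_apply:
  "monoid.mult (mpoly_ring R V) p q m = (\<Oplus>m' \<in> {m'. m' \<subseteq># m}. p m' \<otimes> q (m - m'))"
  by (simp add: mpoly_ring_def)

lemma mpoly_ring_sel [simp]:
  "ring.add (mpoly_ring R V) p q m = p m \<oplus> q m"
  "ring.zero (mpoly_ring R V) m = \<zero>"
  "monoid.one (mpoly_ring R V) m = (if m = {#} then \<one> else \<zero>)"
  by (simp_all add: mpoly_ring_def indexed_padd_def indexed_const_def)

lemma indexed_var_eq: "indexed_var i = (\<lambda>m. if m = {#i#} then \<one> else \<zero>)"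
  by (auto simp: indexed_var_def indexed_pmult_def indexed_const_def fun_eq_iff
      dest: multi_member_split)

text \<open>Replaces the inductive generation of the carrier by a condition on coefficients, so that
  closure properties can be checked coefficientwise. Conversely, a finitely supported function is a
  finite sum of monomials with scalar factors.\<close>

lemma mem_mpoly_ring_iff:
  fixes V :: "'v set"
  shows "p \<in> carrier (mpoly_ring R V) \<longleftrightarrow>
     (\<forall>m. p m \<in> carrier R) \<and> finite {m. p m \<noteq> \<zero>} \<and> (\<forall>m. p m \<noteq> \<zero> \<longrightarrow> set_mset m \<subseteq> V)"
  (is "_ = ?P p")
proof
  assume "p \<in> carrier (mpoly_ring R V)"
  then have "p \<in> indexed_pset V (carrier R)" by (simp add: mpoly_ring_def)
  then show "?P p"
  proof (induction rule: indexed_pset.induct)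
    case (indexed_const k)
    then show ?case
      by (auto simp: indexed_const_def intro: finite_subset[of _ "{{#}}"])
  next
    case (indexed_padd P Q)
    have "{m. P m \<oplus> Q m \<noteq> \<zero>} \<subseteq> {m. P m \<noteq> \<zero>} \<union> {m. Q m \<noteq> \<zero>}"
      using indexed_padd by auto
    with indexed_padd show ?case
      by (auto simp: indexed_padd_def intro: finite_subset) (metis subsetD r_zero zero_closed)
  next
    case (indexed_pmult P i)
    have "{m. (if i \<in># m then P (m - {#i#}) else \<zero>) \<noteq> \<zero>} \<subseteq> add_mset i ` {m. P m \<noteq> \<zero>}"
    proof
      fix m assume "m \<in> {m. (if i \<in># m then P (m - {#i#}) else \<zero>) \<noteq> \<zero>}"
      then have "i \<in># m" "P (m - {#i#}) \<noteq> \<zero>" by (auto split: if_splits)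
      then show "m \<in> add_mset i ` {m. P m \<noteq> \<zero>}"
        by (intro image_eqI[of _ _ "m - {#i#}"]) auto
    qed
    moreover have "set_mset m \<subseteq> V" if "i \<in># m" "P (m - {#i#}) \<noteq> \<zero>" for m
    proof -
      have "set_mset (m - {#i#}) \<subseteq> V" using indexed_pmult that by blast
      moreover have "m = add_mset i (m - {#i#})" using that by simp
      ultimately show ?thesis using indexed_pmult.hyps
        by (metis insert_subset set_mset_add_mset_insert)
    qed
    ultimately show ?case using indexed_pmult
      unfolding indexed_pmult_def by (intro conjI) (auto intro: finite_subset split: if_splits)
  qed
next
  \<comment> \<open>A single term is built from a constant by multiplying with one variable at a
    time.\<close>
  have mono: "(\<lambda>m. if m = m0 then k else \<zero>) \<in> indexed_pset V (carrier R)"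
    if "k \<in> carrier R" "set_mset m0 \<subseteq> V" for k and m0 :: "'v multiset"
    using that(2)
  proof (induction m0)
    case empty
    then show ?case using indexed_pset.indexed_const[OF that(1), of V]
      by (simp add: indexed_const_def)
  next
    case (add i m0)
    then have "indexed_pmult (\<lambda>m. if m = m0 then k else \<zero>) i \<in> indexed_pset V (carrier R)"
      by (intro indexed_pset.indexed_pmult) auto
    moreover have "indexed_pmult (\<lambda>m. if m = m0 then k else \<zero>) i
        = (\<lambda>m. if m = add_mset i m0 then k else \<zero>)"
      by (auto simp: indexed_pmult_def fun_eq_iff)
    ultimately show ?case by simp
  qed
  assume p: "?P p"
  \<comment> \<open>The induction is over a finite superset \<open>M\<close> of the support, so the
    coefficient removed at \<open>m0\<close> may be zero already.\<close>
  have ind: "p \<in> indexed_pset V (carrier R)"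
    if "finite M" "{m. p m \<noteq> \<zero>} \<subseteq> M" "?P p" for M p
    using that
  proof (induction M arbitrary: p rule: finite_induct)
    case empty
    then have "p = indexed_const \<zero>" by (auto simp: indexed_const_def fun_eq_iff)
    then show ?case by (simp add: indexed_pset.indexed_const)
  next
    case (insert m0 M)
    let ?q = "p(m0 := \<zero>)"
    have fin: "finite {m. ?q m \<noteq> \<zero>}"
      using insert.prems by (auto intro: finite_subset[of _ "{m. p m \<noteq> \<zero>}"])
    have "?q \<in> indexed_pset V (carrier R)"
      using insert.prems fin by (intro insert.IH) auto
    moreover have "(\<lambda>m. if m = m0 then p m0 else \<zero>) \<in> indexed_pset V (carrier R)"
    proof (cases "p m0 = \<zero>")
      case True
      then show ?thesis using indexed_pset.indexed_const[of \<zero> "carrier R" V]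
        by (simp add: indexed_const_def cong: if_cong)
    next
      case False
      then show ?thesis using insert.prems by (intro mono) auto
    qed
    ultimately have "indexed_padd ?q (\<lambda>m. if m = m0 then p m0 else \<zero>) \<in> indexed_pset V (carrier R)"
      by (rule indexed_pset.indexed_padd)
    moreover have "indexed_padd ?q (\<lambda>m. if m = m0 then p m0 else \<zero>) = p"
      using insert.prems by (auto simp: indexed_padd_def fun_eq_iff)
    ultimately show ?case by simp
  qed
  have "finite {m. p m \<noteq> \<zero>}" using p by blast
  from ind[OF this subset_refl p] show "p \<in> carrier (mpoly_ring R V)"
    by (simp add: mpoly_ring_def)
qed

lemma mpoly_coeff_closed: "p \<in> carrier (mpoly_ring R V) \<Longrightarrow> p m \<in> carrier R"
  by (simp add: mem_mpoly_ring_iff)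

lemma mpoly_mult_nonzeroE:
  assumes "monoid.mult (mpoly_ring R V) p q m \<noteq> \<zero>"
    and "\<And>m. p m \<in> carrier R" "\<And>m. q m \<in> carrier R"
  obtains m1 m2 where "m = m1 + m2" "p m1 \<noteq> \<zero>" "q m2 \<noteq> \<zero>"
proof -
  obtain m' where "m' \<subseteq># m" "p m' \<otimes> q (m - m') \<noteq> \<zero>"
    using assms(1) by (auto simp: mpoly_mult_apply elim: finsum_nonzeroE)
  moreover from this have "m = m' + (m - m')" "p m' \<noteq> \<zero>" "q (m - m') \<noteq> \<zero>"
    using assms by auto
  ultimately show ?thesis using that by blast
qed

text \<open>The tool for all leading-term arguments: when only one factorisation of a monomial
  survives, the convolution collapses to one product. Cancellation of multisets makes it enough to
  determine the first factor.\<close>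

lemma mpoly_mult_unique:
  assumes "\<And>m. p m \<in> carrier R" "\<And>m. q m \<in> carrier R"
    and "\<And>n1 n2. n1 + n2 = m1 + m2 \<Longrightarrow> p n1 \<noteq> \<zero> \<Longrightarrow> q n2 \<noteq> \<zero> \<Longrightarrow> n1 = m1"
  shows "monoid.mult (mpoly_ring R V) p q (m1 + m2) = p m1 \<otimes> q m2"
proof -
  have "monoid.mult (mpoly_ring R V) p q (m1 + m2) = p m1 \<otimes> q (m1 + m2 - m1)"
    unfolding mpoly_mult_apply
  proof (intro finsum_single)
    fix j assume j: "j \<in> {m'. m' \<subseteq># m1 + m2}" "j \<noteq> m1"
    then have "j + (m1 + m2 - j) = m1 + m2" by simp
    then show "p j \<otimes> q (m1 + m2 - j) = \<zero>"
      using assms j by (metis l_null r_null)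
  qed (use assms in auto)
  then show ?thesis by simp
qed

lemma mpoly_mult_closed:
  assumes "p \<in> carrier (mpoly_ring R V)" "q \<in> carrier (mpoly_ring R V)"
  shows "monoid.mult (mpoly_ring R V) p q \<in> carrier (mpoly_ring R V)"
proof -
  have c: "p m \<in> carrier R" "q m \<in> carrier R" for m using assms by (auto simp: mem_mpoly_ring_iff)
  have "{m. monoid.mult (mpoly_ring R V) p q m \<noteq> \<zero>} \<subseteq> (\<lambda>(a, b). a + b) ` ({m. p m \<noteq> \<zero>} \<times> {m. q m \<noteq> \<zero>})"
    using c by (auto elim!: mpoly_mult_nonzeroE)
  moreover have "finite ({m. p m \<noteq> \<zero>} \<times> {m. q m \<noteq> \<zero>})"
    using assms by (auto simp: mem_mpoly_ring_iff)
  ultimately have "finite {m. monoid.mult (mpoly_ring R V) p q m \<noteq> \<zero>}"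
    by (meson finite_imageI finite_subset)
  moreover have "set_mset m \<subseteq> V" if nz: "monoid.mult (mpoly_ring R V) p q m \<noteq> \<zero>" for m
  proof -
    obtain m1 m2 where "m = m1 + m2" "p m1 \<noteq> \<zero>" "q m2 \<noteq> \<zero>"
      using mpoly_mult_nonzeroE[OF nz c] by blast
    then show ?thesis using assms by (auto simp: mem_mpoly_ring_iff)
  qed
  moreover have "monoid.mult (mpoly_ring R V) p q m \<in> carrier R" for m
    using c by (auto simp: mpoly_mult_apply intro!: finsum_closed)
  ultimately show ?thesis unfolding mem_mpoly_ring_iff by blast
qed

end

context cring
begin

text \<open>Passing to the complement \<open>m - m'\<close> is an involution on the divisors of
  \<open>m\<close>; reindexing along it exchanges the two factors.\<close>

lemma mpoly_mult_comm:
  assumes "\<And>m. p m \<in> carrier R" "\<And>m. q m \<in> carrier R"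
  shows "monoid.mult (mpoly_ring R V) p q = monoid.mult (mpoly_ring R V) q p"
proof
  fix m
  have "(\<Oplus>m' \<in> {m'. m' \<subseteq># m}. p m' \<otimes> q (m - m'))
      = (\<Oplus>m' \<in> (\<lambda>m'. m - m') ` {m'. m' \<subseteq># m}. p m' \<otimes> q (m - m'))"
  proof -
    have "(\<lambda>m'. m - m') ` {m'. m' \<subseteq># m} = {m'. m' \<subseteq># m}"
      by (auto simp: image_iff) (metis diff_subset_eq_self mset_diff_diff)
    then show ?thesis by simp
  qed
  also have "\<dots> = (\<Oplus>m' \<in> {m'. m' \<subseteq># m}. p (m - m') \<otimes> q (m - (m - m')))"
  proof (intro finsum_reindex)
    show "inj_on ((-) m) {m'. m' \<subseteq># m}"
      by (rule inj_onI) (metis mem_Collect_eq mset_diff_diff)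
  qed (use assms in auto)
  also have "\<dots> = (\<Oplus>m' \<in> {m'. m' \<subseteq># m}. q m' \<otimes> p (m - m'))"
  proof (rule finsum_cong')
    fix i assume "i \<in> {m'. m' \<subseteq># m}"
    then have "m - (m - i) = i" by (simp add: mset_diff_diff)
    then show "p (m - i) \<otimes> q (m - (m - i)) = q i \<otimes> p (m - i)" using assms m_comm by simp
  qed (use assms in auto)
  finally show "monoid.mult (mpoly_ring R V) p q m = monoid.mult (mpoly_ring R V) q p m" by (simp add: mpoly_mult_apply)
qed

lemma mpoly_mult_assoc:
  assumes c: "\<And>m. p m \<in> carrier R" "\<And>m. q m \<in> carrier R" "\<And>m. r m \<in> carrier R"
  shows "monoid.mult (mpoly_ring R V) (monoid.mult (mpoly_ring R V) p q) r
       = monoid.mult (mpoly_ring R V) p (monoid.mult (mpoly_ring R V) q r)"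
proof
  fix m :: "'c multiset"
  let ?D = "{a. a \<subseteq># m}"
  let ?t = "\<lambda>a b. p b \<otimes> q (a - b) \<otimes> r (m - a)"
  \<comment> \<open>Both bracketings sum over chains \<open>b \<subseteq># a \<subseteq># m\<close>.
    Padding by zero lets \<open>a\<close> and \<open>b\<close> range independently over all divisors
    of \<open>m\<close>, so that the sums can be swapped.\<close>
  let ?f = "\<lambda>a b. if b \<subseteq># a then ?t a b else \<zero>"
  have "monoid.mult (mpoly_ring R V) (monoid.mult (mpoly_ring R V) p q) r m
      = (\<Oplus>a\<in>?D. (\<Oplus>b\<in>{b. b \<subseteq># a}. p b \<otimes> q (a - b)) \<otimes> r (m - a))" by (simp add: mpoly_mult_apply)
  also have "\<dots> = (\<Oplus>a\<in>?D. \<Oplus>b\<in>{b. b \<subseteq># a}. ?t a b)"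
    using c by (intro finsum_cong') (auto intro!: finsum_closed finsum_ldistr)
  also have "\<dots> = (\<Oplus>a\<in>?D. \<Oplus>b\<in>?D. ?f a b)"
    using c by (intro finsum_cong' finsum_mono_neutral_left)
      (auto intro!: finsum_closed intro: subset_mset.order_trans)
  also have "\<dots> = (\<Oplus>b\<in>?D. \<Oplus>a\<in>?D. ?f a b)"
    using c by (intro finsum_swap) auto
  also have "\<dots> = (\<Oplus>b\<in>?D. p b \<otimes> (\<Oplus>e\<in>{e. e \<subseteq># m - b}. q e \<otimes> r (m - b - e)))"
  proof (rule finsum_cong')
    fix b assume b: "b \<in> ?D"
    have "(\<Oplus>a\<in>?D. ?f a b) = (\<Oplus>a\<in>(+) b ` {e. e \<subseteq># m - b}. ?t a b)"
    proof (rule sym, rule finsum_mono_neutral_left)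
      show "(+) b ` {e. e \<subseteq># m - b} \<subseteq> ?D"
        using b by (auto simp: subset_mset.le_diff_conv2 add.commute)
      fix i assume i: "i \<in> ?D - (+) b ` {e. e \<subseteq># m - b}"
      have "\<not> b \<subseteq># i"
      proof
        assume "b \<subseteq># i"
        then have "i = b + (i - b)" "i - b \<subseteq># m - b"
          using i by (auto simp: subseteq_mset_def intro: diff_le_mono)
        then show False using i by blast
      qed
      then show "?f i b = \<zero>" by simp
    qed (use c in auto)
    also have "\<dots> = (\<Oplus>e\<in>{e. e \<subseteq># m - b}. ?t (b + e) b)"
      using c by (intro finsum_reindex) auto
    also have "\<dots> = (\<Oplus>e\<in>{e. e \<subseteq># m - b}. p b \<otimes> (q e \<otimes> r (m - b - e)))"
      using c by (intro finsum_cong') (auto simp: m_assoc)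
    also have "\<dots> = p b \<otimes> (\<Oplus>e\<in>{e. e \<subseteq># m - b}. q e \<otimes> r (m - b - e))"
      using c by (intro finsum_rdistr[symmetric]) auto
    finally show "(\<Oplus>a\<in>?D. ?f a b) = p b \<otimes> (\<Oplus>e\<in>{e. e \<subseteq># m - b}. q e \<otimes> r (m - b - e))" .
  qed (use c in \<open>auto intro!: finsum_closed\<close>)
  finally show "monoid.mult (mpoly_ring R V) (monoid.mult (mpoly_ring R V) p q) r m
       = monoid.mult (mpoly_ring R V) p (monoid.mult (mpoly_ring R V) q r) m" by (simp add: mpoly_mult_apply)
qed

lemma mpoly_one_mult:
  assumes "\<And>m. p m \<in> carrier R"
  shows "monoid.mult (mpoly_ring R V) (monoid.one (mpoly_ring R V)) p = p"
proof
  fix m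
  show "monoid.mult (mpoly_ring R V) (monoid.one (mpoly_ring R V)) p m = p m"
    using assms by (subst mpoly_mult_unique[of _ _ "{#}" m, simplified add_0])
      (auto split: if_splits)
qed

theorem mpoly_cring: "cring (mpoly_ring R V)"
proof (intro cringI abelian_groupI comm_monoidI)
  fix x y z assume x: "x \<in> carrier (mpoly_ring R V)" and y: "y \<in> carrier (mpoly_ring R V)"
    and z: "z \<in> carrier (mpoly_ring R V)"
  have c: "x m \<in> carrier R" "y m \<in> carrier R" "z m \<in> carrier R" for m
    using x y z by (auto simp: mpoly_coeff_closed)
  show "x \<otimes>\<^bsub>mpoly_ring R V\<^esub> y \<otimes>\<^bsub>mpoly_ring R V\<^esub> z =
       x \<otimes>\<^bsub>mpoly_ring R V\<^esub> (y \<otimes>\<^bsub>mpoly_ring R V\<^esub> z)"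
    by (rule mpoly_mult_assoc) (use c in auto)
  show "(x \<oplus>\<^bsub>mpoly_ring R V\<^esub> y) \<otimes>\<^bsub>mpoly_ring R V\<^esub> z =
       x \<otimes>\<^bsub>mpoly_ring R V\<^esub> z \<oplus>\<^bsub>mpoly_ring R V\<^esub> y \<otimes>\<^bsub>mpoly_ring R V\<^esub> z"
    using c by (auto simp: fun_eq_iff mpoly_mult_apply l_distr simp flip: finsum_addf intro!: finsum_cong')
  show "x \<oplus>\<^bsub>mpoly_ring R V\<^esub> y \<oplus>\<^bsub>mpoly_ring R V\<^esub> z =
       x \<oplus>\<^bsub>mpoly_ring R V\<^esub> (y \<oplus>\<^bsub>mpoly_ring R V\<^esub> z)"
    using c by (auto simp: fun_eq_iff a_assoc)
next
  fix x y assume x: "x \<in> carrier (mpoly_ring R V)" and y: "y \<in> carrier (mpoly_ring R V)"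
  have c: "x m \<in> carrier R" "y m \<in> carrier R" for m
    using x y by (auto simp: mpoly_coeff_closed)
  show "x \<otimes>\<^bsub>mpoly_ring R V\<^esub> y = y \<otimes>\<^bsub>mpoly_ring R V\<^esub> x"
    by (rule mpoly_mult_comm) (use c in auto)
  show "x \<oplus>\<^bsub>mpoly_ring R V\<^esub> y = y \<oplus>\<^bsub>mpoly_ring R V\<^esub> x"
    using c by (auto simp: fun_eq_iff a_comm)
  show "x \<oplus>\<^bsub>mpoly_ring R V\<^esub> y \<in> carrier (mpoly_ring R V)"
    using x y by (simp add: mpoly_ring_def indexed_pset.indexed_padd)
  show "x \<otimes>\<^bsub>mpoly_ring R V\<^esub> y \<in> carrier (mpoly_ring R V)"
    using x y by (rule mpoly_mult_closed)
next
  show "\<one>\<^bsub>mpoly_ring R V\<^esub> \<in> carrier (mpoly_ring R V)"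
    "\<zero>\<^bsub>mpoly_ring R V\<^esub> \<in> carrier (mpoly_ring R V)"
    by (simp_all add: mpoly_ring_def indexed_pset.indexed_const)
next
  fix x assume x: "x \<in> carrier (mpoly_ring R V)"
  then have c: "x m \<in> carrier R" for m by (simp add: mpoly_coeff_closed)
  show "\<one>\<^bsub>mpoly_ring R V\<^esub> \<otimes>\<^bsub>mpoly_ring R V\<^esub> x = x"
    by (rule mpoly_one_mult) (use c in auto)
  show "\<zero>\<^bsub>mpoly_ring R V\<^esub> \<oplus>\<^bsub>mpoly_ring R V\<^esub> x = x"
    using c by (auto simp: fun_eq_iff)
  have "(\<lambda>m. \<ominus> x m) \<in> carrier (mpoly_ring R V)"
  proof -
    have "\<ominus> x m \<noteq> \<zero> \<longleftrightarrow> x m \<noteq> \<zero>" for m using c by (metis minus_minus minus_zero)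
    then show ?thesis using x by (simp add: mem_mpoly_ring_iff)
  qed
  moreover have "(\<lambda>m. \<ominus> x m) \<oplus>\<^bsub>mpoly_ring R V\<^esub> x = \<zero>\<^bsub>mpoly_ring R V\<^esub>"
    using c by (auto simp: fun_eq_iff l_neg)
  ultimately show "\<exists>y\<in>carrier (mpoly_ring R V). y \<oplus>\<^bsub>mpoly_ring R V\<^esub> x = \<zero>\<^bsub>mpoly_ring R V\<^esub>"
    by blast
qed

lemma mpoly_finsum_apply:
  assumes "finite A" "\<And>k. k \<in> A \<Longrightarrow> f k \<in> carrier (mpoly_ring R V)"
  shows "finsum (mpoly_ring R V) f A m = (\<Oplus>k\<in>A. f k m)"
  using assms
proof (induction A rule: finite_induct)
  interpret M: cring "mpoly_ring R V" by (rule mpoly_cring)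
  {
    case empty
    then show ?case by simp
  next
    case (insert k A)
    then have "f j m \<in> carrier R" if "j \<in> insert k A" for j
      using that mpoly_coeff_closed by blast
    then show ?case using insert
      by (subst M.finsum_insert) (auto simp: Pi_iff)
  }
qed

lemma mpoly_const_mult:
  assumes "k \<in> carrier R" "\<And>m. p m \<in> carrier R"
  shows "monoid.mult (mpoly_ring R V) (indexed_const k) p m = k \<otimes> p m"
  using assms by (subst mpoly_mult_unique[of _ _ "{#}" m, simplified add_0])
    (auto simp: indexed_const_def split: if_splits)

lemma mpoly_var_mult:
  assumes "\<And>m. p m \<in> carrier R"
  shows "monoid.mult (mpoly_ring R V) (indexed_var i) p m = (if i \<in># m then p (m - {#i#}) else \<zero>)"
proof (cases "i \<in># m")
  case True
  then have "monoid.mult (mpoly_ring R V) (indexed_var i) p ({#i#} + (m - {#i#})) = p (m - {#i#})"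
    using assms by (subst mpoly_mult_unique) (auto simp: indexed_var_eq split: if_splits)
  then show ?thesis using True by simp
next
  case False
  have "monoid.mult (mpoly_ring R V) (indexed_var i) p m = \<zero>"
  proof (rule ccontr)
    assume "\<not> ?thesis"
    then show False using assms False
      by (elim mpoly_mult_nonzeroE) (auto simp: indexed_var_eq split: if_splits)
  qed
  then show ?thesis using False by simp
qed

lemma indexed_const_closed: "k \<in> carrier R \<Longrightarrow> indexed_const k \<in> carrier (mpoly_ring R V)"
  by (simp add: mpoly_ring_def indexed_pset.indexed_const)

lemma indexed_var_closed: "i \<in> V \<Longrightarrow> indexed_var i \<in> carrier (mpoly_ring R V)"
  by (simp add: mpoly_ring_def indexed_var_def indexed_pset.indexed_const indexed_pset.indexed_pmult)

end

text \<open>The linear order on variables extends to a linear order on monomials that is compatible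
  with multiplication. The product of the two largest monomials therefore arises in only one way,
  and its coefficient is a product of nonzero elements.\<close>

theorem (in domain) mpoly_domain:
  fixes V :: "'v::linorder set"
  shows "domain (mpoly_ring R V)"
proof -
  interpret M: cring "mpoly_ring R V" by (rule mpoly_cring)
  show ?thesis
  proof (intro domain.intro M.is_cring domain_axioms.intro)
    show "\<one>\<^bsub>mpoly_ring R V\<^esub> \<noteq> \<zero>\<^bsub>mpoly_ring R V\<^esub>"
      by (metis mpoly_ring_sel(2,3) zero_not_one)
    fix a b assume ab: "a \<otimes>\<^bsub>mpoly_ring R V\<^esub> b = \<zero>\<^bsub>mpoly_ring R V\<^esub>"
      and a: "a \<in> carrier (mpoly_ring R V)" and b: "b \<in> carrier (mpoly_ring R V)"
    show "a = \<zero>\<^bsub>mpoly_ring R V\<^esub> \<or> b = \<zero>\<^bsub>mpoly_ring R V\<^esub>"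
    proof (rule ccontr)
      assume "\<not> ?thesis"
      then have ne: "{m. a m \<noteq> \<zero>} \<noteq> {}" "{m. b m \<noteq> \<zero>} \<noteq> {}"
        by (auto simp: fun_eq_iff)
      have fin: "finite {m. a m \<noteq> \<zero>}" "finite {m. b m \<noteq> \<zero>}"
        using a b by (auto simp: mem_mpoly_ring_iff)
      define ma where "ma = Max {m. a m \<noteq> \<zero>}"
      define mb where "mb = Max {m. b m \<noteq> \<zero>}"
      have nz: "a ma \<noteq> \<zero>" "b mb \<noteq> \<zero>"
        using Max_in[OF fin(1) ne(1)] Max_in[OF fin(2) ne(2)] by (auto simp: ma_def mb_def)
      have le: "m \<le> ma" if "a m \<noteq> \<zero>" for m using that fin by (auto simp: ma_def)
      have le': "m \<le> mb" if "b m \<noteq> \<zero>" for m using that fin by (auto simp: mb_def)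
      have "(a \<otimes>\<^bsub>mpoly_ring R V\<^esub> b) (ma + mb) = a ma \<otimes> b mb"
      proof (rule mpoly_mult_unique)
        fix n1 n2 assume "n1 + n2 = ma + mb" "a n1 \<noteq> \<zero>" "b n2 \<noteq> \<zero>"
        then show "n1 = ma" using le le' add_less_le_mono[of n1 ma n2 mb]
          by (metis less_irrefl order_le_less)
      qed (use a b in \<open>auto simp: mpoly_coeff_closed\<close>)
      moreover have "a ma \<otimes> b mb \<noteq> \<zero>"
        using nz a b by (metis integral_iff mpoly_coeff_closed)
      ultimately show False using ab by simp
    qed
  qed
qed

section \<open>Rational functions and linear systems\<close>

text \<open>Operations on fractions are unions over all representatives. Once the result is
  independent of the representatives, the union of equal classes is that class.\<close>

lemma Union_pairs_const:
  assumes "(a, b) \<in> p" "(c, d) \<in> q"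
    and "\<And>a b c d. (a, b) \<in> p \<Longrightarrow> (c, d) \<in> q \<Longrightarrow> f a b c d = x"
  shows "(\<Union>(a, b)\<in>p. \<Union>(c, d)\<in>q. f a b c d) = x"
proof (rule SUP_eq_const)
  show "p \<noteq> {}" using assms by auto
  fix y assume y: "y \<in> p"
  have "(\<Union>(c, d)\<in>q. f (fst y) (snd y) c d) = x"
    by (rule SUP_eq_const) (use assms y in auto)
  then show "(case y of (a, b) \<Rightarrow> \<Union>(c, d)\<in>q. f a b c d) = x"
    by (simp add: case_prod_beta)
qed

section \<open>Fractions over a domain\<close>

context domain
begin

lemma frac_rel_iff:
  "((a, b), (c, d)) \<in> frac_rel R \<longleftrightarrow> a \<in> carrier R \<and> b \<in> carrier R \<and> b \<noteq> \<zero> \<and>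
     c \<in> carrier R \<and> d \<in> carrier R \<and> d \<noteq> \<zero> \<and> a \<otimes> d = c \<otimes> b"
  by (auto simp: frac_rel_def)

lemma frac_rel_equiv: "equiv (carrier R \<times> (carrier R - {\<zero>})) (frac_rel R)"
proof (rule equivI)
  show "frac_rel R \<subseteq> (carrier R \<times> (carrier R - {\<zero>})) \<times> (carrier R \<times> (carrier R - {\<zero>}))"
    by (auto simp: frac_rel_def)
  show "refl_on (carrier R \<times> (carrier R - {\<zero>})) (frac_rel R)"
    by (auto simp: refl_on_def frac_rel_def)
  show "sym (frac_rel R)"
    by (auto simp: sym_def frac_rel_def)
  show "trans (frac_rel R)"
  proof (rule transI)
    fix x y z assume xy: "(x, y) \<in> frac_rel R" and yz: "(y, z) \<in> frac_rel R"
    obtain a b where x: "x = (a, b)" by (cases x)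
    obtain c d where y: "y = (c, d)" by (cases y)
    obtain e f where z: "z = (e, f)" by (cases z)
    have h: "a \<in> carrier R" "b \<in> carrier R" "b \<noteq> \<zero>" "c \<in> carrier R" "d \<in> carrier R" "d \<noteq> \<zero>"
      "e \<in> carrier R" "f \<in> carrier R" "f \<noteq> \<zero>" and ad: "a \<otimes> d = c \<otimes> b" and cf: "c \<otimes> f = e \<otimes> d"
      using xy yz by (auto simp: x y z frac_rel_iff)
    \<comment> \<open>The middle denominator \<open>d\<close> is multiplied in and cancelled; this
      is where the absence of zero divisors matters.\<close>
    have "d \<otimes> (a \<otimes> f) = (a \<otimes> d) \<otimes> f" using h by (simp add: m_ac)
    also have "\<dots> = (c \<otimes> f) \<otimes> b" unfolding ad using h by (simp add: m_ac)
    also have "\<dots> = d \<otimes> (e \<otimes> b)" unfolding cf using h by (simp add: m_ac)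
    finally have "a \<otimes> f = e \<otimes> b" using h by (simp add: m_lcancel)
    then show "(x, z) \<in> frac_rel R" using h by (simp add: x z frac_rel_iff)
  qed
qed

lemma frac_eq_iff:
  assumes "a \<in> carrier R" "b \<in> carrier R" "b \<noteq> \<zero>" "c \<in> carrier R" "d \<in> carrier R" "d \<noteq> \<zero>"
  shows "frac R a b = frac R c d \<longleftrightarrow> a \<otimes> d = c \<otimes> b"
  unfolding frac_def using eq_equiv_class_iff[OF frac_rel_equiv, of "(a, b)" "(c, d)"] assms
  by (simp add: frac_rel_iff)

lemma mem_frac_iff:
  assumes "a \<in> carrier R" "b \<in> carrier R" "b \<noteq> \<zero>"
  shows "(c, d) \<in> frac R a b \<longleftrightarrow> c \<in> carrier R \<and> d \<in> carrier R \<and> d \<noteq> \<zero> \<and> a \<otimes> d = c \<otimes> b"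
  using assms by (auto simp: frac_def frac_rel_iff)

lemma frac_closed:
  assumes "a \<in> carrier R" "b \<in> carrier R" "b \<noteq> \<zero>"
  shows "frac R a b \<in> carrier (frac_field R)"
  using assms by (auto simp: frac_def frac_field_def quotient_def)

lemma frac_cases:
  assumes "x \<in> carrier (frac_field R)"
  obtains a b where "a \<in> carrier R" "b \<in> carrier R" "b \<noteq> \<zero>" "x = frac R a b"
  using assms by (auto simp: frac_def frac_field_def elim!: quotientE)

lemma frac_mult:
  assumes "a \<in> carrier R" "b \<in> carrier R" "b \<noteq> \<zero>" "c \<in> carrier R" "d \<in> carrier R" "d \<noteq> \<zero>"
  shows "frac R a b \<otimes>\<^bsub>frac_field R\<^esub> frac R c d = frac R (a \<otimes> c) (b \<otimes> d)"
proof -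
  have *: "frac R (a' \<otimes> c') (b' \<otimes> d') = frac R (a \<otimes> c) (b \<otimes> d)"
    if "(a', b') \<in> frac R a b" "(c', d') \<in> frac R c d" for a' b' c' d'
  proof -
    have h: "a' \<in> carrier R" "b' \<in> carrier R" "b' \<noteq> \<zero>" "a \<otimes> b' = a' \<otimes> b"
      "c' \<in> carrier R" "d' \<in> carrier R" "d' \<noteq> \<zero>" "c \<otimes> d' = c' \<otimes> d"
      using that assms by (auto simp: mem_frac_iff)
    have "(a' \<otimes> c') \<otimes> (b \<otimes> d) = (a' \<otimes> b) \<otimes> (c' \<otimes> d)" using h(1-3,5-7) assms by (simp add: m_ac)
    also have "\<dots> = (a \<otimes> b') \<otimes> (c \<otimes> d')" using h by simp
    also have "\<dots> = (a \<otimes> c) \<otimes> (b' \<otimes> d')" using h(1-3,5-7) assms by (simp add: m_ac)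
    finally show ?thesis using h assms by (simp add: frac_eq_iff integral_iff)
  qed
  have "(a, b) \<in> frac R a b" "(c, d) \<in> frac R c d" using assms by (auto simp: mem_frac_iff)
  then have "(\<Union>(a', b')\<in>frac R a b. \<Union>(c', d')\<in>frac R c d. frac R (a' \<otimes> c') (b' \<otimes> d'))
      = frac R (a \<otimes> c) (b \<otimes> d)"
    by (rule Union_pairs_const) (rule *)
  then show ?thesis by (simp add: frac_field_def)
qed

lemma frac_add:
  assumes "a \<in> carrier R" "b \<in> carrier R" "b \<noteq> \<zero>" "c \<in> carrier R" "d \<in> carrier R" "d \<noteq> \<zero>"
  shows "frac R a b \<oplus>\<^bsub>frac_field R\<^esub> frac R c d = frac R (a \<otimes> d \<oplus> c \<otimes> b) (b \<otimes> d)"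
proof -
  have *: "frac R (a' \<otimes> d' \<oplus> c' \<otimes> b') (b' \<otimes> d') = frac R (a \<otimes> d \<oplus> c \<otimes> b) (b \<otimes> d)"
    if "(a', b') \<in> frac R a b" "(c', d') \<in> frac R c d" for a' b' c' d'
  proof -
    have h: "a' \<in> carrier R" "b' \<in> carrier R" "b' \<noteq> \<zero>" "a \<otimes> b' = a' \<otimes> b"
      "c' \<in> carrier R" "d' \<in> carrier R" "d' \<noteq> \<zero>" "c \<otimes> d' = c' \<otimes> d"
      using that assms by (auto simp: mem_frac_iff)
    have "(a' \<otimes> d' \<oplus> c' \<otimes> b') \<otimes> (b \<otimes> d) = (a' \<otimes> b) \<otimes> (d' \<otimes> d) \<oplus> (c' \<otimes> d) \<otimes> (b' \<otimes> b)"
      using h(1-3,5-7) assms by (simp add: m_ac l_distr r_distr)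
    also have "\<dots> = (a \<otimes> b') \<otimes> (d' \<otimes> d) \<oplus> (c \<otimes> d') \<otimes> (b' \<otimes> b)" using h by simp
    also have "\<dots> = (a \<otimes> d \<oplus> c \<otimes> b) \<otimes> (b' \<otimes> d')"
      using h(1-3,5-7) assms by (simp add: m_ac l_distr r_distr)
    finally show ?thesis using h assms by (simp add: frac_eq_iff integral_iff)
  qed
  have "(a, b) \<in> frac R a b" "(c, d) \<in> frac R c d" using assms by (auto simp: mem_frac_iff)
  then have "(\<Union>(a', b')\<in>frac R a b. \<Union>(c', d')\<in>frac R c d.
        frac R (a' \<otimes> d' \<oplus> c' \<otimes> b') (b' \<otimes> d'))
      = frac R (a \<otimes> d \<oplus> c \<otimes> b) (b \<otimes> d)"
    by (rule Union_pairs_const) (rule *)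
  then show ?thesis by (simp add: frac_field_def)
qed

lemma frac_zero: "\<zero>\<^bsub>frac_field R\<^esub> = frac R \<zero> \<one>"
  and frac_one: "\<one>\<^bsub>frac_field R\<^esub> = frac R \<one> \<one>"
  by (simp_all add: frac_field_def)

lemmas frac_simps = frac_mult frac_add frac_zero frac_one frac_eq_iff integral_iff
  m_ac l_distr r_distr a_ac

theorem frac_field_is_field: "field (frac_field R)"
proof -
  interpret K: cring "frac_field R"
  proof (intro cringI abelian_groupI comm_monoidI)
    fix x y z
    assume xyz: "x \<in> carrier (frac_field R)" "y \<in> carrier (frac_field R)" "z \<in> carrier (frac_field R)"
    obtain a b where x: "a \<in> carrier R" "b \<in> carrier R" "b \<noteq> \<zero>" "x = frac R a b"
      using xyz(1) by (rule frac_cases)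
    obtain c d where y: "c \<in> carrier R" "d \<in> carrier R" "d \<noteq> \<zero>" "y = frac R c d"
      using xyz(2) by (rule frac_cases)
    obtain e f where z: "e \<in> carrier R" "f \<in> carrier R" "f \<noteq> \<zero>" "z = frac R e f"
      using xyz(3) by (rule frac_cases)
    show "x \<otimes>\<^bsub>frac_field R\<^esub> y \<otimes>\<^bsub>frac_field R\<^esub> z = x \<otimes>\<^bsub>frac_field R\<^esub> (y \<otimes>\<^bsub>frac_field R\<^esub> z)"
      using x y z by (simp add: frac_simps)
    show "x \<oplus>\<^bsub>frac_field R\<^esub> y \<oplus>\<^bsub>frac_field R\<^esub> z = x \<oplus>\<^bsub>frac_field R\<^esub> (y \<oplus>\<^bsub>frac_field R\<^esub> z)"
      using x y z by (simp add: frac_simps)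
    show "(x \<oplus>\<^bsub>frac_field R\<^esub> y) \<otimes>\<^bsub>frac_field R\<^esub> z
        = x \<otimes>\<^bsub>frac_field R\<^esub> z \<oplus>\<^bsub>frac_field R\<^esub> y \<otimes>\<^bsub>frac_field R\<^esub> z"
      using x y z by (simp add: frac_simps)
  next
    fix x y
    assume xyz: "x \<in> carrier (frac_field R)" "y \<in> carrier (frac_field R)"
    obtain a b where x: "a \<in> carrier R" "b \<in> carrier R" "b \<noteq> \<zero>" "x = frac R a b"
      using xyz(1) by (rule frac_cases)
    obtain c d where y: "c \<in> carrier R" "d \<in> carrier R" "d \<noteq> \<zero>" "y = frac R c d"
      using xyz(2) by (rule frac_cases)
    show "x \<oplus>\<^bsub>frac_field R\<^esub> y \<in> carrier (frac_field R)"
      "x \<otimes>\<^bsub>frac_field R\<^esub> y \<in> carrier (frac_field R)"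
      using x y by (simp_all add: frac_mult frac_add frac_closed integral_iff)
    show "x \<oplus>\<^bsub>frac_field R\<^esub> y = y \<oplus>\<^bsub>frac_field R\<^esub> x"
      "x \<otimes>\<^bsub>frac_field R\<^esub> y = y \<otimes>\<^bsub>frac_field R\<^esub> x"
      using x y by (simp_all add: frac_simps)
  next
    fix x assume "x \<in> carrier (frac_field R)"
    then obtain a b where x: "a \<in> carrier R" "b \<in> carrier R" "b \<noteq> \<zero>" "x = frac R a b"
      by (rule frac_cases)
    show "\<zero>\<^bsub>frac_field R\<^esub> \<oplus>\<^bsub>frac_field R\<^esub> x = x" "\<one>\<^bsub>frac_field R\<^esub> \<otimes>\<^bsub>frac_field R\<^esub> x = x"
      using x by (simp_all add: frac_simps)
    have "frac R (\<ominus> a) b \<oplus>\<^bsub>frac_field R\<^esub> x = \<zero>\<^bsub>frac_field R\<^esub>"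
      using x by (simp add: frac_add frac_zero frac_eq_iff integral_iff l_minus l_neg)
    then show "\<exists>y\<in>carrier (frac_field R). y \<oplus>\<^bsub>frac_field R\<^esub> x = \<zero>\<^bsub>frac_field R\<^esub>"
      using x frac_closed a_inv_closed by blast
  qed (auto simp: frac_zero frac_one frac_closed)
  show ?thesis
  proof (rule K.cring_fieldI2)
    show "\<zero>\<^bsub>frac_field R\<^esub> \<noteq> \<one>\<^bsub>frac_field R\<^esub>" by (simp add: frac_zero frac_one frac_eq_iff)
    fix x assume "x \<in> carrier (frac_field R)" "x \<noteq> \<zero>\<^bsub>frac_field R\<^esub>"
    then obtain a b where x: "a \<in> carrier R" "b \<in> carrier R" "b \<noteq> \<zero>" "x = frac R a b"
      using frac_cases by metis
    then have "a \<noteq> \<zero>" using \<open>x \<noteq> \<zero>\<^bsub>frac_field R\<^esub>\<close> by (auto simp: frac_zero frac_eq_iff)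
    with x have "frac R b a \<in> carrier (frac_field R)"
      "x \<otimes>\<^bsub>frac_field R\<^esub> frac R b a = \<one>\<^bsub>frac_field R\<^esub>"
      by (simp_all add: frac_closed frac_mult frac_one frac_eq_iff integral_iff m_comm)
    then show "\<exists>y\<in>carrier (frac_field R). x \<otimes>\<^bsub>frac_field R\<^esub> y = \<one>\<^bsub>frac_field R\<^esub>" by blast
  qed
qed

lemma frac_embed_hom: "ring_hom_cring R (frac_field R) (\<lambda>a. frac R a \<one>)"
proof -
  interpret K: field "frac_field R" by (rule frac_field_is_field)
  show ?thesis
    by (intro ring_hom_cringI is_cring K.is_cring ring_hom_memI)
      (simp_all add: frac_closed frac_mult frac_add frac_one)
qed

text \<open>Serves to turn a linear relation over the fraction field into one over the domain, where
  monomials and weights make sense.\<close>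

lemma frac_common_denominator:
  assumes "finite A" "\<And>x. x \<in> A \<Longrightarrow> c x \<in> carrier (frac_field R)"
  obtains d a where "d \<in> carrier R" "d \<noteq> \<zero>" "\<And>x. x \<in> A \<Longrightarrow> a x \<in> carrier R"
    "\<And>x. x \<in> A \<Longrightarrow> frac R d \<one> \<otimes>\<^bsub>frac_field R\<^esub> c x = frac R (a x) \<one>"
proof -
  have "\<exists>d a. d \<in> carrier R \<and> d \<noteq> \<zero> \<and> (\<forall>x\<in>A. a x \<in> carrier R \<and>
      frac R d \<one> \<otimes>\<^bsub>frac_field R\<^esub> c x = frac R (a x) \<one>)"
    using assms
  proof (induction A rule: finite_induct)
    case empty
    then show ?case by (intro exI[of _ \<one>]) auto
  next
    case (insert y A)
    have "\<exists>d a. d \<in> carrier R \<and> d \<noteq> \<zero> \<and> (\<forall>x\<in>A. a x \<in> carrier R \<and>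
      frac R d \<one> \<otimes>\<^bsub>frac_field R\<^esub> c x = frac R (a x) \<one>)"
      by (rule insert.IH) (simp add: insert.prems)
    then obtain d a where da: "d \<in> carrier R" "d \<noteq> \<zero>" "\<And>x. x \<in> A \<Longrightarrow> a x \<in> carrier R"
      "\<And>x. x \<in> A \<Longrightarrow> frac R d \<one> \<otimes>\<^bsub>frac_field R\<^esub> c x = frac R (a x) \<one>"
      by blast
    have "c y \<in> carrier (frac_field R)" using insert by simp
    then obtain p q where pq: "p \<in> carrier R" "q \<in> carrier R" "q \<noteq> \<zero>" "c y = frac R p q"
      by (rule frac_cases)
    interpret K: field "frac_field R" by (rule frac_field_is_field)
    have "frac R (q \<otimes> d) \<one> \<otimes>\<^bsub>frac_field R\<^esub> c x = frac R (q \<otimes> a x) \<one>" if "x \<in> A" for x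
    proof -
      have "frac R (q \<otimes> d) \<one> = frac R q \<one> \<otimes>\<^bsub>frac_field R\<^esub> frac R d \<one>"
        using da pq by (simp add: frac_mult)
      then have "frac R (q \<otimes> d) \<one> \<otimes>\<^bsub>frac_field R\<^esub> c x
          = frac R q \<one> \<otimes>\<^bsub>frac_field R\<^esub> (frac R d \<one> \<otimes>\<^bsub>frac_field R\<^esub> c x)"
        using da pq insert.prems that by (simp add: K.m_assoc frac_closed)
      then show ?thesis using da pq that by (simp add: frac_mult)
    qed
    moreover have "frac R (q \<otimes> d) \<one> \<otimes>\<^bsub>frac_field R\<^esub> c y = frac R (d \<otimes> p) \<one>"
      using da pq by (simp add: frac_mult frac_eq_iff m_ac integral_iff)
    \<comment> \<open>The new common denominator is \<open>q \<otimes> d\<close>: old numerators are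
      scaled by the new denominator \<open>q\<close>, the new numerator by the old
      \<open>d\<close>.\<close>
    ultimately show ?case using da pq insert.hyps
      by (intro exI[of _ "q \<otimes> d"] exI[of _ "\<lambda>x. if x = y then d \<otimes> p else q \<otimes> a x"])
        (auto simp: integral_iff)
  qed
  then show ?thesis using that by blast
qed

end

text \<open>Gaussian elimination by induction on the equations: an equation with a nonzero
  coefficient is solved for one unknown, which removes one equation and one unknown. This is the
  linear algebra behind the rank bound.\<close>

lemma (in field) homogeneous_system:
  assumes "finite A" "finite I" "card I < card A"
    and "\<And>i x. i \<in> I \<Longrightarrow> x \<in> A \<Longrightarrow> a i x \<in> carrier R"
  obtains c where "\<And>x. x \<in> A \<Longrightarrow> c x \<in> carrier R" "\<exists>x\<in>A. c x \<noteq> \<zero>"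
    "\<And>i. i \<in> I \<Longrightarrow> (\<Oplus>x\<in>A. c x \<otimes> a i x) = \<zero>"
proof -
  have "\<exists>c. (\<forall>x\<in>A. c x \<in> carrier R) \<and> (\<exists>x\<in>A. c x \<noteq> \<zero>) \<and> (\<forall>i\<in>I. (\<Oplus>x\<in>A. c x \<otimes> a i x) = \<zero>)"
    using assms(2,1,3,4)
  proof (induction I arbitrary: A a rule: finite_induct)
    case empty
    then show ?case by (intro exI[of _ "\<lambda>_. \<one>"]) (auto simp: card_gt_0_iff)
  next
    case (insert j I)
    show ?case
    proof (cases "\<forall>x\<in>A. a j x = \<zero>")
      case True
      have "\<exists>c. (\<forall>x\<in>A. c x \<in> carrier R) \<and> (\<exists>x\<in>A. c x \<noteq> \<zero>) \<and> (\<forall>i\<in>I. (\<Oplus>x\<in>A. c x \<otimes> a i x) = \<zero>)"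
        by (rule insert.IH) (use insert in auto)
      then obtain c where c: "\<forall>x\<in>A. c x \<in> carrier R" "\<exists>x\<in>A. c x \<noteq> \<zero>"
        "\<forall>i\<in>I. (\<Oplus>x\<in>A. c x \<otimes> a i x) = \<zero>" by blast
      have "(\<Oplus>x\<in>A. c x \<otimes> a j x) = \<zero>" using c True by (intro finsum_zeroI) auto
      with c show ?thesis by (intro exI[of _ c]) auto
    next
      case False
      then obtain p where p: "p \<in> A" "a j p \<noteq> \<zero>" by auto
      define B where "B = A - {p}"
      have B: "finite B" "p \<notin> B" "A = insert p B" using p insert.prems by (auto simp: B_def)
      have ca: "a i x \<in> carrier R" if "i \<in> insert j I" "x \<in> A" for i x using insert.prems that by blast
      have inv: "inv (a j p) \<in> carrier R" "inv (a j p) \<otimes> a j p = \<one>"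
        using p ca by (auto simp: field_Units)
      \<comment> \<open>The coefficients of the remaining equations after the unknown
        \<open>p\<close> has been eliminated with equation \<open>j\<close>.\<close>
      define b where "b i x = a i x \<ominus> a j x \<otimes> (inv (a j p) \<otimes> a i p)" for i x
      have cb: "b i x \<in> carrier R" if "i \<in> I" "x \<in> B" for i x
        using that ca B inv by (auto simp: b_def)
      have "\<exists>c. (\<forall>x\<in>B. c x \<in> carrier R) \<and> (\<exists>x\<in>B. c x \<noteq> \<zero>) \<and> (\<forall>i\<in>I. (\<Oplus>x\<in>B. c x \<otimes> b i x) = \<zero>)"
        by (rule insert.IH) (use insert.prems insert.hyps B cb in auto)
      then obtain c where c: "\<And>x. x \<in> B \<Longrightarrow> c x \<in> carrier R" "\<exists>x\<in>B. c x \<noteq> \<zero>"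
        "\<And>i. i \<in> I \<Longrightarrow> (\<Oplus>x\<in>B. c x \<otimes> b i x) = \<zero>" by blast
      define s where "s = (\<Oplus>x\<in>B. c x \<otimes> a j x)"
      have s: "s \<in> carrier R" using c ca B by (auto simp: s_def intro!: finsum_closed)
      \<comment> \<open>The value at \<open>p\<close> is the one that equation \<open>j\<close>
        forces, given a solution \<open>c\<close> of the reduced system.\<close>
      define c' where "c' = c(p := \<ominus> (s \<otimes> inv (a j p)))"
      have c': "c' x \<in> carrier R" if "x \<in> A" for x
        using that B c s inv by (auto simp: c'_def)
      have sum_eq: "(\<Oplus>x\<in>A. c' x \<otimes> a i x)
          = \<ominus> (s \<otimes> inv (a j p)) \<otimes> a i p \<oplus> (\<Oplus>x\<in>B. c x \<otimes> a i x)" if i: "i \<in> insert j I" for i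
      proof -
        have "(\<Oplus>x\<in>A. c' x \<otimes> a i x) = c' p \<otimes> a i p \<oplus> (\<Oplus>x\<in>B. c' x \<otimes> a i x)"
          using B c' ca i by (simp add: Pi_iff)
        also have "(\<Oplus>x\<in>B. c' x \<otimes> a i x) = (\<Oplus>x\<in>B. c x \<otimes> a i x)"
          using B c ca i by (intro finsum_cong') (auto simp: c'_def)
        finally show ?thesis by (simp add: c'_def)
      qed
      have "(\<Oplus>x\<in>A. c' x \<otimes> a j x) = \<zero>"
      proof -
        have "\<ominus> (s \<otimes> inv (a j p)) \<otimes> a j p = \<ominus> s"
          using s inv p ca by (simp add: l_minus m_assoc)
        then show ?thesis using sum_eq[of j] s by (simp add: s_def[symmetric] l_neg)
      qed
      moreover have "(\<Oplus>x\<in>A. c' x \<otimes> a i x) = \<zero>" if i: "i \<in> I" for i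
      proof -
        have ai: "a i p \<in> carrier R" using ca i p by auto
        have "(\<Oplus>x\<in>B. c x \<otimes> b i x)
            = (\<Oplus>x\<in>B. c x \<otimes> a i x \<oplus> \<ominus> (inv (a j p) \<otimes> a i p) \<otimes> (c x \<otimes> a j x))"
          using B c ca inv i ai
          by (intro finsum_cong') (auto simp: b_def minus_eq r_distr l_minus r_minus m_ac)
        also have "\<dots> = (\<Oplus>x\<in>B. c x \<otimes> a i x) \<oplus> \<ominus> (inv (a j p) \<otimes> a i p) \<otimes> s"
          using B c ca inv i ai unfolding s_def
          by (subst finsum_addf) (auto simp: finsum_rdistr Pi_iff)
        finally have "(\<Oplus>x\<in>B. c x \<otimes> a i x) \<oplus> \<ominus> (inv (a j p) \<otimes> a i p) \<otimes> s = \<zero>" using c i by simp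
        moreover have "\<ominus> (s \<otimes> inv (a j p)) \<otimes> a i p = \<ominus> (inv (a j p) \<otimes> a i p) \<otimes> s"
          using s inv ai by (simp add: l_minus r_minus m_ac)
        moreover have "(\<Oplus>x\<in>B. c x \<otimes> a i x) \<in> carrier R"
          using B c ca i by (auto intro!: finsum_closed)
        ultimately show ?thesis using sum_eq[of i] i s inv ai by (simp add: a_comm)
      qed
      moreover have "\<exists>x\<in>A. c' x \<noteq> \<zero>" using c(2) B by (auto simp: c'_def)
      ultimately show ?thesis using c' by (intro exI[of _ c']) auto
    qed
  qed
  then show ?thesis using that by blast
qed

section \<open>The Raz--Yehudayoff recursion\<close>

declare One_nat_def [simp del]

context cring
begin

lemma ry_poly_closed:
  assumes "\<And>i k j. i \<in> {1..n} \<Longrightarrow> k \<in> {1..n} \<Longrightarrow> j \<in> {1..n} \<Longrightarrow> w i k j \<in> carrier R"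
    and "1 \<le> i" "j \<le> n"
  shows "ry_poly R n w i j \<in> carrier (mpoly_ring R {1..n})"
  using assms(2,3)
proof (induction "Suc j - i" arbitrary: i j rule: less_induct)
  case less
  interpret M: cring "mpoly_ring R {1..n}" by (rule mpoly_cring)
  show ?case
  proof (cases "j < i")
    case True
    then show ?thesis by (subst ry_poly.simps) simp
  next
    case False
    have "indexed_const (w i k j) \<otimes>\<^bsub>mpoly_ring R {1..n}\<^esub> ry_poly R n w i k
            \<otimes>\<^bsub>mpoly_ring R {1..n}\<^esub> ry_poly R n w (k + 1) j \<in> carrier (mpoly_ring R {1..n})"
      if "k \<in> {k \<in> {i + 1..j - 2}. even (k + 1 - i)}" for k
      using that less assms(1)
      by (intro M.m_closed indexed_const_closed less.hyps) auto
    moreover have "ry_poly R n w (i + 1) (j - 1) \<in> carrier (mpoly_ring R {1..n})"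
      using False less by (intro less.hyps) auto
    moreover have "indexed_var i \<in> carrier (mpoly_ring R {1..n})"
      "indexed_var j \<in> carrier (mpoly_ring R {1..n})"
      using less.prems False by (auto intro!: indexed_var_closed)
    ultimately show ?thesis using False
      by (subst ry_poly.simps) (auto intro!: M.finsum_closed)
  qed
qed

text \<open>The factor \<open>1 + x\<^sub>i x\<^sub>j\<close> contributes the inner coefficient at
  \<open>m\<close> itself and, if \<open>x\<^sub>i x\<^sub>j\<close> divides \<open>m\<close>, the
  one at the quotient. All further work with the recursion goes through this form.\<close>

lemma ry_poly_coeff:
  assumes w: "\<And>i k j. i \<in> {1..n} \<Longrightarrow> k \<in> {1..n} \<Longrightarrow> j \<in> {1..n} \<Longrightarrow> w i k j \<in> carrier R"
    and ij: "1 \<le> i" "j \<le> n" "i \<le> j"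
  shows "ry_poly R n w i j m =
    ry_poly R n w (i + 1) (j - 1) m
    \<oplus> (if {#i, j#} \<subseteq># m then ry_poly R n w (i + 1) (j - 1) (m - {#i, j#}) else \<zero>)
    \<oplus> (\<Oplus>k \<in> {k \<in> {i + 1..j - 2}. even (k + 1 - i)}.
        w i k j \<otimes> (ry_poly R n w i k \<otimes>\<^bsub>mpoly_ring R {1..n}\<^esub> ry_poly R n w (k + 1) j) m)"
proof -
  interpret M: cring "mpoly_ring R {1..n}" by (rule mpoly_cring)
  let ?M = "mpoly_ring R {1..n}"
  let ?K = "{k \<in> {i + 1..j - 2}. even (k + 1 - i)}"
  let ?g = "ry_poly R n w (i + 1) (j - 1)"
  have cl: "ry_poly R n w i' j' \<in> carrier ?M" if "1 \<le> i'" "j' \<le> n" for i' j'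
    using that w by (intro ry_poly_closed)
  have x: "indexed_var i \<in> carrier ?M" "indexed_var j \<in> carrier ?M"
    using ij by (auto intro!: indexed_var_closed)
  have g: "?g \<in> carrier ?M" using ij by (intro cl) auto
  then have gc: "?g m \<in> carrier R" for m by (rule mpoly_coeff_closed)
  have wk: "w i k j \<in> carrier R" if "k \<in> ?K" for k
    using that ij by (intro w) auto
  have hk: "ry_poly R n w i k \<in> carrier ?M" "ry_poly R n w (k + 1) j \<in> carrier ?M" if "k \<in> ?K" for k
    using that ij by (auto simp only: mem_Collect_eq atLeastAtMost_iff intro!: cl)
  have 1: "((\<one>\<^bsub>?M\<^esub> \<oplus>\<^bsub>?M\<^esub> indexed_var i \<otimes>\<^bsub>?M\<^esub> indexed_var j) \<otimes>\<^bsub>?M\<^esub> ?g) m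
      = ?g m \<oplus> (if {#i, j#} \<subseteq># m then ?g (m - {#i, j#}) else \<zero>)"
  proof -
    have "(\<one>\<^bsub>?M\<^esub> \<oplus>\<^bsub>?M\<^esub> indexed_var i \<otimes>\<^bsub>?M\<^esub> indexed_var j) \<otimes>\<^bsub>?M\<^esub> ?g
        = ?g \<oplus>\<^bsub>?M\<^esub> indexed_var i \<otimes>\<^bsub>?M\<^esub> (indexed_var j \<otimes>\<^bsub>?M\<^esub> ?g)"
      using g x by (simp add: M.l_distr M.m_assoc)
    moreover have "(indexed_var i \<otimes>\<^bsub>?M\<^esub> (indexed_var j \<otimes>\<^bsub>?M\<^esub> ?g)) m
        = (if {#i, j#} \<subseteq># m then ?g (m - {#i, j#}) else \<zero>)"
      using gc by (subst mpoly_var_mult)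
        (auto simp: mpoly_var_mult insert_subset_eq_iff add_mset_commute[of j i])
    ultimately show ?thesis by simp
  qed
  have 2: "(indexed_const (w i k j) \<otimes>\<^bsub>?M\<^esub> ry_poly R n w i k \<otimes>\<^bsub>?M\<^esub> ry_poly R n w (k + 1) j) m
      = w i k j \<otimes> (ry_poly R n w i k \<otimes>\<^bsub>?M\<^esub> ry_poly R n w (k + 1) j) m" if k: "k \<in> ?K" for k
  proof -
    have "indexed_const (w i k j) \<otimes>\<^bsub>?M\<^esub> ry_poly R n w i k \<otimes>\<^bsub>?M\<^esub> ry_poly R n w (k + 1) j
        = indexed_const (w i k j) \<otimes>\<^bsub>?M\<^esub> (ry_poly R n w i k \<otimes>\<^bsub>?M\<^esub> ry_poly R n w (k + 1) j)"
      using wk hk k by (intro M.m_assoc indexed_const_closed)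
    then show ?thesis
      using wk[OF k] mpoly_coeff_closed[OF M.m_closed[OF hk[OF k]]] by (simp add: mpoly_const_mult)
  qed
  have "(\<Oplus>\<^bsub>?M\<^esub>k\<in>?K. indexed_const (w i k j) \<otimes>\<^bsub>?M\<^esub> ry_poly R n w i k \<otimes>\<^bsub>?M\<^esub> ry_poly R n w (k + 1) j) m
     = (\<Oplus>k\<in>?K. (indexed_const (w i k j) \<otimes>\<^bsub>?M\<^esub> ry_poly R n w i k \<otimes>\<^bsub>?M\<^esub> ry_poly R n w (k + 1) j) m)"
    using wk hk by (intro mpoly_finsum_apply) (auto intro!: M.m_closed indexed_const_closed)
  also have "\<dots> = (\<Oplus>k\<in>?K. w i k j \<otimes> (ry_poly R n w i k \<otimes>\<^bsub>?M\<^esub> ry_poly R n w (k + 1) j) m)"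
    using wk mpoly_coeff_closed[OF M.m_closed[OF hk]]
    by (intro finsum_cong' 2) auto
  finally have 3: "(\<Oplus>\<^bsub>?M\<^esub>k\<in>?K. indexed_const (w i k j) \<otimes>\<^bsub>?M\<^esub> ry_poly R n w i k \<otimes>\<^bsub>?M\<^esub> ry_poly R n w (k + 1) j) m
     = (\<Oplus>k\<in>?K. w i k j \<otimes> (ry_poly R n w i k \<otimes>\<^bsub>?M\<^esub> ry_poly R n w (k + 1) j) m)" .
  show ?thesis using ij
    by (subst ry_poly.simps) (simp only: not_less[symmetric] if_False mpoly_ring_sel(1) 1 3)
qed

end

text \<open>The recursion only adds and multiplies. Applied to the embedding of polynomials into
  fractions, this moves the polynomial to coefficients that are polynomials in the \<open>w\<close>,
  where weights can be assigned.\<close>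

lemma (in ring_hom_cring) ry_poly_hom:
  assumes w: "\<And>i k j. i \<in> {1..n} \<Longrightarrow> k \<in> {1..n} \<Longrightarrow> j \<in> {1..n} \<Longrightarrow> w i k j \<in> carrier R"
    and "1 \<le> i" "j \<le> n"
  shows "ry_poly S n (\<lambda>i k j. h (w i k j)) i j m = h (ry_poly R n w i j m)"
  using assms(2,3)
proof (induction "Suc j - i" arbitrary: i j m rule: less_induct)
  case less
  show ?case
  proof (cases "j < i")
    case True
    then show ?thesis by (simp add: ry_poly.simps)
  next
    case False
    have cR: "ry_poly R n w i' j' m \<in> carrier R" if "1 \<le> i'" "j' \<le> n" for i' j' m
      using that w R.ry_poly_closed R.mpoly_coeff_closed by blast
    have IH: "ry_poly S n (\<lambda>i k j. h (w i k j)) i' j' m = h (ry_poly R n w i' j' m)"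
      if "Suc j' - i' < Suc j - i" "1 \<le> i'" "j' \<le> n" for i' j' m
      using that by (rule less.hyps)
    let ?K = "{k \<in> {i + 1..j - 2}. even (k + 1 - i)}"
    have wk: "w i k j \<in> carrier R" if "k \<in> ?K" for k
      using that less.prems by (intro w) auto
    have prod: "(ry_poly S n (\<lambda>i k j. h (w i k j)) i k \<otimes>\<^bsub>mpoly_ring S {1..n}\<^esub>
        ry_poly S n (\<lambda>i k j. h (w i k j)) (k + 1) j) m
      = h ((ry_poly R n w i k \<otimes>\<^bsub>mpoly_ring R {1..n}\<^esub> ry_poly R n w (k + 1) j) m)"
      if k: "k \<in> ?K" for k
    proof -
      have r: "1 \<le> i" "k \<le> n" "1 \<le> k + 1" "j \<le> n" "Suc k - i < Suc j - i" "Suc j - (k + 1) < Suc j - i"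
        using k less.prems by auto
      have "(\<lambda>m'. ry_poly R n w i k m' \<otimes>\<^bsub>R\<^esub> ry_poly R n w (k + 1) j (m - m')) \<in> {m'. m' \<subseteq># m} \<rightarrow> carrier R"
        using cR r by auto
      then show ?thesis using r
        by (simp add: IH cR R.mpoly_mult_apply S.mpoly_mult_apply)
          (intro S.finsum_cong', auto simp: cR)
    qed
    have pc: "(ry_poly R n w i k \<otimes>\<^bsub>mpoly_ring R {1..n}\<^esub> ry_poly R n w (k + 1) j) m \<in> carrier R"
      if k: "k \<in> ?K" for k
      using k less.prems w
      by (intro R.mpoly_coeff_closed[OF R.mpoly_mult_closed] R.ry_poly_closed) auto
    have sum: "(\<Oplus>\<^bsub>S\<^esub>k\<in>?K. h (w i k j) \<otimes>\<^bsub>S\<^esub> (ry_poly S n (\<lambda>i k j. h (w i k j)) i k \<otimes>\<^bsub>mpoly_ring S {1..n}\<^esub>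
        ry_poly S n (\<lambda>i k j. h (w i k j)) (k + 1) j) m)
       = h (\<Oplus>\<^bsub>R\<^esub>k\<in>?K. w i k j \<otimes>\<^bsub>R\<^esub> (ry_poly R n w i k \<otimes>\<^bsub>mpoly_ring R {1..n}\<^esub> ry_poly R n w (k + 1) j) m)"
    proof -
      have "h (\<Oplus>\<^bsub>R\<^esub>k\<in>?K. w i k j \<otimes>\<^bsub>R\<^esub> (ry_poly R n w i k \<otimes>\<^bsub>mpoly_ring R {1..n}\<^esub> ry_poly R n w (k + 1) j) m)
        = (\<Oplus>\<^bsub>S\<^esub>k\<in>?K. h (w i k j \<otimes>\<^bsub>R\<^esub> (ry_poly R n w i k \<otimes>\<^bsub>mpoly_ring R {1..n}\<^esub> ry_poly R n w (k + 1) j) m))"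
        using wk pc by (subst hom_finsum) (auto simp: comp_def)
      also have "\<dots> = (\<Oplus>\<^bsub>S\<^esub>k\<in>?K. h (w i k j) \<otimes>\<^bsub>S\<^esub> (ry_poly S n (\<lambda>i k j. h (w i k j)) i k \<otimes>\<^bsub>mpoly_ring S {1..n}\<^esub>
        ry_poly S n (\<lambda>i k j. h (w i k j)) (k + 1) j) m)"
      proof (intro S.finsum_cong' refl)
        fix k assume k: "k \<in> ?K"
        show "h (w i k j \<otimes>\<^bsub>R\<^esub> (ry_poly R n w i k \<otimes>\<^bsub>mpoly_ring R {1..n}\<^esub> ry_poly R n w (k + 1) j) m)
          = h (w i k j) \<otimes>\<^bsub>S\<^esub> (ry_poly S n (\<lambda>i k j. h (w i k j)) i k \<otimes>\<^bsub>mpoly_ring S {1..n}\<^esub>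
            ry_poly S n (\<lambda>i k j. h (w i k j)) (k + 1) j) m"
          unfolding prod[OF k] using wk[OF k] pc[OF k] by (rule hom_mult)
      next
        show "(\<lambda>k. h (w i k j) \<otimes>\<^bsub>S\<^esub> (ry_poly S n (\<lambda>i k j. h (w i k j)) i k \<otimes>\<^bsub>mpoly_ring S {1..n}\<^esub>
            ry_poly S n (\<lambda>i k j. h (w i k j)) (k + 1) j) m) \<in> ?K \<rightarrow> carrier S"
        proof
          fix k assume k: "k \<in> ?K"
          show "h (w i k j) \<otimes>\<^bsub>S\<^esub> (ry_poly S n (\<lambda>i k j. h (w i k j)) i k \<otimes>\<^bsub>mpoly_ring S {1..n}\<^esub>
            ry_poly S n (\<lambda>i k j. h (w i k j)) (k + 1) j) m \<in> carrier S"
            unfolding prod[OF k] using wk[OF k] pc[OF k] by (intro S.m_closed hom_closed)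
        qed
      qed
      finally show ?thesis by simp
    qed
    have sc: "(\<Oplus>\<^bsub>R\<^esub>k\<in>?K. w i k j \<otimes>\<^bsub>R\<^esub> (ry_poly R n w i k \<otimes>\<^bsub>mpoly_ring R {1..n}\<^esub> ry_poly R n w (k + 1) j) m) \<in> carrier R"
      using wk pc by (intro R.finsum_closed) auto
    have ij: "1 \<le> i" "j \<le> n" "i \<le> j" using less.prems False by auto
    have hw: "h (w i k j) \<in> carrier S" if "i \<in> {1..n}" "k \<in> {1..n}" "j \<in> {1..n}" for i k j
      using w that by simp
    have "Suc (j - 1) - (i + 1) < Suc j - i" "1 \<le> i + 1" "j - 1 \<le> n" using ij by auto
    note IH' = IH[OF this] and c' = cR[OF this(2,3)]
    show ?thesis
      apply (subst R.ry_poly_coeff[OF w ij], assumption+)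
      apply (subst S.ry_poly_coeff[OF hw ij], assumption+)
      unfolding sum IH' using c' sc by auto
  qed
qed

section \<open>Weights\<close>

text \<open>The discrepancy of an interval, zero exactly when it is balanced. As a function of the
  right end it is a walk with steps 1 and -1.\<close>

definition disc :: "nat set \<Rightarrow> nat \<Rightarrow> nat \<Rightarrow> int" where
  "disc Y i j = (\<Sum>x\<in>{i..j}. if x \<in> Y then 1 else -1)"

lemma disc_empty: "j < i \<Longrightarrow> disc Y i j = 0"
  by (simp add: disc_def)

lemma disc_split: "i \<le> k + 1 \<Longrightarrow> k \<le> j \<Longrightarrow> disc Y i j = disc Y i k + disc Y (k + 1) j"
  unfolding disc_def by (subst sum.union_disjoint[symmetric]) (auto intro!: sum.cong)

lemma disc_single: "disc Y i i = (if i \<in> Y then 1 else -1)"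
  by (simp add: disc_def)

lemma disc_ends:
  assumes "i < j"
  shows "disc Y i j = (if i \<in> Y then 1 else -1) + disc Y (i + 1) (j - 1) + (if j \<in> Y then 1 else -1)"
proof -
  have "disc Y i j = disc Y i i + disc Y (i + 1) j" using assms by (intro disc_split) auto
  also have "disc Y (i + 1) j = disc Y (i + 1) (j - 1) + disc Y (j - 1 + 1) j"
    using assms by (intro disc_split) auto
  finally show ?thesis using assms by (simp add: disc_single)
qed

lemma disc_parity: "i \<le> j + 1 \<Longrightarrow> even (disc Y i j) \<longleftrightarrow> even (j + 1 - i)"
proof (induction "j + 1 - i" arbitrary: i)
  case 0
  then show ?case by (simp add: disc_empty)
next
  case (Suc k)
  then have "i \<le> j" by simp
  then have "disc Y i j = disc Y i i + disc Y (i + 1) j" by (intro disc_split) auto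
  moreover have "even (disc Y (i + 1) j) \<longleftrightarrow> even (j + 1 - (i + 1))"
    using Suc by (intro Suc.hyps) auto
  moreover have "j + 1 - i = Suc (j + 1 - (i + 1))" using \<open>i \<le> j\<close> by simp
  ultimately show ?case by (simp add: disc_single)
qed

text \<open>The walk starts at the sign of the first point. As it ends at 0 with a step of the same
  sign, it has the opposite sign just before the last point, so it vanishes in between. Both parts
  of that split are balanced, and the zero cannot lie at \<open>i\<close> or
  \<open>j - 1\<close>.\<close>

lemma disc_zero_split:
  assumes "disc Y i j = 0" "i < j" "i \<in> Y \<longleftrightarrow> j \<in> Y"
  shows "\<exists>k. k \<in> {i + 1..j - 2} \<and> even (k + 1 - i) \<and> disc Y i k = 0 \<and> disc Y (k + 1) j = 0"
proof -
  \<comment> \<open>The sign is chosen so that \<open>s * disc Y i k\<close> runs from -1 at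
    \<open>k = i\<close> to 1 at \<open>k = j - 1\<close>.\<close>
  define s :: int where "s = (if i \<in> Y then -1 else 1)"
  have last: "disc Y i (j - 1) = s"
    using disc_split[of i "j - 1" j Y] assms by (auto simp: disc_single s_def)
  have step: "disc Y i (Suc k) = disc Y i k + (if Suc k \<in> Y then 1 else -1)" if "i \<le> k" for k
    using disc_split[of i k "Suc k" Y] that by (simp add: disc_single Suc_eq_plus1)
  have "\<exists>k. i \<le> k \<and> k \<le> j - 1 \<and> s * disc Y i k = 0"
  proof (rule nat_intermed_int_val)
    show "\<forall>k. i \<le> k \<and> k < j - 1 \<longrightarrow> \<bar>s * disc Y i (Suc k) - s * disc Y i k\<bar> \<le> 1"
      using step by (auto simp: s_def)
    show "i \<le> j - 1" using assms by simp
    show "s * disc Y i i \<le> 0" by (simp add: s_def disc_single)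
    show "0 \<le> s * disc Y i (j - 1)" by (simp add: last)
  qed
  then obtain k where k: "i \<le> k" "k \<le> j - 1" "disc Y i k = 0" by (auto simp: s_def split: if_splits)
  have "k \<noteq> i" "k \<noteq> j - 1" using k last by (auto simp: disc_single s_def split: if_splits)
  moreover have "disc Y (k + 1) j = 0" using disc_split[of i k j Y] k assms by simp
  moreover have "even (k + 1 - i)" using disc_parity[of i k Y] k by simp
  ultimately show ?thesis using k by (intro exI[of _ k]) auto
qed

text \<open>An interval may have several balanced splits, and their contributions would compete.
  Fixing one of them is what makes the monomial of top weight unique.\<close>

definition split_at :: "nat set \<Rightarrow> nat \<Rightarrow> nat \<Rightarrow> nat" where
  "split_at Y i j = (SOME k. k \<in> {i + 1..j - 2} \<and> even (k + 1 - i) \<and> disc Y i k = 0 \<and> disc Y (k + 1) j = 0)"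

lemma split_at:
  assumes "disc Y i j = 0" "i < j" "i \<in> Y \<longleftrightarrow> j \<in> Y"
  shows "split_at Y i j \<in> {i + 1..j - 2}" "even (split_at Y i j + 1 - i)"
    "disc Y i (split_at Y i j) = 0" "disc Y (split_at Y i j + 1) j = 0"
  unfolding split_at_def using someI_ex[OF disc_zero_split[OF assms]] by blast+

text \<open>
  The weights grow so fast with the length of the interval that on a balanced interval with ends
  on the same side the summand of the chosen balanced split outweighs all others, while every other
  summand with a \<open>w\<close> has negative weight.
\<close>

definition wt :: "nat set \<Rightarrow> wvar \<Rightarrow> int" where
  "wt Y = (\<lambda>(i, k, j). if disc Y i j = 0 \<and> (i \<in> Y \<longleftrightarrow> j \<in> Y) \<and> k = split_at Y i j
     then 4 ^ (j - i) else - (4 ^ (j + 1 - i)))"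

definition weight :: "nat set \<Rightarrow> wvar multiset \<Rightarrow> int" where
  "weight Y q = sum_mset (image_mset (wt Y) q)"

lemma weight_simps [simp]:
  "weight Y {#} = 0" "weight Y (add_mset v q) = wt Y v + weight Y q"
  "weight Y (p + q) = weight Y p + weight Y q"
  by (simp_all add: weight_def)

lemma wt_eq_iff:
  "wt Y (i, k, j) = 4 ^ (j - i) \<longleftrightarrow> disc Y i j = 0 \<and> (i \<in> Y \<longleftrightarrow> j \<in> Y) \<and> k = split_at Y i j"
proof -
  have "- (4 ^ (j + 1 - i)) \<noteq> (4 ^ (j - i) :: int)"
  proof -
    have "(0::int) < 4 ^ (j - i)" "(0::int) < 4 ^ (j + 1 - i)" by simp_all
    then show ?thesis by linarith
  qed
  then show ?thesis by (simp add: wt_def)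
qed

text \<open>Here \<open>a\<close> and \<open>b\<close> stand for the lengths of the two parts of a
  split, each at least 2 less than the whole length \<open>l + 2\<close>. In units of
  \<open>4 ^ l\<close> the favoured split weighs at most 4 + 1 + 1, which is below 16, and any other
  at most -16 + 1 + 1, which is negative.\<close>

lemma wt_bounds:
  assumes "i \<le> j" "a + 2 \<le> j + 1 - i" "b + 2 \<le> j + 1 - i"
  shows "wt Y (i, k, j) + 4 ^ a + 4 ^ b \<le> 4 ^ (j + 1 - i)"
    and "wt Y (i, k, j) \<noteq> 4 ^ (j - i) \<Longrightarrow> wt Y (i, k, j) + 4 ^ a + 4 ^ b < 0"
proof -
  obtain l where l: "j + 1 - i = l + 2" using assms by (metis add.commute le_Suc_ex add_leD2)
  have "(4::int) ^ a \<le> 4 ^ l" "(4::int) ^ b \<le> 4 ^ l"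
    using assms l by (auto intro!: power_increasing)
  moreover have p: "(4::int) ^ (j + 1 - i) = 16 * 4 ^ l" "(4::int) ^ (j - i) = 4 * 4 ^ l"
  proof -
    have "j - i = Suc l" "j + 1 - i = Suc (Suc l)" using l assms by auto
    then show "(4::int) ^ (j + 1 - i) = 16 * 4 ^ l" "(4::int) ^ (j - i) = 4 * 4 ^ l" by simp_all
  qed
  moreover have "wt Y (i, k, j) = 4 ^ (j - i) \<or> wt Y (i, k, j) = - (4 ^ (j + 1 - i))"
    by (simp add: wt_def)
  moreover have "(0::int) < 4 ^ l" by simp
  ultimately show "wt Y (i, k, j) + 4 ^ a + 4 ^ b \<le> 4 ^ (j + 1 - i)"
    "wt Y (i, k, j) \<noteq> 4 ^ (j - i) \<Longrightarrow> wt Y (i, k, j) + 4 ^ a + 4 ^ b < 0"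
    by linarith+
qed

section \<open>Polynomials with polynomial coefficients\<close>

context cring
begin

lemma mpoly_mult_nonzeroE2:
  assumes A: "A \<in> carrier (mpoly_ring (mpoly_ring R V) U)" and B: "B \<in> carrier (mpoly_ring (mpoly_ring R V) U)"
    and nz: "(A \<otimes>\<^bsub>mpoly_ring (mpoly_ring R V) U\<^esub> B) m q \<noteq> \<zero>"
  obtains m1 m2 q1 q2 where "m = m1 + m2" "q = q1 + q2" "A m1 q1 \<noteq> \<zero>" "B m2 q2 \<noteq> \<zero>"
proof -
  interpret M: cring "mpoly_ring R V" by (rule mpoly_cring)
  have c: "A m \<in> carrier (mpoly_ring R V)" "B m \<in> carrier (mpoly_ring R V)" for m
    using A B by (auto intro: M.mpoly_coeff_closed)
  then have c': "A m q \<in> carrier R" "B m q \<in> carrier R" for m q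
    by (auto intro: mpoly_coeff_closed)
  have "(\<Oplus>m'\<in>{m'. m' \<subseteq># m}. (A m' \<otimes>\<^bsub>mpoly_ring R V\<^esub> B (m - m')) q) \<noteq> \<zero>"
    using nz c unfolding M.mpoly_mult_apply
    by (subst (asm) mpoly_finsum_apply) auto
  then obtain m' where m': "m' \<subseteq># m" "(A m' \<otimes>\<^bsub>mpoly_ring R V\<^esub> B (m - m')) q \<noteq> \<zero>"
    by (auto elim: finsum_nonzeroE)
  from m'(2) obtain q1 q2 where "q = q1 + q2" "A m' q1 \<noteq> \<zero>" "B (m - m') q2 \<noteq> \<zero>"
    by (rule mpoly_mult_nonzeroE) (use c' in auto)
  moreover have "m = m' + (m - m')" using m' by simp
  ultimately show ?thesis using that by blast
qed

text \<open>The collapse of the convolution for both levels of variables: \<open>m\<close> are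
  monomials in the x and \<open>q\<close> in the w. Uniqueness is required only of the pair, because
  the two components are controlled by different arguments.\<close>

lemma mpoly_mult_unique2:
  assumes A: "A \<in> carrier (mpoly_ring (mpoly_ring R V) U)" and B: "B \<in> carrier (mpoly_ring (mpoly_ring R V) U)"
    and u: "\<And>n1 n2 r1 r2. n1 + n2 = m1 + m2 \<Longrightarrow> r1 + r2 = q1 + q2 \<Longrightarrow>
      A n1 r1 \<noteq> \<zero> \<Longrightarrow> B n2 r2 \<noteq> \<zero> \<Longrightarrow> n1 = m1 \<and> r1 = q1"
  shows "(A \<otimes>\<^bsub>mpoly_ring (mpoly_ring R V) U\<^esub> B) (m1 + m2) (q1 + q2) = A m1 q1 \<otimes> B m2 q2"
proof -
  interpret M: cring "mpoly_ring R V" by (rule mpoly_cring)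
  have c: "A m \<in> carrier (mpoly_ring R V)" "B m \<in> carrier (mpoly_ring R V)" for m
    using A B by (auto intro: M.mpoly_coeff_closed)
  then have c': "A m q \<in> carrier R" "B m q \<in> carrier R" for m q
    by (auto intro: mpoly_coeff_closed)
  have "(A \<otimes>\<^bsub>mpoly_ring (mpoly_ring R V) U\<^esub> B) (m1 + m2) (q1 + q2)
      = (\<Oplus>m'\<in>{m'. m' \<subseteq># m1 + m2}. (A m' \<otimes>\<^bsub>mpoly_ring R V\<^esub> B (m1 + m2 - m')) (q1 + q2))"
    using c unfolding M.mpoly_mult_apply
    by (subst mpoly_finsum_apply) auto
  also have "\<dots> = (A m1 \<otimes>\<^bsub>mpoly_ring R V\<^esub> B (m1 + m2 - m1)) (q1 + q2)"
  proof (rule finsum_single)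
    fix j assume j: "j \<in> {m'. m' \<subseteq># m1 + m2}" "j \<noteq> m1"
    then have "j + (m1 + m2 - j) = m1 + m2" by simp
    then show "(A j \<otimes>\<^bsub>mpoly_ring R V\<^esub> B (m1 + m2 - j)) (q1 + q2) = \<zero>"
      using u j(2) mpoly_mult_nonzeroE c' by metis
  qed (use c in \<open>auto intro!: mpoly_coeff_closed\<close>)
  also have "\<dots> = (A m1 \<otimes>\<^bsub>mpoly_ring R V\<^esub> B m2) (q1 + q2)" by simp
  also have "\<dots> = A m1 q1 \<otimes> B m2 q2"
  proof (rule mpoly_mult_unique)
    fix r1 r2 assume "r1 + r2 = q1 + q2" "A m1 r1 \<noteq> \<zero>" "B m2 r2 \<noteq> \<zero>"
    then show "r1 = q1" using u[of m1 m2 r1 r2] by blast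
  qed (use c' in auto)
  finally show ?thesis .
qed

lemma mpoly_var_mult_mpoly:
  assumes "A \<in> carrier (mpoly_ring (mpoly_ring R V) U)"
  shows "(indexed_var v \<otimes>\<^bsub>mpoly_ring R V\<^esub> A m) q = (if v \<in># q then A m (q - {#v#}) else \<zero>)"
proof -
  interpret M: cring "mpoly_ring R V" by (rule mpoly_cring)
  show ?thesis
    by (rule mpoly_var_mult, rule mpoly_coeff_closed, rule M.mpoly_coeff_closed, rule assms)
qed

end

section \<open>Perfect matchings and the monomials they generate\<close>

definition pairing :: "nat set \<Rightarrow> (nat \<Rightarrow> nat) \<Rightarrow> nat \<Rightarrow> nat \<Rightarrow> bool" where
  "pairing Y \<tau> i j \<longleftrightarrow> (\<forall>x\<in>{i..j}. \<tau> x \<in> {i..j} \<and> \<tau> (\<tau> x) = x \<and> (\<tau> x \<in> Y \<longleftrightarrow> x \<notin> Y))"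

definition paired :: "(nat \<Rightarrow> nat) \<Rightarrow> nat \<Rightarrow> nat \<Rightarrow> nat multiset \<Rightarrow> bool" where
  "paired \<tau> i j m \<longleftrightarrow>
     set_mset m \<subseteq> {i..j} \<and> (\<forall>x\<in>{i..j}. count m x \<le> 1 \<and> count m (\<tau> x) = count m x)"

text \<open>Multiplication by \<open>1 + x\<^sub>i x\<^sub>j\<close> puts in both end points or
  neither. As \<open>\<tau>\<close> keeps the inner interval to itself, redefining it at
  \<open>i\<close> and \<open>j\<close> does not disturb the inner pairs.\<close>

lemma paired_ends:
  assumes "i < j" "pairing Y \<tau> (i + 1) (j - 1)"
  shows "paired (\<tau>(i := j, j := i)) i j m \<longleftrightarrow> paired \<tau> (i + 1) (j - 1) m \<or>
     ({#i, j#} \<subseteq># m \<and> paired \<tau> (i + 1) (j - 1) (m - {#i, j#}))"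
    (is "?P \<longleftrightarrow> ?A \<or> ?B")
proof -
  have \<tau>: "\<tau> x \<noteq> i" "\<tau> x \<noteq> j" if "x \<in> {i + 1..j - 1}" for x
    using that assms unfolding pairing_def by fastforce+
  have ij: "{i..j} = insert i (insert j {i + 1..j - 1})" "i \<notin> {i + 1..j - 1}" "j \<notin> {i + 1..j - 1}"
    using assms by auto
  have P: "?P \<longleftrightarrow> set_mset m \<subseteq> {i..j} \<and> count m i \<le> 1 \<and> count m j = count m i \<and>
      (\<forall>x\<in>{i + 1..j - 1}. count m x \<le> 1 \<and> count m (\<tau> x) = count m x)"
    using assms(1) ij(2,3) unfolding paired_def by (auto simp: ij(1))
  show ?thesis
  proof (cases "i \<in># m \<and> j \<in># m")
    case True
    then have sub: "{#i, j#} \<subseteq># m" using assms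
      by (auto simp: insert_subset_eq_iff in_diff_count)
    then obtain m' where m': "m = m' + {#i, j#}" by (metis subset_mset.diff_add)
    have cm: "count m x = count m' x" "count m (\<tau> x) = count m' (\<tau> x)" if "x \<in> {i + 1..j - 1}" for x
      using \<tau>[OF that] that assms(1) by (auto simp: m')
    have "\<not> ?A" using True by (auto simp: paired_def dest: subsetD)
    moreover have "?P \<longleftrightarrow> paired \<tau> (i + 1) (j - 1) m'"
    proof
      assume ?P
      then have c: "count m' i = 0" "count m' j = 0" and s: "set_mset m' \<subseteq> {i..j}"
        and r: "\<forall>x\<in>{i + 1..j - 1}. count m x \<le> 1 \<and> count m (\<tau> x) = count m x"
        using assms unfolding P by (auto simp: m')
      have "set_mset m' \<subseteq> {i + 1..j - 1}" using c s unfolding ij(1) count_eq_zero_iff by auto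
      then show "paired \<tau> (i + 1) (j - 1) m'"
        using r cm unfolding paired_def by simp
    next
      assume p: "paired \<tau> (i + 1) (j - 1) m'"
      then have "i \<notin># m'" "j \<notin># m'" using ij by (auto simp: paired_def)
      then have "count m i = 1" "count m j = 1" using assms(1) by (auto simp: m' not_in_iff)
      moreover have "set_mset m \<subseteq> {i..j}" using p unfolding paired_def ij(1) by (auto simp: m')
      moreover have "\<forall>x\<in>{i + 1..j - 1}. count m x \<le> 1 \<and> count m (\<tau> x) = count m x"
        using p cm unfolding paired_def by simp
      ultimately show ?P unfolding P by simp
    qed
    ultimately show ?thesis using sub by (simp add: m')
  next
    case False
    then have "\<not> {#i, j#} \<subseteq># m" by (auto dest: mset_subset_eqD)
    moreover have "?P \<longleftrightarrow> ?A"
    proof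
      assume ?P
      then have "count m i = 0" "count m j = 0" using False unfolding P
        by (auto simp: not_in_iff)
      then have "i \<notin># m" "j \<notin># m" by (auto simp: not_in_iff)
      then have "set_mset m \<subseteq> {i + 1..j - 1}" using \<open>?P\<close> unfolding P ij(1) by auto
      then show ?A using \<open>?P\<close> unfolding P by (simp add: paired_def)
    next
      assume ?A
      then have "i \<notin># m" "j \<notin># m" using ij by (auto simp: paired_def)
      then have "count m i \<le> 1" "count m j = count m i" by (auto simp: not_in_iff)
      moreover have "set_mset m \<subseteq> {i..j}" using \<open>?A\<close> unfolding paired_def ij(1) by auto
      moreover have "\<forall>x\<in>{i + 1..j - 1}. count m x \<le> 1 \<and> count m (\<tau> x) = count m x"
        using \<open>?A\<close> unfolding paired_def by blast
      ultimately show ?P unfolding P by blast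
    qed
    ultimately show ?thesis by blast
  qed
qed

lemma pairing_ends:
  assumes "i < j" "pairing Y \<tau> (i + 1) (j - 1)" "i \<in> Y \<longleftrightarrow> j \<notin> Y"
  shows "pairing Y (\<tau>(i := j, j := i)) i j"
proof -
  have ij: "{i..j} = insert i (insert j {i + 1..j - 1})" "i \<notin> {i + 1..j - 1}" "j \<notin> {i + 1..j - 1}"
    using assms by auto
  have "\<tau> x \<noteq> i" "\<tau> x \<noteq> j" if "x \<in> {i + 1..j - 1}" for x
    using that assms unfolding pairing_def by fastforce+
  then show ?thesis using assms ij(2,3) unfolding pairing_def ij(1) by auto
qed

lemma pairing_concat:
  assumes "i \<le> k" "k < j" "pairing Y \<tau>1 i k" "pairing Y \<tau>2 (k + 1) j"
  shows "pairing Y (\<lambda>x. if x \<le> k then \<tau>1 x else \<tau>2 x) i j"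
  unfolding pairing_def
proof
  fix x assume x: "x \<in> {i..j}"
  show "(if x \<le> k then \<tau>1 x else \<tau>2 x) \<in> {i..j} \<and>
      (if (if x \<le> k then \<tau>1 x else \<tau>2 x) \<le> k then \<tau>1 (if x \<le> k then \<tau>1 x else \<tau>2 x)
       else \<tau>2 (if x \<le> k then \<tau>1 x else \<tau>2 x)) = x \<and>
      ((if x \<le> k then \<tau>1 x else \<tau>2 x) \<in> Y) = (x \<notin> Y)"
  proof (cases "x \<le> k")
    case True
    then have "x \<in> {i..k}" using x by auto
    with assms(3) have "\<tau>1 x \<in> {i..k}" "\<tau>1 (\<tau>1 x) = x" "\<tau>1 x \<in> Y \<longleftrightarrow> x \<notin> Y"
      by (auto simp: pairing_def)
    then show ?thesis using True assms by auto
  next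
    case False
    then have "x \<in> {k + 1..j}" using x by auto
    with assms(4) have "\<tau>2 x \<in> {k + 1..j}" "\<tau>2 (\<tau>2 x) = x" "\<tau>2 x \<in> Y \<longleftrightarrow> x \<notin> Y"
      by (auto simp: pairing_def)
    then show ?thesis using False assms by auto
  qed
qed

text \<open>Both matchings stay within their own part, so the condition decouples at
  \<open>k\<close>: it corresponds to multiplying two products in disjoint variables.\<close>

lemma paired_concat:
  assumes "i \<le> k" "k < j" "pairing Y \<tau>1 i k" "pairing Y \<tau>2 (k + 1) j"
    and m: "set_mset m1 \<subseteq> {i..k}" "set_mset m2 \<subseteq> {k + 1..j}"
  shows "paired (\<lambda>x. if x \<le> k then \<tau>1 x else \<tau>2 x) i j (m1 + m2)
     \<longleftrightarrow> paired \<tau>1 i k m1 \<and> paired \<tau>2 (k + 1) j m2"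
proof -
  have ij: "{i..j} = {i..k} \<union> {k + 1..j}" using assms by auto
  have c: "count m2 x = 0" if "x \<le> k" for x using m(2) that by (auto simp: count_eq_zero_iff)
  have c': "count m1 x = 0" if "\<not> x \<le> k" for x using m(1) that by (auto simp: count_eq_zero_iff)
  have 1: "\<tau>1 x \<le> k" if "x \<in> {i..k}" for x using assms(3) that by (auto simp: pairing_def)
  have 2: "\<not> \<tau>2 x \<le> k" if "x \<in> {k + 1..j}" for x
  proof -
    have "\<tau>2 x \<in> {k + 1..j}" using assms(4) that unfolding pairing_def by blast
    then show ?thesis by simp
  qed
  have "(\<forall>x\<in>{i..k}. count (m1 + m2) x \<le> 1 \<and>
      count (m1 + m2) (if x \<le> k then \<tau>1 x else \<tau>2 x) = count (m1 + m2) x) \<longleftrightarrow>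
      (\<forall>x\<in>{i..k}. count m1 x \<le> 1 \<and> count m1 (\<tau>1 x) = count m1 x)"
    using c 1 by (intro ball_cong) auto
  moreover have "(\<forall>x\<in>{k + 1..j}. count (m1 + m2) x \<le> 1 \<and>
      count (m1 + m2) (if x \<le> k then \<tau>1 x else \<tau>2 x) = count (m1 + m2) x) \<longleftrightarrow>
      (\<forall>x\<in>{k + 1..j}. count m2 x \<le> 1 \<and> count m2 (\<tau>2 x) = count m2 x)"
    using c' 2 by (intro ball_cong) auto
  ultimately show ?thesis using m unfolding paired_def ij ball_Un by auto
qed

text \<open>The polynomial before passing to fractions: a coefficient is now a polynomial in the
  \<open>w\<close>, so that \<open>ryW n i j m q\<close> is the scalar at the x-monomial
  \<open>m\<close> and the w-monomial \<open>q\<close>.\<close>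

definition (in ring) ryW :: "nat \<Rightarrow> nat \<Rightarrow> nat \<Rightarrow> nat multiset \<Rightarrow> wvar multiset \<Rightarrow> 'a" where
  "ryW n = ry_poly (Wring R n) n (\<lambda>i k j. indexed_var (i, k, j))"

text \<open>The weight maximum is taken over all x-monomials together and attained by the single
  w-monomial \<open>\<mu>\<close>; the polynomial in x that multiplies \<open>\<mu>\<close> is the
  product over the matching \<open>\<tau>\<close>. The weight is kept nonnegative so that summands
  of negative weight can never reach it.\<close>

definition (in ring) is_top where
  "is_top n Y i j \<tau> \<mu> \<longleftrightarrow> pairing Y \<tau> i j \<and> 0 \<le> weight Y \<mu> \<and>
     (\<forall>m q. ryW n i j m q \<noteq> \<zero> \<longrightarrow> weight Y q \<le> weight Y \<mu> \<and> (weight Y q = weight Y \<mu> \<longrightarrow> q = \<mu>)) \<and>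
     (\<forall>m. ryW n i j m \<mu> = (if paired \<tau> i j m then \<one> else \<zero>))"

section \<open>Support and top-weight part of the interval polynomials\<close>

context cring
begin

lemma Wring_cring: "cring (Wring R n)"
  unfolding Wring_def by (rule mpoly_cring)

lemma ryW_closed:
  assumes "1 \<le> i" "j \<le> n"
  shows "ryW n i j \<in> carrier (mpoly_ring (Wring R n) {1..n})"
  unfolding ryW_def
proof (rule cring.ry_poly_closed[OF Wring_cring _ assms])
  fix i k j assume "i \<in> {1..n}" "k \<in> {1..n}" "j \<in> {1..n}"
  then show "indexed_var (i, k, j) \<in> carrier (Wring R n)"
    unfolding Wring_def by (intro indexed_var_closed) auto
qed

lemma ryW_coeff_closed:
  assumes "1 \<le> i" "j \<le> n"
  shows "ryW n i j m \<in> carrier (Wring R n)" "ryW n i j m q \<in> carrier R"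
proof -
  interpret W: cring "Wring R n" by (rule Wring_cring)
  show "ryW n i j m \<in> carrier (Wring R n)"
    using ryW_closed[OF assms] by (rule W.mpoly_coeff_closed)
  then show "ryW n i j m q \<in> carrier R" unfolding Wring_def by (rule mpoly_coeff_closed)
qed

lemma ryW_empty:
  assumes "j < i"
  shows "ryW n i j m q = (if m = {#} \<and> q = {#} then \<one> else \<zero>)"
proof -
  interpret W: cring "Wring R n" by (rule Wring_cring)
  show ?thesis using assms unfolding ryW_def
    by (subst ry_poly.simps, simp) (simp add: Wring_def)
qed

lemma ryW_coeff:
  assumes ij: "1 \<le> i" "j \<le> n" "i \<le> j"
  shows "ryW n i j m q = ryW n (i + 1) (j - 1) m q
    \<oplus> (if {#i, j#} \<subseteq># m then ryW n (i + 1) (j - 1) (m - {#i, j#}) q else \<zero>)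
    \<oplus> (\<Oplus>k \<in> {k \<in> {i + 1..j - 2}. even (k + 1 - i)}. if (i, k, j) \<in># q then
        (ryW n i k \<otimes>\<^bsub>mpoly_ring (Wring R n) {1..n}\<^esub> ryW n (k + 1) j) m (q - {#(i, k, j)#}) else \<zero>)"
proof -
  interpret W: cring "Wring R n" by (rule Wring_cring)
  interpret M: cring "mpoly_ring (Wring R n) {1..n}" by (rule W.mpoly_cring)
  let ?K = "{k \<in> {i + 1..j - 2}. even (k + 1 - i)}"
  have v: "indexed_var (i, k, j) \<in> carrier (Wring R n)"
    if "i \<in> {1..n}" "k \<in> {1..n}" "j \<in> {1..n}" for i k j
    using that unfolding Wring_def by (intro indexed_var_closed) auto
  have pc: "ryW n i k \<otimes>\<^bsub>mpoly_ring (Wring R n) {1..n}\<^esub> ryW n (k + 1) j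
      \<in> carrier (mpoly_ring (Wring R n) {1..n})" if "k \<in> ?K" for k
    using that ij by (intro M.m_closed ryW_closed) auto
  have pc': "(ryW n i k \<otimes>\<^bsub>mpoly_ring (Wring R n) {1..n}\<^esub> ryW n (k + 1) j) m
      \<in> carrier (Wring R n)" if "k \<in> ?K" for k
    using pc[OF that] by (rule W.mpoly_coeff_closed)
  have t: "(indexed_var (i, k, j) \<otimes>\<^bsub>Wring R n\<^esub>
      (ryW n i k \<otimes>\<^bsub>mpoly_ring (Wring R n) {1..n}\<^esub> ryW n (k + 1) j) m) \<in> carrier (Wring R n)"
    if "k \<in> ?K" for k
    using that ij pc'[OF that] by (intro W.m_closed v) auto
  have q: "(indexed_var (i, k, j) \<otimes>\<^bsub>Wring R n\<^esub>
      (ryW n i k \<otimes>\<^bsub>mpoly_ring (Wring R n) {1..n}\<^esub> ryW n (k + 1) j) m) q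
    = (if (i, k, j) \<in># q then
        (ryW n i k \<otimes>\<^bsub>mpoly_ring (Wring R n) {1..n}\<^esub> ryW n (k + 1) j) m (q - {#(i, k, j)#}) else \<zero>)"
    if "k \<in> ?K" for k
    using pc[OF that] unfolding Wring_def by (rule mpoly_var_mult_mpoly)
  have "(\<Oplus>\<^bsub>Wring R n\<^esub>k\<in>?K. indexed_var (i, k, j) \<otimes>\<^bsub>Wring R n\<^esub>
      (ryW n i k \<otimes>\<^bsub>mpoly_ring (Wring R n) {1..n}\<^esub> ryW n (k + 1) j) m) q
    = (\<Oplus>k\<in>?K. (indexed_var (i, k, j) \<otimes>\<^bsub>Wring R n\<^esub>
      (ryW n i k \<otimes>\<^bsub>mpoly_ring (Wring R n) {1..n}\<^esub> ryW n (k + 1) j) m) q)"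
    using t unfolding Wring_def by (intro mpoly_finsum_apply) auto
  also have "\<dots> = (\<Oplus>k\<in>?K. if (i, k, j) \<in># q then
        (ryW n i k \<otimes>\<^bsub>mpoly_ring (Wring R n) {1..n}\<^esub> ryW n (k + 1) j) m (q - {#(i, k, j)#}) else \<zero>)"
  proof (intro finsum_cong' refl q)
    show "(\<lambda>k. if (i, k, j) \<in># q then
        (ryW n i k \<otimes>\<^bsub>mpoly_ring (Wring R n) {1..n}\<^esub> ryW n (k + 1) j) m (q - {#(i, k, j)#}) else \<zero>)
        \<in> ?K \<rightarrow> carrier R"
    proof
      fix k assume k: "k \<in> ?K"
      show "(if (i, k, j) \<in># q then
        (ryW n i k \<otimes>\<^bsub>mpoly_ring (Wring R n) {1..n}\<^esub> ryW n (k + 1) j) m (q - {#(i, k, j)#}) else \<zero>)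
        \<in> carrier R"
        using mpoly_coeff_closed[OF pc'[OF k, unfolded Wring_def]] by (simp add: Wring_def)
    qed
  qed
  finally have sum: "(\<Oplus>\<^bsub>Wring R n\<^esub>k\<in>?K. indexed_var (i, k, j) \<otimes>\<^bsub>Wring R n\<^esub>
      (ryW n i k \<otimes>\<^bsub>mpoly_ring (Wring R n) {1..n}\<^esub> ryW n (k + 1) j) m) q = \<dots>" .
  have "ryW n i j m = ryW n (i + 1) (j - 1) m
    \<oplus>\<^bsub>Wring R n\<^esub> (if {#i, j#} \<subseteq># m then ryW n (i + 1) (j - 1) (m - {#i, j#}) else \<zero>\<^bsub>Wring R n\<^esub>)
    \<oplus>\<^bsub>Wring R n\<^esub> (\<Oplus>\<^bsub>Wring R n\<^esub>k\<in>?K. indexed_var (i, k, j) \<otimes>\<^bsub>Wring R n\<^esub>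
      (ryW n i k \<otimes>\<^bsub>mpoly_ring (Wring R n) {1..n}\<^esub> ryW n (k + 1) j) m)"
    unfolding ryW_def by (rule W.ry_poly_coeff) (use v ij in auto)
  then have "ryW n i j m q = ryW n (i + 1) (j - 1) m q
    \<oplus> (if {#i, j#} \<subseteq># m then ryW n (i + 1) (j - 1) (m - {#i, j#}) else \<zero>\<^bsub>Wring R n\<^esub>) q
    \<oplus> (\<Oplus>\<^bsub>Wring R n\<^esub>k\<in>?K. indexed_var (i, k, j) \<otimes>\<^bsub>Wring R n\<^esub>
      (ryW n i k \<otimes>\<^bsub>mpoly_ring (Wring R n) {1..n}\<^esub> ryW n (k + 1) j) m) q"
    by (simp add: Wring_def)
  then show ?thesis unfolding sum by (simp add: Wring_def if_distribR)
qed

lemma ryW_prod_nonzeroE: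
  assumes "1 \<le> i" "k \<le> n" "j \<le> n"
    and "(ryW n i k \<otimes>\<^bsub>mpoly_ring (Wring R n) {1..n}\<^esub> ryW n (k + 1) j) m q \<noteq> \<zero>"
  obtains m1 m2 q1 q2 where "m = m1 + m2" "q = q1 + q2" "ryW n i k m1 q1 \<noteq> \<zero>" "ryW n (k + 1) j m2 q2 \<noteq> \<zero>"
proof -
  have "ryW n i k \<in> carrier (mpoly_ring (Wring R n) {1..n})"
    "ryW n (k + 1) j \<in> carrier (mpoly_ring (Wring R n) {1..n})"
    using assms by (auto intro!: ryW_closed)
  from this[unfolded Wring_def] assms(4)[unfolded Wring_def] show ?thesis
    by (rule mpoly_mult_nonzeroE2) (rule that)
qed

text \<open>Only an implication: summands might cancel, which can merely shrink the support. Upper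
  bounds on weights follow from it without any analysis of cancellation.\<close>

lemma ryW_nonzero_cases:
  assumes ij: "1 \<le> i" "j \<le> n" "i \<le> j" and nz: "ryW n i j m q \<noteq> \<zero>"
  obtains (drop) m' where "m = m' \<or> m = add_mset i (add_mset j m')" "ryW n (i + 1) (j - 1) m' q \<noteq> \<zero>"
  | (split) k m1 m2 q1 q2 where "k \<in> {i + 1..j - 2}" "even (k + 1 - i)"
    "m = m1 + m2" "q = add_mset (i, k, j) (q1 + q2)"
    "ryW n i k m1 q1 \<noteq> \<zero>" "ryW n (k + 1) j m2 q2 \<noteq> \<zero>"
proof -
  have "a \<noteq> \<zero> \<or> (P \<and> b \<noteq> \<zero>) \<or> c \<noteq> \<zero>" if "a \<oplus> (if P then b else \<zero>) \<oplus> c \<noteq> \<zero>" for a b c P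
    using that by (cases P) auto
  note nz' = this[OF nz[unfolded ryW_coeff[OF ij]]]
  consider "ryW n (i + 1) (j - 1) m q \<noteq> \<zero>"
    | "{#i, j#} \<subseteq># m" "ryW n (i + 1) (j - 1) (m - {#i, j#}) q \<noteq> \<zero>"
    | "(\<Oplus>k \<in> {k \<in> {i + 1..j - 2}. even (k + 1 - i)}. if (i, k, j) \<in># q then
        (ryW n i k \<otimes>\<^bsub>mpoly_ring (Wring R n) {1..n}\<^esub> ryW n (k + 1) j) m (q - {#(i, k, j)#}) else \<zero>) \<noteq> \<zero>"
    using nz' by blast
  then show ?thesis
  proof cases
    case 1
    then show ?thesis using drop by blast
  next
    case 2
    moreover have "m = add_mset i (add_mset j (m - {#i, j#}))"
      using subset_mset.diff_add[OF 2(1)] by simp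
    ultimately show ?thesis using drop by blast
  next
    case 3
    then obtain k where k: "k \<in> {i + 1..j - 2}" "even (k + 1 - i)" "(i, k, j) \<in># q"
      "(ryW n i k \<otimes>\<^bsub>mpoly_ring (Wring R n) {1..n}\<^esub> ryW n (k + 1) j) m (q - {#(i, k, j)#}) \<noteq> \<zero>"
      by (elim finsum_nonzeroE) (auto split: if_splits)
    have "k \<le> n" using k ij by auto
    from ij(1) this ij(2) k(4) obtain m1 m2 q1 q2 where "m = m1 + m2" "q - {#(i, k, j)#} = q1 + q2"
      "ryW n i k m1 q1 \<noteq> \<zero>" "ryW n (k + 1) j m2 q2 \<noteq> \<zero>"
      by (rule ryW_prod_nonzeroE)
    moreover from this(2) have "q = add_mset (i, k, j) (q1 + q2)" using k(3)
      by (metis insert_DiffM)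
    ultimately show ?thesis using split k by blast
  qed
qed

text \<open>The exponent is the length of the interval. A split stays within the bound by
  \<open>wt_bounds\<close>, and dropping the two ends only shortens the interval. Even length
  guarantees that both parts of a split have even length as well.\<close>

lemma ryW_support:
  assumes "1 \<le> i" "j \<le> n" "even (j + 1 - i)" "ryW n i j m q \<noteq> \<zero>"
  shows "set_mset m \<subseteq> {i..j} \<and> weight Y q \<le> 4 ^ (j + 1 - i)"
  using assms
proof (induction "j + 1 - i" arbitrary: i j m q rule: less_induct)
  case less
  show ?case
  proof (cases "j < i")
    case True
    then show ?thesis using less.prems(4) by (auto simp: ryW_empty split: if_splits)
  next
    case False
    then have ij: "i \<le> j" "i < j" using less.prems(3) by (auto intro: le_neq_implies_less)
    from less.prems(1,2) ij(1) less.prems(4) show ?thesis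
    proof (cases rule: ryW_nonzero_cases)
      case (drop m')
      have IH: "set_mset m' \<subseteq> {i + 1..j - 1} \<and> weight Y q \<le> 4 ^ (j - 1 + 1 - (i + 1))"
        by (rule less.hyps) (use less.prems ij drop in auto)
      have "(4::int) ^ (j - 1 + 1 - (i + 1)) \<le> 4 ^ (j + 1 - i)"
        by (intro power_increasing) auto
      with IH have "weight Y q \<le> 4 ^ (j + 1 - i)" by linarith
      moreover have "set_mset m' \<subseteq> {i..j}"
        by (rule subset_trans[OF conjunct1[OF IH]]) auto
      ultimately show ?thesis using drop(1) ij by (elim disjE) simp_all
    next
      case (split k m1 m2 q1 q2)
      have 1: "set_mset m1 \<subseteq> {i..k} \<and> weight Y q1 \<le> 4 ^ (k + 1 - i)"
        by (rule less.hyps) (use less.prems ij split in auto)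
      have 2: "set_mset m2 \<subseteq> {k + 1..j} \<and> weight Y q2 \<le> 4 ^ (j + 1 - (k + 1))"
        by (rule less.hyps) (use less.prems ij split in auto)
      have "wt Y (i, k, j) + 4 ^ (k + 1 - i) + 4 ^ (j + 1 - (k + 1)) \<le> 4 ^ (j + 1 - i)"
        by (rule wt_bounds) (use split ij in auto)
      then have "weight Y q \<le> 4 ^ (j + 1 - i)" using 1 2 split(4) by simp
      moreover have "set_mset m1 \<subseteq> {i..j}" "set_mset m2 \<subseteq> {i..j}"
        using split(1) by (auto intro!: subset_trans[OF conjunct1[OF 1]] subset_trans[OF conjunct1[OF 2]])
      ultimately show ?thesis using split(3) by simp
    qed
  qed
qed

lemma ryW_split_weight:
  assumes "1 \<le> i" "j \<le> n" "even (j + 1 - i)" "k \<in> {i + 1..j - 2}" "even (k + 1 - i)"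
    and "ryW n i k m1 q1 \<noteq> \<zero>" "ryW n (k + 1) j m2 q2 \<noteq> \<zero>" "wt Y (i, k, j) \<noteq> 4 ^ (j - i)"
  shows "weight Y (add_mset (i, k, j) (q1 + q2)) < 0"
proof -
  have "weight Y q1 \<le> 4 ^ (k + 1 - i)"
    using ryW_support[of i k n m1 q1 Y] assms by auto
  moreover have "weight Y q2 \<le> 4 ^ (j + 1 - (k + 1))"
    using ryW_support[of "k + 1" j n m2 q2 Y] assms by auto
  moreover have "wt Y (i, k, j) + 4 ^ (k + 1 - i) + 4 ^ (j + 1 - (k + 1)) < 0"
    by (rule wt_bounds) (use assms in auto)
  ultimately show ?thesis by simp
qed

text \<open>With ends on different sides no split is favoured, so every split has negative total
  weight. The top part therefore comes from the inner interval alone, multiplied by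
  \<open>1 + x\<^sub>i x\<^sub>j\<close>, with the same \<open>\<mu>\<close>.\<close>

lemma ryW_top_ends:
  assumes ij: "1 \<le> i" "j \<le> n" "i < j" "even (j + 1 - i)" and Y: "i \<in> Y \<longleftrightarrow> j \<notin> Y"
    and top: "is_top n Y (i + 1) (j - 1) \<tau> \<mu>"
  shows "is_top n Y i j (\<tau>(i := j, j := i)) \<mu>"
proof -
  have pr: "pairing Y \<tau> (i + 1) (j - 1)" and \<mu>: "0 \<le> weight Y \<mu>"
    and le: "\<And>m q. ryW n (i + 1) (j - 1) m q \<noteq> \<zero> \<Longrightarrow>
      weight Y q \<le> weight Y \<mu> \<and> (weight Y q = weight Y \<mu> \<longrightarrow> q = \<mu>)"
    and val: "\<And>m. ryW n (i + 1) (j - 1) m \<mu> = (if paired \<tau> (i + 1) (j - 1) m then \<one> else \<zero>)"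
    using top unfolding is_top_def by blast+
  have neg: "weight Y (add_mset (i, k, j) (q1 + q2)) < 0"
    if "k \<in> {i + 1..j - 2}" "even (k + 1 - i)" "ryW n i k m1 q1 \<noteq> \<zero>" "ryW n (k + 1) j m2 q2 \<noteq> \<zero>"
    for k m1 m2 q1 q2
    using ij that Y by (intro ryW_split_weight) (auto simp: wt_eq_iff)
  have "weight Y q \<le> weight Y \<mu> \<and> (weight Y q = weight Y \<mu> \<longrightarrow> q = \<mu>)"
    if nz: "ryW n i j m q \<noteq> \<zero>" for m q
    using ij(1,2) less_imp_le[OF ij(3)] nz
  proof (cases rule: ryW_nonzero_cases)
    case (drop m')
    then show ?thesis using le by blast
  next
    case (split k m1 m2 q1 q2)
    then have "weight Y q < 0" using neg by blast
    then show ?thesis using \<mu> by simp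
  qed
  moreover have "ryW n i j m \<mu> = (if paired (\<tau>(i := j, j := i)) i j m then \<one> else \<zero>)" for m
  proof -
    let ?C = "\<Oplus>k \<in> {k \<in> {i + 1..j - 2}. even (k + 1 - i)}. if (i, k, j) \<in># \<mu> then
        (ryW n i k \<otimes>\<^bsub>mpoly_ring (Wring R n) {1..n}\<^esub> ryW n (k + 1) j) m (\<mu> - {#(i, k, j)#}) else \<zero>"
    \<comment> \<open>A nonzero summand would write \<open>\<mu>\<close> as a w-monomial of negative
      weight, against \<open>0 \<le> weight Y \<mu>\<close>.\<close>
    have C: "?C = \<zero>"
    proof (rule finsum_zeroI, rule ccontr)
      fix k assume k: "k \<in> {k \<in> {i + 1..j - 2}. even (k + 1 - i)}"
      assume "(if (i, k, j) \<in># \<mu> then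
        (ryW n i k \<otimes>\<^bsub>mpoly_ring (Wring R n) {1..n}\<^esub> ryW n (k + 1) j) m (\<mu> - {#(i, k, j)#})
        else \<zero>) \<noteq> \<zero>"
      then have h: "(i, k, j) \<in># \<mu>"
        "(ryW n i k \<otimes>\<^bsub>mpoly_ring (Wring R n) {1..n}\<^esub> ryW n (k + 1) j) m (\<mu> - {#(i, k, j)#}) \<noteq> \<zero>"
        by (auto split: if_splits)
      have "k \<le> n" using k ij by auto
      from ij(1) this ij(2) h(2) obtain m1 m2 q1 q2 where q: "\<mu> - {#(i, k, j)#} = q1 + q2"
        "ryW n i k m1 q1 \<noteq> \<zero>" "ryW n (k + 1) j m2 q2 \<noteq> \<zero>"
        by (rule ryW_prod_nonzeroE)
      have "weight Y (add_mset (i, k, j) (q1 + q2)) < 0" using k q by (intro neg) auto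
      then show False using \<mu> h(1) unfolding q(1)[symmetric] by (simp only: insert_DiffM)
    qed
    \<comment> \<open>The two contributions of the factor \<open>1 + x\<^sub>i x\<^sub>j\<close>
      exclude each other at every monomial. Hence the coefficient is never 1 + 1, which would vanish
      in characteristic 2.\<close>
    have "i \<notin># m" if "paired \<tau> (i + 1) (j - 1) m" using that by (auto simp: paired_def)
    then have ex: "\<not> {#i, j#} \<subseteq># m" if "paired \<tau> (i + 1) (j - 1) m"
      using that by (auto simp: insert_subset_eq_iff)
    show ?thesis
      unfolding ryW_coeff[OF ij(1,2) less_imp_le[OF ij(3)]] C val paired_ends[OF ij(3) pr]
      using ex by auto
  qed
  ultimately show ?thesis
    using pairing_ends[OF ij(3) pr Y] \<mu> unfolding is_top_def by blast
qed

text \<open>The favoured split multiplies the top monomials of its two parts by its own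
  \<open>w\<close>. It beats the inner interval, whose weights are at most
  \<open>4 ^ (j - i - 1)\<close>, and all other splits, whose weights are negative.\<close>

lemma ryW_top_split:
  assumes ij: "1 \<le> i" "j \<le> n" "i < j" "even (j + 1 - i)" and wk: "wt Y (i, k, j) = 4 ^ (j - i)"
    and uniq: "\<And>k'. wt Y (i, k', j) = 4 ^ (j - i) \<Longrightarrow> k' = k"
    and k: "k \<in> {i + 1..j - 2}" "even (k + 1 - i)"
    and top1: "is_top n Y i k \<tau>1 \<mu>1" and top2: "is_top n Y (k + 1) j \<tau>2 \<mu>2"
  shows "is_top n Y i j (\<lambda>x. if x \<le> k then \<tau>1 x else \<tau>2 x) (add_mset (i, k, j) (\<mu>1 + \<mu>2))"
proof -
  have ij': "i \<le> j" and kj: "i \<le> k" "k < j" "k \<le> n" using ij k by auto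
  let ?\<mu> = "add_mset (i, k, j) (\<mu>1 + \<mu>2)"
  have pr1: "pairing Y \<tau>1 i k" and \<mu>1: "0 \<le> weight Y \<mu>1"
    and le1: "\<And>m q. ryW n i k m q \<noteq> \<zero> \<Longrightarrow>
      weight Y q \<le> weight Y \<mu>1 \<and> (weight Y q = weight Y \<mu>1 \<longrightarrow> q = \<mu>1)"
    and val1: "\<And>m. ryW n i k m \<mu>1 = (if paired \<tau>1 i k m then \<one> else \<zero>)"
    using top1 unfolding is_top_def by blast+
  have pr2: "pairing Y \<tau>2 (k + 1) j" and \<mu>2: "0 \<le> weight Y \<mu>2"
    and le2: "\<And>m q. ryW n (k + 1) j m q \<noteq> \<zero> \<Longrightarrow>
      weight Y q \<le> weight Y \<mu>2 \<and> (weight Y q = weight Y \<mu>2 \<longrightarrow> q = \<mu>2)"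
    and val2: "\<And>m. ryW n (k + 1) j m \<mu>2 = (if paired \<tau>2 (k + 1) j m then \<one> else \<zero>)"
    using top2 unfolding is_top_def by blast+
  have \<mu>: "4 ^ (j - i) \<le> weight Y ?\<mu>" using wk \<mu>1 \<mu>2 by simp
  then have \<mu>0: "0 < weight Y ?\<mu>" by (smt (verit) zero_less_power)
  have neg: "weight Y (add_mset (i, k', j) (q1 + q2)) < 0"
    if "k' \<in> {i + 1..j - 2}" "even (k' + 1 - i)" "ryW n i k' m1 q1 \<noteq> \<zero>" "ryW n (k' + 1) j m2 q2 \<noteq> \<zero>" "k' \<noteq> k"
    for k' m1 m2 q1 q2
    using ij that uniq by (intro ryW_split_weight) auto
  \<comment> \<open>The inner interval is two points shorter, one less than the exponent
    \<open>j - i\<close> in the favoured weight; the inequality is therefore strict.\<close>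
  have small: "weight Y q < weight Y ?\<mu>" if "ryW n (i + 1) (j - 1) m q \<noteq> \<zero>" for m q
  proof -
    have "weight Y q \<le> 4 ^ (j - 1 + 1 - (i + 1))"
      using ryW_support[of "i + 1" "j - 1" n m q Y] that ij by auto
    also have "\<dots> < (4::int) ^ (j - i)" using ij by (intro power_strict_increasing) auto
    finally show ?thesis using \<mu> by simp
  qed
  have "weight Y q \<le> weight Y ?\<mu> \<and> (weight Y q = weight Y ?\<mu> \<longrightarrow> q = ?\<mu>)"
    if nz: "ryW n i j m q \<noteq> \<zero>" for m q
    using ij(1,2) ij' nz
  proof (cases rule: ryW_nonzero_cases)
    case (drop m')
    then show ?thesis using small by fastforce
  next
    case (split k' m1 m2 q1 q2)
    show ?thesis
    proof (cases "k' = k")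
      case True
      then show ?thesis using split le1[of m1 q1] le2[of m2 q2] by auto
    next
      case False
      then have "weight Y q < 0" using neg split by blast
      then show ?thesis using \<mu>0 by simp
    qed
  qed
  moreover have "ryW n i j m ?\<mu> = (if paired (\<lambda>x. if x \<le> k then \<tau>1 x else \<tau>2 x) i j m then \<one> else \<zero>)" for m
  proof -
    let ?P = "\<lambda>k. ryW n i k \<otimes>\<^bsub>mpoly_ring (Wring R n) {1..n}\<^esub> ryW n (k + 1) j"
    have cl: "ryW n i k \<in> carrier (mpoly_ring (Wring R n) {1..n})"
      "ryW n (k + 1) j \<in> carrier (mpoly_ring (Wring R n) {1..n})"
      using ij kj by (auto intro!: ryW_closed)
    have D: "ryW n (i + 1) (j - 1) m ?\<mu> = \<zero>" for m using small by blast
    have "(\<Oplus>k' \<in> {k' \<in> {i + 1..j - 2}. even (k' + 1 - i)}. if (i, k', j) \<in># ?\<mu> then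
        ?P k' m (?\<mu> - {#(i, k', j)#}) else \<zero>)
      = (if (i, k, j) \<in># ?\<mu> then ?P k m (?\<mu> - {#(i, k, j)#}) else \<zero>)"
    proof (rule finsum_single)
      show "(if (i, k, j) \<in># ?\<mu> then ?P k m (?\<mu> - {#(i, k, j)#}) else \<zero>) \<in> carrier R"
      proof -
        interpret W: cring "Wring R n" by (rule Wring_cring)
        have "?P k m \<in> carrier (Wring R n)"
          by (rule W.mpoly_coeff_closed[OF W.mpoly_mult_closed[OF cl]])
        from mpoly_coeff_closed[OF this[unfolded Wring_def]] show ?thesis by (simp add: Wring_def)
      qed
      fix k' assume k': "k' \<in> {k' \<in> {i + 1..j - 2}. even (k' + 1 - i)}" "k' \<noteq> k"
      show "(if (i, k', j) \<in># ?\<mu> then ?P k' m (?\<mu> - {#(i, k', j)#}) else \<zero>) = \<zero>"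
      proof (rule ccontr)
        assume "\<not> ?thesis"
        then have h: "(i, k', j) \<in># ?\<mu>" "?P k' m (?\<mu> - {#(i, k', j)#}) \<noteq> \<zero>"
          by (auto split: if_splits)
        have "k' \<le> n" using k' ij by auto
        from ij(1) this ij(2) h(2) obtain m1 m2 q1 q2 where q: "?\<mu> - {#(i, k', j)#} = q1 + q2"
          "ryW n i k' m1 q1 \<noteq> \<zero>" "ryW n (k' + 1) j m2 q2 \<noteq> \<zero>"
          by (rule ryW_prod_nonzeroE)
        have "weight Y (add_mset (i, k', j) (q1 + q2)) < 0" using k' q by (intro neg) auto
        then show False using \<mu>0 h(1) unfolding q(1)[symmetric] by (simp only: insert_DiffM)
      qed
    qed (use k in auto)
    also have "\<dots> = ?P k m (\<mu>1 + \<mu>2)" by simp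
    finally have "ryW n i j m ?\<mu> = ?P k m (\<mu>1 + \<mu>2)"
    proof -
      assume S: "(\<Oplus>k' \<in> {k' \<in> {i + 1..j - 2}. even (k' + 1 - i)}. if (i, k', j) \<in># ?\<mu> then
        ?P k' m (?\<mu> - {#(i, k', j)#}) else \<zero>) = ?P k m (\<mu>1 + \<mu>2)"
      have "?P k m (\<mu>1 + \<mu>2) \<in> carrier R"
      proof -
        interpret W: cring "Wring R n" by (rule Wring_cring)
        have "?P k m \<in> carrier (Wring R n)"
          by (rule W.mpoly_coeff_closed[OF W.mpoly_mult_closed[OF cl]])
        from mpoly_coeff_closed[OF this[unfolded Wring_def]] show ?thesis by (simp add: Wring_def)
      qed
      then show ?thesis unfolding ryW_coeff[OF ij(1,2) ij'] D S by simp
    qed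
    also have "\<dots> = (if paired (\<lambda>x. if x \<le> k then \<tau>1 x else \<tau>2 x) i j m then \<one> else \<zero>)"
    proof (cases "set_mset m \<subseteq> {i..j}")
      case False
      have "?P k m (\<mu>1 + \<mu>2) = \<zero>"
      proof (rule ccontr)
        assume nz: "?P k m (\<mu>1 + \<mu>2) \<noteq> \<zero>"
        obtain m1 m2 q1 q2 where q: "m = m1 + m2" "ryW n i k m1 q1 \<noteq> \<zero>" "ryW n (k + 1) j m2 q2 \<noteq> \<zero>"
          by (rule ryW_prod_nonzeroE[OF ij(1) kj(3) ij(2) nz])
        have "set_mset m1 \<subseteq> {i..k}" "set_mset m2 \<subseteq> {k + 1..j}"
          using ryW_support[OF _ _ _ q(2)] ryW_support[OF _ _ _ q(3)] ij k kj by auto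
        then show False using q(1) False kj by force
      qed
      then show ?thesis using False by (simp add: paired_def)
    next
      case True
      \<comment> \<open>The two parts use disjoint variables, so the x-monomial determines its
        factors by restriction to the points up to \<open>k\<close> and beyond
        \<open>k\<close>.\<close>
      define m1 where "m1 = filter_mset (\<lambda>x. x \<le> k) m"
      define m2 where "m2 = filter_mset (\<lambda>x. \<not> x \<le> k) m"
      have m: "m = m1 + m2" unfolding m1_def m2_def by (rule multiset_partition)
      have s: "set_mset m1 \<subseteq> {i..k}" "set_mset m2 \<subseteq> {k + 1..j}"
        using True by (auto simp: m1_def m2_def)
      have "?P k (m1 + m2) (\<mu>1 + \<mu>2) = ryW n i k m1 \<mu>1 \<otimes> ryW n (k + 1) j m2 \<mu>2"
        unfolding Wring_def
      proof (rule mpoly_mult_unique2)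
        fix n1 n2 r1 r2 assume eq: "n1 + n2 = m1 + m2" "r1 + r2 = \<mu>1 + \<mu>2"
          and nz: "ryW n i k n1 r1 \<noteq> \<zero>" "ryW n (k + 1) j n2 r2 \<noteq> \<zero>"
        have "set_mset n1 \<subseteq> {i..k}" "set_mset n2 \<subseteq> {k + 1..j}"
          using ryW_support[OF _ _ _ nz(1)] ryW_support[OF _ _ _ nz(2)] ij k kj by auto
        then have f: "filter_mset (\<lambda>x. x \<le> k) n1 = n1" "filter_mset (\<lambda>x. x \<le> k) n2 = {#}"
          by (auto simp: filter_mset_eq_conv)
        have sum: "n1 + n2 = m" using eq m by simp
        have "filter_mset (\<lambda>x. x \<le> k) (n1 + n2) = m1" unfolding sum m1_def ..
        then have "n1 = m1" unfolding filter_union_mset f by simp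
        \<comment> \<open>Neither factor can exceed its top weight, so equal sums force both weights
          to be maximal, and the top monomial is unique.\<close>
        moreover have "weight Y r1 + weight Y r2 = weight Y \<mu>1 + weight Y \<mu>2"
          using arg_cong[OF eq(2), of "weight Y"] by simp
        then have "r1 = \<mu>1" using le1[OF nz(1)] le2[OF nz(2)] by auto
        ultimately show "n1 = m1 \<and> r1 = \<mu>1" ..
      qed (use cl in \<open>auto simp: Wring_def\<close>)
      then show ?thesis unfolding m val1 val2 paired_concat[OF kj(1,2) pr1 pr2 s] by simp
    qed
    finally show ?thesis .
  qed
  ultimately show ?thesis
    using pairing_concat[OF kj(1,2) pr1 pr2] \<mu>0 unfolding is_top_def by (blast intro: less_imp_le)
qed

text \<open>The induction stays among balanced intervals: removing ends on different sides preserves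
  balance, and ends on the same side admit a balanced split.\<close>

theorem ryW_top_exists:
  assumes "1 \<le> i" "j \<le> n" "i \<le> j + 1" "disc Y i j = 0"
  shows "\<exists>\<tau> \<mu>. is_top n Y i j \<tau> \<mu>"
  using assms
proof (induction "j + 1 - i" arbitrary: i j rule: less_induct)
  case less
  show ?case
  proof (cases "j < i")
    case True
    have "is_top n Y i j id {#}"
      using True unfolding is_top_def by (auto simp: pairing_def paired_def ryW_empty)
    then show ?thesis by blast
  next
    case False
    have ev: "even (j + 1 - i)" using disc_parity[of i j Y] less.prems by simp
    then have ij: "i < j" using False by (auto intro: le_neq_implies_less)
    show ?thesis
    proof (cases "i \<in> Y \<longleftrightarrow> j \<in> Y")
      case False
      have "\<exists>\<tau> \<mu>. is_top n Y (i + 1) (j - 1) \<tau> \<mu>"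
        by (rule less.hyps) (use less.prems ij False disc_ends[OF ij, of Y] in auto)
      then show ?thesis
        using ryW_top_ends[OF less.prems(1,2) ij ev] False by blast
    next
      case True
      note k = split_at[OF less.prems(4) ij True]
      define k where "k = split_at Y i j"
      note k = k[folded k_def]
      have "\<exists>\<tau> \<mu>. is_top n Y i k \<tau> \<mu>" "\<exists>\<tau> \<mu>. is_top n Y (k + 1) j \<tau> \<mu>"
        by (rule less.hyps; use less.prems k in auto)+
      moreover have "wt Y (i, k, j) = 4 ^ (j - i)"
        using True less.prems by (simp add: wt_eq_iff k_def)
      moreover have "k' = k" if "wt Y (i, k', j) = 4 ^ (j - i)" for k'
        using that by (simp add: wt_eq_iff k_def)
      ultimately show ?thesis
        using ryW_top_split[OF less.prems(1,2) ij ev _ _ k(1,2)] by blast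
    qed
  qed
qed

end

lemma paired_union_image:
  assumes pr: "pairing Y \<tau> 1 n" and S: "S \<subseteq> Y" "S' \<subseteq> Y" "Y \<subseteq> {1..n}"
  shows "paired \<tau> 1 n (mset_set (S \<union> \<tau> ` S')) \<longleftrightarrow> S = S'"
proof -
  have \<tau>: "\<tau> x \<in> {1..n}" "\<tau> (\<tau> x) = x" "\<tau> x \<in> Y \<longleftrightarrow> x \<notin> Y" if "x \<in> {1..n}" for x
    using pr that by (auto simp: pairing_def)
  have fin: "finite S" "finite S'" using S by (meson finite_atLeastAtMost finite_subset)+
  have sub: "S \<subseteq> {1..n}" "S' \<subseteq> {1..n}" using S by auto
  have "\<tau> ` S' \<subseteq> {1..n}" using \<tau>(1) sub by blast
  then have set: "set_mset (mset_set (S \<union> \<tau> ` S')) \<subseteq> {1..n}" using fin sub by simp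
  have count: "count (mset_set (S \<union> \<tau> ` S')) x = (if x \<in> S \<union> \<tau> ` S' then 1 else 0)" for x
    using fin by (simp add: count_mset_set')
  have "paired \<tau> 1 n (mset_set (S \<union> \<tau> ` S')) \<longleftrightarrow>
      (\<forall>x\<in>{1..n}. \<tau> x \<in> S \<union> \<tau> ` S' \<longleftrightarrow> x \<in> S \<union> \<tau> ` S')"
    unfolding paired_def count using set by (intro iffI conjI ballI) (auto split: if_splits)
  also have "\<dots> \<longleftrightarrow> S = S'"
  proof
    assume h: "\<forall>x\<in>{1..n}. \<tau> x \<in> S \<union> \<tau> ` S' \<longleftrightarrow> x \<in> S \<union> \<tau> ` S'"
    show "S = S'"
    proof
      show "S \<subseteq> S'"
      proof
        fix y assume y: "y \<in> S"
        then have yn: "y \<in> {1..n}" "y \<in> Y" using S sub by auto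
        then have "\<tau> y \<in> S \<union> \<tau> ` S'" using h y by blast
        moreover have "\<tau> y \<notin> S" using \<tau>(3)[OF yn(1)] yn(2) S by blast
        ultimately obtain z where z: "z \<in> S'" "\<tau> y = \<tau> z" by blast
        then have "y = z" using \<tau>(2)[OF yn(1)] \<tau>(2)[of z] sub by force
        then show "y \<in> S'" using z by simp
      qed
      show "S' \<subseteq> S"
      proof
        fix y assume y: "y \<in> S'"
        then have yn: "y \<in> {1..n}" "y \<in> Y" using S sub by auto
        have "y \<in> S \<union> \<tau> ` S'" using h yn y by blast
        moreover have "y \<noteq> \<tau> z" if "z \<in> S'" for z
        proof -
          have "z \<in> {1..n}" "z \<in> Y" using that S sub by auto
          then show ?thesis using \<tau>(3) yn by blast
        qed
        ultimately show "y \<in> S" by blast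
      qed
    qed
  next
    assume "S = S'"
    moreover have "x \<in> S' \<union> \<tau> ` S'" if "x \<in> {1..n}" "\<tau> x \<in> S' \<union> \<tau> ` S'" for x
    proof -
      have "\<tau> (\<tau> x) \<in> \<tau> ` S' \<union> \<tau> ` \<tau> ` S'" using that(2) by blast
      moreover have "\<tau> ` \<tau> ` S' = (\<lambda>x. x) ` S'"
        unfolding image_image using \<tau>(2) sub by (intro image_cong) blast+
      ultimately show ?thesis using \<tau>(2)[OF that(1)] by auto
    qed
    moreover have "\<tau> x \<in> S' \<union> \<tau> ` S'" if "x \<in> S' \<union> \<tau> ` S'" for x
      using that \<tau>(2) sub by auto
    ultimately show "\<forall>x\<in>{1..n}. \<tau> x \<in> S \<union> \<tau> ` S' \<longleftrightarrow> x \<in> S \<union> \<tau> ` S'" by blast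
  qed
  finally show ?thesis .
qed

text \<open>Among all monomials of all coefficients \<open>a S\<close> take one, \<open>q0\<close>
  in \<open>a S0\<close>, of maximal weight. In the relation for the column matched with
  \<open>S0\<close>, the w-monomial \<open>q0 + \<mu>\<close> arises only as \<open>q0\<close> times
  \<open>\<mu>\<close> and only from the row \<open>S0\<close>, so \<open>a S0 q0\<close> would have
  to vanish.\<close>

lemma (in cring) ryW_nonsingular:
  assumes Y: "Y \<subseteq> {1..n}" "disc Y 1 n = 0"
    and a: "\<And>S. S \<subseteq> Y \<Longrightarrow> a S \<in> carrier (Wring R n)"
    and rel: "\<And>T. T \<subseteq> {1..n} - Y \<Longrightarrow>
      (\<Oplus>\<^bsub>Wring R n\<^esub>S\<in>Pow Y. a S \<otimes>\<^bsub>Wring R n\<^esub> ryW n 1 n (mset_set (S \<union> T))) = \<zero>\<^bsub>Wring R n\<^esub>"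
    and S: "S \<subseteq> Y"
  shows "a S = \<zero>\<^bsub>Wring R n\<^esub>"
proof (rule ccontr)
  assume "a S \<noteq> \<zero>\<^bsub>Wring R n\<^esub>"
  then obtain q where q: "a S q \<noteq> \<zero>" by (auto simp: fun_eq_iff Wring_def)
  interpret W: cring "Wring R n" by (rule Wring_cring)
  have fY: "finite Y" using Y finite_subset by blast
  obtain \<tau> \<mu> where top: "is_top n Y 1 n \<tau> \<mu>" using ryW_top_exists[of 1 n n Y] Y by auto
  have pr: "pairing Y \<tau> 1 n"
    and le: "\<And>m q. ryW n 1 n m q \<noteq> \<zero> \<Longrightarrow>
      weight Y q \<le> weight Y \<mu> \<and> (weight Y q = weight Y \<mu> \<longrightarrow> q = \<mu>)"
    and val: "\<And>m. ryW n 1 n m \<mu> = (if paired \<tau> 1 n m then \<one> else \<zero>)"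
    using top unfolding is_top_def by blast+
  \<comment> \<open>The maximum is taken over the rows jointly, as each coefficient may contain
    monomials of different weights.\<close>
  define D where "D = (SIGMA S:Pow Y. {q. a S q \<noteq> \<zero>})"
  have "finite {q. a S q \<noteq> \<zero>}" if "S \<subseteq> Y" for S
    using a[OF that] unfolding Wring_def mem_mpoly_ring_iff by blast
  then have finD: "finite D" unfolding D_def using fY by (intro finite_SigmaI) auto
  have "(S, q) \<in> D" using S q by (simp add: D_def)
  then have "Max ((weight Y \<circ> snd) ` D) \<in> (weight Y \<circ> snd) ` D"
    using finD by (intro Max_in) auto
  then obtain x where "x \<in> D" "Max ((weight Y \<circ> snd) ` D) = weight Y (snd x)" by auto
  moreover have "weight Y (snd y) \<le> Max ((weight Y \<circ> snd) ` D)" if "y \<in> D" for y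
    using that finD by (intro Max_ge) auto
  ultimately have "\<exists>x\<in>D. \<forall>y\<in>D. weight Y (snd y) \<le> weight Y (snd x)"
    by (intro bexI[of _ x] ballI) auto
  then obtain S0 q0 where S0: "S0 \<subseteq> Y" "a S0 q0 \<noteq> \<zero>"
    and max: "\<And>S q. S \<subseteq> Y \<Longrightarrow> a S q \<noteq> \<zero> \<Longrightarrow> weight Y q \<le> weight Y q0"
    by (auto simp: D_def)
  \<comment> \<open>The column in which the permutation matrix of the top part has its 1 in row
    \<open>S0\<close>.\<close>
  define T where "T = \<tau> ` S0"
  have T: "T \<subseteq> {1..n} - Y" using pr S0(1) Y(1) by (auto simp: T_def pairing_def)
  let ?r = "\<lambda>S. ryW n 1 n (mset_set (S \<union> T))"
  have r: "?r S \<in> carrier (Wring R n)" "?r S q \<in> carrier R" for S q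
    by (rule ryW_coeff_closed; simp)+
  have ac: "a S q \<in> carrier R" if "S \<subseteq> Y" for S q
    using a[OF that] unfolding Wring_def by (rule mpoly_coeff_closed)
  have prod: "(a S \<otimes>\<^bsub>Wring R n\<^esub> ?r S) (q0 + \<mu>) = (if S = S0 then a S0 q0 else \<zero>)" if S: "S \<in> Pow Y" for S
  proof -
    have "(a S \<otimes>\<^bsub>Wring R n\<^esub> ?r S) (q0 + \<mu>) = a S q0 \<otimes> ?r S \<mu>"
      unfolding Wring_def
    proof (rule mpoly_mult_unique)
      fix n1 n2 assume h: "n1 + n2 = q0 + \<mu>" "a S n1 \<noteq> \<zero>" "?r S n2 \<noteq> \<zero>"
      have "weight Y n1 + weight Y n2 = weight Y q0 + weight Y \<mu>"
        using arg_cong[OF h(1), of "weight Y"] by simp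
      \<comment> \<open>Several monomials of the coefficients may share the maximal weight;
        uniqueness of \<open>\<mu>\<close> alone fixes the factorisation, and \<open>n1\<close>
        follows by cancellation.\<close>
      then have "n2 = \<mu>" using le[OF h(3)] max[OF _ h(2)] S by auto
      then show "n1 = q0" using h(1) by simp
    qed (use ac r S in auto)
    also have "\<dots> = (if S = S0 then a S0 q0 else \<zero>)"
      using S S0(1) Y ac unfolding val T_def by (subst paired_union_image[OF pr]) auto
    finally show ?thesis .
  qed
  have "\<zero> = (\<Oplus>\<^bsub>Wring R n\<^esub>S\<in>Pow Y. a S \<otimes>\<^bsub>Wring R n\<^esub> ?r S) (q0 + \<mu>)"
    unfolding rel[OF T] by (simp add: Wring_def)
  also have "\<dots> = (\<Oplus>S\<in>Pow Y. (a S \<otimes>\<^bsub>Wring R n\<^esub> ?r S) (q0 + \<mu>))"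
    unfolding Wring_def using fY a r
    by (intro mpoly_finsum_apply mpoly_mult_closed) (auto simp: Wring_def)
  also have "\<dots> = (\<Oplus>S\<in>Pow Y. if S = S0 then a S0 q0 else \<zero>)"
    using ac[OF S0(1)] by (intro finsum_cong' refl prod) auto
  also have "\<dots> = a S0 q0"
    using fY S0(1) ac[OF S0(1)] by (subst finsum_single[of _ S0]) auto
  finally show False using S0 by simp
qed

section \<open>Nonsingularity over the field of rational functions\<close>

context domain
begin

lemma Wring_domain: "domain (Wring R n)"
  unfolding Wring_def by (rule mpoly_domain)

lemma Wfield_field: "field (Wfield R n)"
  unfolding Wfield_def by (rule domain.frac_field_is_field[OF Wring_domain])

lemma RY_eq_frac: "RY R n m = frac (Wring R n) (ryW n 1 n m) \<one>\<^bsub>Wring R n\<^esub>"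
proof -
  interpret W: domain "Wring R n" by (rule Wring_domain)
  interpret h: ring_hom_cring "Wring R n" "Wfield R n" "\<lambda>a. frac (Wring R n) a \<one>\<^bsub>Wring R n\<^esub>"
    unfolding Wfield_def by (rule W.frac_embed_hom)
  have "wgen R n = (\<lambda>i k j. frac (Wring R n) (indexed_var (i, k, j)) \<one>\<^bsub>Wring R n\<^esub>)"
    by (intro ext) (simp add: wgen_def)
  moreover have "indexed_var (i, k, j) \<in> carrier (Wring R n)"
    if "i \<in> {1..n}" "k \<in> {1..n}" "j \<in> {1..n}" for i k j
    using that unfolding Wring_def by (intro indexed_var_closed) auto
  ultimately show ?thesis
    unfolding RY_def ryW_def using h.ry_poly_hom[of n "\<lambda>i k j. indexed_var (i, k, j)" 1 n m] by auto
qed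

text \<open>The set of all points is invariant under any matching, so its monomial occurs in the top
  part with coefficient 1. Consequently every program for the polynomial uses all variables between
  source and sink.\<close>

lemma RY_full_nonzero:
  assumes "disc Y 1 n = 0"
  shows "RY R n (mset_set {1..n}) \<noteq> \<zero>\<^bsub>Wfield R n\<^esub>"
proof -
  interpret W: domain "Wring R n" by (rule Wring_domain)
  obtain \<tau> \<mu> where top: "is_top n Y 1 n \<tau> \<mu>" using ryW_top_exists[of 1 n n Y] assms by auto
  then have "paired \<tau> 1 n (mset_set {1..n})" by (auto simp: paired_def is_top_def pairing_def)
  then have "ryW n 1 n (mset_set {1..n}) \<mu> = \<one>" using top by (simp add: is_top_def)
  then have "ryW n 1 n (mset_set {1..n}) \<noteq> \<zero>\<^bsub>Wring R n\<^esub>" by (auto simp: Wring_def)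
  then show ?thesis
    using ryW_coeff_closed(1)[of 1 n n] unfolding RY_eq_frac Wfield_def W.frac_zero
    by (simp add: W.frac_eq_iff)
qed

theorem RY_nonsingular:
  assumes Y: "Y \<subseteq> {1..n}" "disc Y 1 n = 0"
    and c: "\<And>S. S \<subseteq> Y \<Longrightarrow> c S \<in> carrier (Wfield R n)"
    and rel: "\<And>T. T \<subseteq> {1..n} - Y \<Longrightarrow>
      (\<Oplus>\<^bsub>Wfield R n\<^esub>S\<in>Pow Y. c S \<otimes>\<^bsub>Wfield R n\<^esub> RY R n (mset_set (S \<union> T))) = \<zero>\<^bsub>Wfield R n\<^esub>"
    and S: "S \<subseteq> Y"
  shows "c S = \<zero>\<^bsub>Wfield R n\<^esub>"
proof -
  interpret W: domain "Wring R n" by (rule Wring_domain)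
  let ?h = "\<lambda>a. frac (Wring R n) a \<one>\<^bsub>Wring R n\<^esub>"
  have h0: "a = \<zero>\<^bsub>Wring R n\<^esub>" if "a \<in> carrier (Wring R n)" "?h a = \<zero>\<^bsub>Wfield R n\<^esub>" for a
    using that unfolding Wfield_def W.frac_zero by (simp add: W.frac_eq_iff)
  interpret K: field "Wfield R n" by (rule Wfield_field)
  interpret h: ring_hom_cring "Wring R n" "Wfield R n" ?h
    unfolding Wfield_def by (rule W.frac_embed_hom)
  have fY: "finite (Pow Y)" using Y finite_subset by blast
  obtain d a where d: "d \<in> carrier (Wring R n)" "d \<noteq> \<zero>\<^bsub>Wring R n\<^esub>"
    and a: "\<And>S. S \<in> Pow Y \<Longrightarrow> a S \<in> carrier (Wring R n)"
    and dc: "\<And>S. S \<in> Pow Y \<Longrightarrow> ?h d \<otimes>\<^bsub>Wfield R n\<^esub> c S = ?h (a S)"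
    using W.frac_common_denominator[OF fY, of c] c unfolding Wfield_def by auto
  have r: "ryW n 1 n m \<in> carrier (Wring R n)" for m by (rule ryW_coeff_closed) auto
  have rel': "(\<Oplus>\<^bsub>Wring R n\<^esub>S\<in>Pow Y. a S \<otimes>\<^bsub>Wring R n\<^esub> ryW n 1 n (mset_set (S \<union> T))) = \<zero>\<^bsub>Wring R n\<^esub>"
    if T: "T \<subseteq> {1..n} - Y" for T
  proof (rule h0)
    have "?h (\<Oplus>\<^bsub>Wring R n\<^esub>S\<in>Pow Y. a S \<otimes>\<^bsub>Wring R n\<^esub> ryW n 1 n (mset_set (S \<union> T)))
      = (\<Oplus>\<^bsub>Wfield R n\<^esub>S\<in>Pow Y. ?h (a S \<otimes>\<^bsub>Wring R n\<^esub> ryW n 1 n (mset_set (S \<union> T))))"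
      using a r by (subst h.hom_finsum) (auto simp: comp_def)
    also have "\<dots> = (\<Oplus>\<^bsub>Wfield R n\<^esub>S\<in>Pow Y.
        ?h d \<otimes>\<^bsub>Wfield R n\<^esub> (c S \<otimes>\<^bsub>Wfield R n\<^esub> RY R n (mset_set (S \<union> T))))"
    proof (intro K.finsum_cong' refl)
      fix S assume S: "S \<in> Pow Y"
      show "?h (a S \<otimes>\<^bsub>Wring R n\<^esub> ryW n 1 n (mset_set (S \<union> T)))
        = ?h d \<otimes>\<^bsub>Wfield R n\<^esub> (c S \<otimes>\<^bsub>Wfield R n\<^esub> RY R n (mset_set (S \<union> T)))"
        using a[OF S] dc[OF S, symmetric] r d c S by (simp add: RY_eq_frac K.m_assoc)
    qed (use c d r in \<open>auto simp: RY_eq_frac\<close>)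
    also have "\<dots> = ?h d \<otimes>\<^bsub>Wfield R n\<^esub> \<zero>\<^bsub>Wfield R n\<^esub>"
      unfolding rel[OF T, symmetric] using fY c d r
      by (subst K.finsum_rdistr) (auto simp: RY_eq_frac)
    finally show "?h (\<Oplus>\<^bsub>Wring R n\<^esub>S\<in>Pow Y. a S \<otimes>\<^bsub>Wring R n\<^esub> ryW n 1 n (mset_set (S \<union> T)))
        = \<zero>\<^bsub>Wfield R n\<^esub>" using d by simp
  qed (use a r in \<open>auto intro!: W.finsum_closed\<close>)
  have "a S = \<zero>\<^bsub>Wring R n\<^esub>"
    by (rule ryW_nonsingular[OF Y _ rel' S]) (use a in blast)+
  then have "?h d \<otimes>\<^bsub>Wfield R n\<^esub> c S = \<zero>\<^bsub>Wfield R n\<^esub>" using dc S by simp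
  then show ?thesis using d c[OF S] h0[of d] by (auto simp: K.integral_iff)
qed

end

section \<open>Rank\<close>

text \<open>A squarefree monomial factors in only one way into parts with variables in disjoint sets
  \<open>A\<close> and \<open>B\<close>. This turns products of polynomials into entrywise products
  of their coefficient matrices.\<close>

lemma (in cring) mpoly_mult_disjoint_support:
  assumes c: "\<And>m. p m \<in> carrier R" "\<And>m. q m \<in> carrier R"
    and s: "\<And>m. p m \<noteq> \<zero> \<Longrightarrow> set_mset m \<subseteq> A" "\<And>m. q m \<noteq> \<zero> \<Longrightarrow> set_mset m \<subseteq> B" "A \<inter> B = {}"
    and D: "finite D"
  shows "(p \<otimes>\<^bsub>mpoly_ring R V\<^esub> q) (mset_set D)
    = (if D \<subseteq> A \<union> B then p (mset_set (D \<inter> A)) \<otimes> q (mset_set (D \<inter> B)) else \<zero>)"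
proof (cases "D \<subseteq> A \<union> B")
  case False
  have "(p \<otimes>\<^bsub>mpoly_ring R V\<^esub> q) (mset_set D) = \<zero>"
  proof (rule ccontr)
    assume "\<not> ?thesis"
    then obtain m1 m2 where m: "mset_set D = m1 + m2" "p m1 \<noteq> \<zero>" "q m2 \<noteq> \<zero>"
      using c by (elim mpoly_mult_nonzeroE) auto
    have "set_mset (m1 + m2) = D" using D m(1)[symmetric] by simp
    then show False using s(1)[OF m(2)] s(2)[OF m(3)] False by auto
  qed
  then show ?thesis using False by simp
next
  case True
  have D': "D = (D \<inter> A) \<union> (D \<inter> B)" "(D \<inter> A) \<inter> (D \<inter> B) = {}" using True s(3) by auto
  have m: "mset_set D = mset_set (D \<inter> A) + mset_set (D \<inter> B)"
    using D D' by (metis finite_Int mset_set_Union)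
  have "(p \<otimes>\<^bsub>mpoly_ring R V\<^esub> q) (mset_set (D \<inter> A) + mset_set (D \<inter> B))
      = p (mset_set (D \<inter> A)) \<otimes> q (mset_set (D \<inter> B))"
  proof (rule mpoly_mult_unique)
    fix n1 n2 assume eq: "n1 + n2 = mset_set (D \<inter> A) + mset_set (D \<inter> B)"
      and nz: "p n1 \<noteq> \<zero>" "q n2 \<noteq> \<zero>"
    have f: "filter_mset (\<lambda>x. x \<in> A) n1 = n1" "filter_mset (\<lambda>x. x \<in> A) n2 = {#}"
      using s(1)[OF nz(1)] s(2)[OF nz(2)] s(3) by (auto simp: filter_mset_eq_conv)
    have "filter_mset (\<lambda>x. x \<in> A) (n1 + n2) = mset_set (D \<inter> A)"
      unfolding eq m[symmetric] using D by (simp add: filter_mset_mset_set Int_def)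
    then show "n1 = mset_set (D \<inter> A)" unfolding filter_union_mset f by simp
  qed (use c in auto)
  then show ?thesis using True m by simp
qed

section \<open>Rank of matrices indexed by subsets\<close>

context field
begin

text \<open>Rank at most \<open>r\<close>, stated by duality: saying that the columns lie in the
  span of \<open>r\<close> vectors amounts to saying that whatever annihilates these vectors
  annihilates every column. This form needs no notion of dimension and combines directly with a
  homogeneous system of equations.\<close>

definition col_rank_le where
  "col_rank_le Y Z M r \<longleftrightarrow> (\<exists>\<Phi>. finite \<Phi> \<and> card \<Phi> \<le> r \<and> (\<forall>\<phi>\<in>\<Phi>. \<forall>S\<subseteq>Y. \<phi> S \<in> carrier R) \<and>
     (\<forall>c. (\<forall>S\<subseteq>Y. c S \<in> carrier R) \<longrightarrow> (\<forall>\<phi>\<in>\<Phi>. (\<Oplus>S\<in>Pow Y. c S \<otimes> \<phi> S) = \<zero>) \<longrightarrow>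
       (\<forall>T\<subseteq>Z. (\<Oplus>S\<in>Pow Y. c S \<otimes> M S T) = \<zero>)))"

text \<open>Once \<open>S \<inter> Y'\<close> and \<open>T \<inter> Z'\<close> are fixed, the matrix
  is a product of a function of \<open>S\<close> and a function of \<open>T\<close>, so it consists
  of \<open>2 ^ k\<close> blocks of rank at most one. Sets on both sides are allowed because
  different factors of a product may be cheaper on different sides.\<close>

definition factors where
  "factors Y Z M k \<longleftrightarrow> (\<exists>Y' Z' A B. Y' \<subseteq> Y \<and> Z' \<subseteq> Z \<and> card Y' + card Z' \<le> k \<and>
     (\<forall>S T. A S T \<in> carrier R \<and> B S T \<in> carrier R) \<and>
     (\<forall>S T. S \<subseteq> Y \<longrightarrow> T \<subseteq> Z \<longrightarrow> M S T = A S (T \<inter> Z') \<otimes> B (S \<inter> Y') T))"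

lemma factorsI:
  assumes "Y' \<subseteq> Y" "Z' \<subseteq> Z" "card Y' + card Z' \<le> k"
    and "\<And>S T. A S T \<in> carrier R" "\<And>S T. B S T \<in> carrier R"
    and "\<And>S T. S \<subseteq> Y \<Longrightarrow> T \<subseteq> Z \<Longrightarrow> M S T = A S (T \<inter> Z') \<otimes> B (S \<inter> Y') T"
  shows "factors Y Z M k"
  unfolding factors_def using assms by blast

lemma factorsE:
  assumes "factors Y Z M k"
  obtains Y' Z' A B where "Y' \<subseteq> Y" "Z' \<subseteq> Z" "card Y' + card Z' \<le> k"
    "\<And>S T. A S T \<in> carrier R" "\<And>S T. B S T \<in> carrier R"
    "\<And>S T. S \<subseteq> Y \<Longrightarrow> T \<subseteq> Z \<Longrightarrow> M S T = A S (T \<inter> Z') \<otimes> B (S \<inter> Y') T"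
  using assms unfolding factors_def
proof (elim exE conjE)
  fix Y' Z' A B
  assume h: "Y' \<subseteq> Y" "Z' \<subseteq> Z" "card Y' + card Z' \<le> k"
    "\<forall>S T. A S T \<in> carrier R \<and> B S T \<in> carrier R"
    "\<forall>S T. S \<subseteq> Y \<longrightarrow> T \<subseteq> Z \<longrightarrow> M S T = A S (T \<inter> Z') \<otimes> B (S \<inter> Y') T"
  show thesis
    by (rule that[of Y' Z' A B]) (use h in simp_all)
qed

lemma col_rank_leE:
  assumes "col_rank_le Y Z M r"
  obtains \<Phi> where "finite \<Phi>" "card \<Phi> \<le> r" "\<And>\<phi> S. \<phi> \<in> \<Phi> \<Longrightarrow> S \<subseteq> Y \<Longrightarrow> \<phi> S \<in> carrier R"
     "\<And>c T. \<forall>S\<subseteq>Y. c S \<in> carrier R \<Longrightarrow> \<forall>\<phi>\<in>\<Phi>. (\<Oplus>S\<in>Pow Y. c S \<otimes> \<phi> S) = \<zero> \<Longrightarrow>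
       T \<subseteq> Z \<Longrightarrow> (\<Oplus>S\<in>Pow Y. c S \<otimes> M S T) = \<zero>"
  using assms unfolding col_rank_le_def
proof (elim exE conjE)
  fix \<Phi>
  assume h: "finite \<Phi>" "card \<Phi> \<le> r" "\<forall>\<phi>\<in>\<Phi>. \<forall>S\<subseteq>Y. \<phi> S \<in> carrier R"
    "\<forall>c. (\<forall>S\<subseteq>Y. c S \<in> carrier R) \<longrightarrow> (\<forall>\<phi>\<in>\<Phi>. (\<Oplus>S\<in>Pow Y. c S \<otimes> \<phi> S) = \<zero>) \<longrightarrow>
       (\<forall>T\<subseteq>Z. (\<Oplus>S\<in>Pow Y. c S \<otimes> M S T) = \<zero>)"
  show thesis
    by (rule that[of \<Phi>]) (use h in simp_all)
qed

lemma col_rank_leI: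
  assumes "finite \<Phi>" "card \<Phi> \<le> r" "\<And>\<phi> S. \<phi> \<in> \<Phi> \<Longrightarrow> S \<subseteq> Y \<Longrightarrow> \<phi> S \<in> carrier R"
    and "\<And>c T. (\<forall>S\<subseteq>Y. c S \<in> carrier R) \<Longrightarrow> (\<forall>\<phi>\<in>\<Phi>. (\<Oplus>S\<in>Pow Y. c S \<otimes> \<phi> S) = \<zero>) \<Longrightarrow>
       T \<subseteq> Z \<Longrightarrow> (\<Oplus>S\<in>Pow Y. c S \<otimes> M S T) = \<zero>"
  shows "col_rank_le Y Z M r"
  unfolding col_rank_le_def
  by (rule exI[of _ \<Phi>], intro conjI allI impI ballI) (simp_all add: assms(1-3), rule assms(4))

lemma factors_mono: "factors Y Z M k \<Longrightarrow> k \<le> l \<Longrightarrow> factors Y Z M l"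
  unfolding factors_def by (meson order_trans)

text \<open>The exponents add because fixing the unions of the two pairs of sets decouples both
  factors simultaneously.\<close>

lemma factors_mult:
  assumes "factors Y Z M1 k1" "factors Y Z M2 k2"
  shows "factors Y Z (\<lambda>S T. M1 S T \<otimes> M2 S T) (k1 + k2)"
proof -
  obtain Y1 Z1 A1 B1 where 1: "Y1 \<subseteq> Y" "Z1 \<subseteq> Z" "card Y1 + card Z1 \<le> k1"
    "\<And>S T. A1 S T \<in> carrier R" "\<And>S T. B1 S T \<in> carrier R"
    "\<And>S T. S \<subseteq> Y \<Longrightarrow> T \<subseteq> Z \<Longrightarrow> M1 S T = A1 S (T \<inter> Z1) \<otimes> B1 (S \<inter> Y1) T"
    using assms(1) by (rule factorsE) (rule that)
  obtain Y2 Z2 A2 B2 where 2: "Y2 \<subseteq> Y" "Z2 \<subseteq> Z" "card Y2 + card Z2 \<le> k2"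
    "\<And>S T. A2 S T \<in> carrier R" "\<And>S T. B2 S T \<in> carrier R"
    "\<And>S T. S \<subseteq> Y \<Longrightarrow> T \<subseteq> Z \<Longrightarrow> M2 S T = A2 S (T \<inter> Z2) \<otimes> B2 (S \<inter> Y2) T"
    using assms(2) by (rule factorsE) (rule that)
  have cd: "card (Y1 \<union> Y2) + card (Z1 \<union> Z2) \<le> k1 + k2"
    using card_Un_le[of Y1 Y2] card_Un_le[of Z1 Z2] 1(3) 2(3) by linarith
  have eq: "M1 S T \<otimes> M2 S T = (A1 S (T \<inter> (Z1 \<union> Z2) \<inter> Z1) \<otimes> A2 S (T \<inter> (Z1 \<union> Z2) \<inter> Z2))
      \<otimes> (B1 (S \<inter> (Y1 \<union> Y2) \<inter> Y1) T \<otimes> B2 (S \<inter> (Y1 \<union> Y2) \<inter> Y2) T)"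
    if "S \<subseteq> Y" "T \<subseteq> Z" for S T
  proof -
    have "T \<inter> (Z1 \<union> Z2) \<inter> Z1 = T \<inter> Z1" "T \<inter> (Z1 \<union> Z2) \<inter> Z2 = T \<inter> Z2"
      "S \<inter> (Y1 \<union> Y2) \<inter> Y1 = S \<inter> Y1" "S \<inter> (Y1 \<union> Y2) \<inter> Y2 = S \<inter> Y2" by auto
    then show ?thesis using that 1(4-6) 2(4-6) by (simp add: m_ac)
  qed
  show ?thesis
    by (rule factorsI[of "Y1 \<union> Y2" Y "Z1 \<union> Z2" Z _ "\<lambda>S V. A1 S (V \<inter> Z1) \<otimes> A2 S (V \<inter> Z2)"
          "\<lambda>U T. B1 (U \<inter> Y1) T \<otimes> B2 (U \<inter> Y2) T", OF _ _ cd _ _ eq])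
      (use 1(1,2,4,5) 2(1,2,4,5) in auto)
qed

lemma factors_subset: "factors Y Z (\<lambda>S T. if S \<union> T \<subseteq> C then \<one> else \<zero>) 0"
  by (rule factorsI[of "{}" _ "{}" _ _ "\<lambda>S _. if S \<subseteq> C then \<one> else \<zero>"
        "\<lambda>_ T. if T \<subseteq> C then \<one> else \<zero>"]) auto

text \<open>A dependence on the points of \<open>A\<close> alone is decoupled by fixing its part in
  \<open>Y\<close> or its part in \<open>Z\<close>, whichever is smaller.\<close>

lemma factors_local:
  assumes "\<And>D. f D \<in> carrier R"
  shows "factors Y Z (\<lambda>S T. f ((S \<union> T) \<inter> A)) (min (card (A \<inter> Y)) (card (A \<inter> Z)))"
proof (cases "card (A \<inter> Y) \<le> card (A \<inter> Z)")
  case True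
  have "f ((S \<union> T) \<inter> A) = \<one> \<otimes> f ((S \<inter> (A \<inter> Y)) \<union> (T \<inter> A))" if "S \<subseteq> Y" for S T
  proof -
    have "(S \<union> T) \<inter> A = (S \<inter> (A \<inter> Y)) \<union> (T \<inter> A)" using that by auto
    then show ?thesis using assms by simp
  qed
  then show ?thesis using True assms
    by (intro factorsI[of "A \<inter> Y" _ "{}" _ _ "\<lambda>_ _. \<one>" "\<lambda>U T. f (U \<union> (T \<inter> A))"]) auto
next
  case False
  have "f ((S \<union> T) \<inter> A) = f ((S \<inter> A) \<union> (T \<inter> (A \<inter> Z))) \<otimes> \<one>" if "T \<subseteq> Z" for S T
  proof -
    have "(S \<union> T) \<inter> A = (S \<inter> A) \<union> (T \<inter> (A \<inter> Z))" using that by auto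
    then show ?thesis using assms by simp
  qed
  then show ?thesis using False assms
    by (intro factorsI[of "{}" _ "A \<inter> Z" _ _ "\<lambda>S V. f ((S \<inter> A) \<union> V)" "\<lambda>_ _. \<one>"]) auto
qed

lemma factors_rank:
  assumes fin: "finite Y" "finite Z" and fac: "factors Y Z M k"
  shows "col_rank_le Y Z M (2 ^ k)"
proof -
  obtain Y' Z' A B where Y': "Y' \<subseteq> Y" "Z' \<subseteq> Z" "card Y' + card Z' \<le> k"
    and cl: "\<And>S T. A S T \<in> carrier R" "\<And>S T. B S T \<in> carrier R"
    and M: "\<And>S T. S \<subseteq> Y \<Longrightarrow> T \<subseteq> Z \<Longrightarrow> M S T = A S (T \<inter> Z') \<otimes> B (S \<inter> Y') T"
    using fac by (rule factorsE) (rule that)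
  have f': "finite Y'" "finite Z'" using fin Y'(1,2) by (auto intro: rev_finite_subset)
  \<comment> \<open>One vector per block: the column of \<open>T\<close> is the combination of the
    vectors \<open>\<phi> U (T \<inter> Z')\<close> with coefficients \<open>B U T\<close>.\<close>
  define \<phi> where "\<phi> U V = (\<lambda>S. if S \<inter> Y' = U then A S V else \<zero>)" for U V
  define \<Phi> where "\<Phi> = (\<lambda>(U, V). \<phi> U V) ` (Pow Y' \<times> Pow Z')"
  have "card \<Phi> \<le> card (Pow Y' \<times> Pow Z')" unfolding \<Phi>_def using f' by (intro card_image_le) auto
  also have "\<dots> = 2 ^ (card Y' + card Z')"
    using f' by (simp add: card_cartesian_product card_Pow power_add)
  also have "\<dots> \<le> 2 ^ k" using Y'(3) by (intro power_increasing) auto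
  finally have r1: "card \<Phi> \<le> 2 ^ k" .
  have r2: "finite \<Phi>" unfolding \<Phi>_def using f' by auto
  have r3: "\<phi> S \<in> carrier R" if "\<phi> \<in> \<Phi>" for \<phi> S using cl that by (auto simp: \<Phi>_def \<phi>_def)
  have r4: "(\<Oplus>S\<in>Pow Y. c S \<otimes> M S T) = \<zero>"
    if c: "\<forall>S\<subseteq>Y. c S \<in> carrier R" and k: "\<forall>\<phi>\<in>\<Phi>. (\<Oplus>S\<in>Pow Y. c S \<otimes> \<phi> S) = \<zero>" and T: "T \<subseteq> Z"
    for c T
  proof -
    define V where "V = T \<inter> Z'"
    have V: "V \<in> Pow Z'" by (auto simp: V_def)
    have \<phi>c: "\<phi> U V S \<in> carrier R" for U S using cl by (simp add: \<phi>_def)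
    have "(\<Oplus>S\<in>Pow Y. c S \<otimes> M S T) = (\<Oplus>S\<in>Pow Y. \<Oplus>U\<in>Pow Y'. B U T \<otimes> (c S \<otimes> \<phi> U V S))"
    proof (intro finsum_cong' refl)
      fix S assume S: "S \<in> Pow Y"
      have "(\<Oplus>U\<in>Pow Y'. B U T \<otimes> (c S \<otimes> \<phi> U V S)) = B (S \<inter> Y') T \<otimes> (c S \<otimes> \<phi> (S \<inter> Y') V S)"
        using f' S c cl \<phi>c by (intro finsum_single) (auto simp: \<phi>_def)
      then show "c S \<otimes> M S T = (\<Oplus>U\<in>Pow Y'. B U T \<otimes> (c S \<otimes> \<phi> U V S))"
        using S T c cl by (simp add: M \<phi>_def V_def m_ac)
    qed (use c cl \<phi>c in \<open>auto intro!: finsum_closed\<close>)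
    also have "\<dots> = (\<Oplus>U\<in>Pow Y'. \<Oplus>S\<in>Pow Y. B U T \<otimes> (c S \<otimes> \<phi> U V S))"
      using fin f' c cl \<phi>c by (intro finsum_swap) auto
    also have "\<dots> = \<zero>"
    proof (rule finsum_zeroI)
      fix U assume U: "U \<in> Pow Y'"
      have "(\<Oplus>S\<in>Pow Y. B U T \<otimes> (c S \<otimes> \<phi> U V S)) = B U T \<otimes> (\<Oplus>S\<in>Pow Y. c S \<otimes> \<phi> U V S)"
        using fin c cl \<phi>c by (intro finsum_rdistr[symmetric]) auto
      also have "(\<Oplus>S\<in>Pow Y. c S \<otimes> \<phi> U V S) = \<zero>"
        using U V k by (auto simp: \<Phi>_def)
      finally show "(\<Oplus>S\<in>Pow Y. B U T \<otimes> (c S \<otimes> \<phi> U V S)) = \<zero>" using cl by simp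
    qed
    finally show ?thesis .
  qed
  show ?thesis
    by (rule col_rank_leI[where \<Phi> = \<Phi> and M = M and Y = Y and Z = Z, OF r2 r1])
      ((rule r3; assumption), (rule r4; assumption))
qed

lemma col_rank_le_sum:
  assumes fin: "finite I" "finite Y"
    and rank: "\<And>i. i \<in> I \<Longrightarrow> col_rank_le Y Z (M i) r"
    and cl: "\<And>i S T. i \<in> I \<Longrightarrow> S \<subseteq> Y \<Longrightarrow> T \<subseteq> Z \<Longrightarrow> M i S T \<in> carrier R"
  shows "col_rank_le Y Z (\<lambda>S T. \<Oplus>i\<in>I. M i S T) (card I * r)"
proof -
  have "\<forall>i\<in>I. \<exists>\<Phi>. finite \<Phi> \<and> card \<Phi> \<le> r \<and> (\<forall>\<phi>\<in>\<Phi>. \<forall>S\<subseteq>Y. \<phi> S \<in> carrier R) \<and>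
     (\<forall>c. (\<forall>S\<subseteq>Y. c S \<in> carrier R) \<longrightarrow> (\<forall>\<phi>\<in>\<Phi>. (\<Oplus>S\<in>Pow Y. c S \<otimes> \<phi> S) = \<zero>) \<longrightarrow>
       (\<forall>T\<subseteq>Z. (\<Oplus>S\<in>Pow Y. c S \<otimes> M i S T) = \<zero>))"
    using rank unfolding col_rank_le_def by blast
  from bchoice[OF this] obtain \<Phi> where \<Phi>: "\<forall>i\<in>I. finite (\<Phi> i) \<and> card (\<Phi> i) \<le> r \<and> (\<forall>\<phi>\<in>\<Phi> i. \<forall>S\<subseteq>Y. \<phi> S \<in> carrier R) \<and>
     (\<forall>c. (\<forall>S\<subseteq>Y. c S \<in> carrier R) \<longrightarrow> (\<forall>\<phi>\<in>\<Phi> i. (\<Oplus>S\<in>Pow Y. c S \<otimes> \<phi> S) = \<zero>) \<longrightarrow>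
       (\<forall>T\<subseteq>Z. (\<Oplus>S\<in>Pow Y. c S \<otimes> M i S T) = \<zero>))"
    by (elim exE)
  have "card (\<Union>i\<in>I. \<Phi> i) \<le> (\<Sum>i\<in>I. card (\<Phi> i))" using fin(1) by (rule card_UN_le)
  also have "\<dots> \<le> card I * r" using \<Phi> sum_bounded_above[of I "\<lambda>i. card (\<Phi> i)" r] by simp
  finally have r1: "card (\<Union>i\<in>I. \<Phi> i) \<le> card I * r" .
  have r2: "finite (\<Union>i\<in>I. \<Phi> i)" using fin \<Phi> by auto
  have r3: "\<phi> S \<in> carrier R" if "\<phi> \<in> (\<Union>i\<in>I. \<Phi> i)" "S \<subseteq> Y" for \<phi> S using \<Phi> that by blast
  have r4: "(\<Oplus>S\<in>Pow Y. c S \<otimes> (\<Oplus>i\<in>I. M i S T)) = \<zero>"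
    if c: "\<forall>S\<subseteq>Y. c S \<in> carrier R" and k: "\<forall>\<phi>\<in>(\<Union>i\<in>I. \<Phi> i). (\<Oplus>S\<in>Pow Y. c S \<otimes> \<phi> S) = \<zero>"
      and T: "T \<subseteq> Z" for c T
  proof -
    have "(\<Oplus>S\<in>Pow Y. c S \<otimes> (\<Oplus>i\<in>I. M i S T)) = (\<Oplus>S\<in>Pow Y. \<Oplus>i\<in>I. c S \<otimes> M i S T)"
      using fin c cl T by (intro finsum_cong' finsum_rdistr) (auto intro!: finsum_closed)
    also have "\<dots> = (\<Oplus>i\<in>I. \<Oplus>S\<in>Pow Y. c S \<otimes> M i S T)"
      using fin c cl T by (intro finsum_swap) auto
    also have "\<dots> = \<zero>"
    proof (rule finsum_zeroI)
      fix i assume i: "i \<in> I"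
      have k': "\<forall>\<phi>\<in>\<Phi> i. (\<Oplus>S\<in>Pow Y. c S \<otimes> \<phi> S) = \<zero>" using k i by blast
      show "(\<Oplus>S\<in>Pow Y. c S \<otimes> M i S T) = \<zero>"
        by (rule bspec[OF \<Phi> i, THEN conjunct2, THEN conjunct2, THEN conjunct2, THEN spec[of _ c],
              THEN mp, OF c, THEN mp, OF k', THEN spec[of _ T], THEN mp, OF T])
    qed
    finally show ?thesis .
  qed
  show ?thesis
    by (rule col_rank_leI[where \<Phi> = "\<Union>i\<in>I. \<Phi> i" and Y = Y and Z = Z, OF r2 r1])
      ((rule r3; assumption), (rule r4; assumption))
qed

lemma col_rank_le_cong:
  assumes "col_rank_le Y Z M r" "r \<le> r'" "\<And>S T. S \<subseteq> Y \<Longrightarrow> T \<subseteq> Z \<Longrightarrow> M' S T = M S T"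
    and "\<And>S T. S \<subseteq> Y \<Longrightarrow> T \<subseteq> Z \<Longrightarrow> M S T \<in> carrier R"
  shows "col_rank_le Y Z M' r'"
proof -
  obtain \<Phi> where \<Phi>: "finite \<Phi>" "card \<Phi> \<le> r" "\<And>\<phi> S. \<phi> \<in> \<Phi> \<Longrightarrow> S \<subseteq> Y \<Longrightarrow> \<phi> S \<in> carrier R"
     "\<And>c T. \<forall>S\<subseteq>Y. c S \<in> carrier R \<Longrightarrow> \<forall>\<phi>\<in>\<Phi>. (\<Oplus>S\<in>Pow Y. c S \<otimes> \<phi> S) = \<zero> \<Longrightarrow>
       T \<subseteq> Z \<Longrightarrow> (\<Oplus>S\<in>Pow Y. c S \<otimes> M S T) = \<zero>"
    using assms(1) by (rule col_rank_leE) (rule that)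
  show ?thesis
  proof (rule col_rank_leI[where \<Phi> = \<Phi> and M = M' and Y = Y and Z = Z])
    show "card \<Phi> \<le> r'" using \<Phi>(2) assms(2) by simp
    fix c T
    assume c: "\<forall>S\<subseteq>Y. c S \<in> carrier R" "\<forall>\<phi>\<in>\<Phi>. (\<Oplus>S\<in>Pow Y. c S \<otimes> \<phi> S) = \<zero>" and T: "T \<subseteq> Z"
    have "(\<Oplus>S\<in>Pow Y. c S \<otimes> M' S T) = (\<Oplus>S\<in>Pow Y. c S \<otimes> M S T)"
      using c T assms(3,4) by (intro finsum_cong') auto
    also have "\<dots> = \<zero>"
      by (rule \<Phi>(4)) (use c T in auto)
    finally show "(\<Oplus>S\<in>Pow Y. c S \<otimes> M' S T) = \<zero>" .
  qed (use \<Phi>(1,3) in auto)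
qed

text \<open>Fewer than \<open>2 ^ card Y\<close> vectors would leave a nonzero common annihilator by
  \<open>homogeneous_system\<close>, and it would be a relation between the rows.\<close>

lemma nonsingular_rank:
  assumes fin: "finite Y" and rank: "col_rank_le Y Z M r"
    and nonsing: "\<And>c. (\<And>S. S \<subseteq> Y \<Longrightarrow> c S \<in> carrier R) \<Longrightarrow>
      (\<And>T. T \<subseteq> Z \<Longrightarrow> (\<Oplus>S\<in>Pow Y. c S \<otimes> M S T) = \<zero>) \<Longrightarrow> \<forall>S\<subseteq>Y. c S = \<zero>"
  shows "2 ^ card Y \<le> r"
proof (rule ccontr)
  assume "\<not> ?thesis"
  then have lt: "r < card (Pow Y)" using fin by (simp add: card_Pow)
  obtain \<Phi> where \<Phi>: "finite \<Phi>" "card \<Phi> \<le> r" "\<And>\<phi> S. \<phi> \<in> \<Phi> \<Longrightarrow> S \<subseteq> Y \<Longrightarrow> \<phi> S \<in> carrier R"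
     "\<And>c T. \<forall>S\<subseteq>Y. c S \<in> carrier R \<Longrightarrow> \<forall>\<phi>\<in>\<Phi>. (\<Oplus>S\<in>Pow Y. c S \<otimes> \<phi> S) = \<zero> \<Longrightarrow>
       T \<subseteq> Z \<Longrightarrow> (\<Oplus>S\<in>Pow Y. c S \<otimes> M S T) = \<zero>"
    using rank by (rule col_rank_leE) (rule that)
  obtain c where c: "\<And>S. S \<in> Pow Y \<Longrightarrow> c S \<in> carrier R" "\<exists>S\<in>Pow Y. c S \<noteq> \<zero>"
    "\<And>\<phi>. \<phi> \<in> \<Phi> \<Longrightarrow> (\<Oplus>S\<in>Pow Y. c S \<otimes> \<phi> S) = \<zero>"
  proof (rule homogeneous_system[of "Pow Y" \<Phi> "\<lambda>\<phi>. \<phi>"])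
    show "finite (Pow Y)" "finite \<Phi>" using fin \<Phi>(1) by auto
    show "card \<Phi> < card (Pow Y)" using \<Phi>(2) lt by (rule le_less_trans)
    show "\<phi> S \<in> carrier R" if "\<phi> \<in> \<Phi>" "S \<in> Pow Y" for \<phi> S using \<Phi>(3) that by blast
  qed blast
  have "\<forall>S\<subseteq>Y. c S = \<zero>"
    by (rule nonsing) (use c \<Phi>(4)[of c] in auto)
  then show False using c(2) by auto
qed

end

section \<open>Branching programs\<close>

text \<open>Disjointness of the variables before and after a node is the form of multilinearity that
  the factorisations below rely on. For a strict program it follows from the disjointness of the two
  arcs at a common node.\<close>

locale disjoint_abp = field +
  fixes n :: nat and P :: "'a abp"
  assumes abp: "is_abp R n P"
    and disj: "\<And>u a v. u \<in> nodes P \<Longrightarrow> a \<in> nodes P \<Longrightarrow> v \<in> nodes P \<Longrightarrow>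
      vars_between P u a \<inter> vars_between P a v = {}"
begin

abbreviation "MP \<equiv> mpoly_ring R {1..n}"

sublocale M: cring MP by (rule mpoly_cring)

lemma finite_nodes: "finite (nodes P)"
  and layers_disjoint: "\<forall>l\<le>depth P. \<forall>l'\<le>depth P. l \<noteq> l' \<longrightarrow> layer P l \<inter> layer P l' = {}"
  and first_layer: "layer P 0 = {source P}"
  and last_layer: "layer P (depth P) = {sink P}"
  and edges_layers: "edges P \<subseteq> (\<Union>l<depth P. layer P l \<times> layer P (Suc l))"
  and in_degree: "\<forall>v\<in>nodes P. (\<nexists>u. (u, v) \<in> edges P) \<longleftrightarrow> v = source P"
  and out_degree: "\<forall>v\<in>nodes P. (\<nexists>u. (v, u) \<in> edges P) \<longleftrightarrow> v = sink P"
  and edge_labels: "\<forall>(u, v)\<in>edges P. lab P u v \<in> Var ` {1..n} \<union> Const ` carrier R"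
  by (insert abp, unfold is_abp_def) (elim conjE, assumption)+

lemma edge_nodes: "(u, v) \<in> edges P \<Longrightarrow> u \<in> nodes P \<and> v \<in> nodes P"
proof -
  assume "(u, v) \<in> edges P"
  then obtain l where "l < depth P" "u \<in> layer P l" "v \<in> layer P (Suc l)"
    using edges_layers by blast
  then show ?thesis unfolding nodes_def by (auto intro: less_imp_le Suc_leI)
qed

lemma finite_edges: "finite (edges P)" "card (edges P) \<le> card (nodes P) ^ 2"
proof -
  have sub: "edges P \<subseteq> nodes P \<times> nodes P" using edge_nodes by auto
  show "finite (edges P)" using finite_subset[OF sub] finite_nodes by auto
  have "card (edges P) \<le> card (nodes P \<times> nodes P)" using sub finite_nodes by (intro card_mono) auto
  then show "card (edges P) \<le> card (nodes P) ^ 2" by (simp add: card_cartesian_product power2_eq_square)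
qed

lemma source_node: "source P \<in> nodes P" and sink_node: "sink P \<in> nodes P"
  using first_layer last_layer by (auto simp: nodes_def)

lemma label_cases:
  assumes "(u, v) \<in> edges P"
  obtains i where "lab P u v = Var i" "i \<in> {1..n}" | c where "lab P u v = Const c" "c \<in> carrier R"
proof -
  have "lab P u v \<in> Var ` {1..n} \<union> Const ` carrier R" using assms edge_labels by blast
  then show ?thesis using that by blast
qed

lemma label_poly_closed: "(u, v) \<in> edges P \<Longrightarrow> label_poly R (lab P u v) \<in> carrier MP"
  by (elim label_cases) (simp_all only: label_poly.simps indexed_var_closed indexed_const_closed)

definition level :: "nat \<Rightarrow> nat" where
  "level v = (THE l. l \<le> depth P \<and> v \<in> layer P l)"

lemma level_eq: "l \<le> depth P \<Longrightarrow> v \<in> layer P l \<Longrightarrow> level v = l"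
  unfolding level_def using layers_disjoint by (intro the_equality) blast+

lemma level_edge:
  assumes "(u, v) \<in> edges P"
  shows "level v = Suc (level u)"
proof -
  obtain l where "l < depth P" "u \<in> layer P l" "v \<in> layer P (Suc l)"
    using edges_layers assms by blast
  then show ?thesis using level_eq[of l u] level_eq[of "Suc l" v] by simp
qed

text \<open>Each edge raises the layer by one. Besides excluding repetitions, this makes the set of
  paths between two nodes finite.\<close>

lemma path_distinct:
  assumes "successively (\<lambda>a b. (a, b) \<in> edges P) p"
  shows "distinct p"
proof -
  have "successively (\<lambda>a b. level a < level b) p"
    using assms by (rule successively_mono) (auto simp: level_edge)
  then have "sorted_wrt (\<lambda>a b. level a < level b) p"
    by (subst (asm) successively_conv_sorted_wrt) (auto simp: transp_def)
  then have "sorted_wrt (<) (map level p)" by (simp add: sorted_wrt_map)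
  then have "distinct (map level p)" by (simp add: strict_sorted_iff)
  then show ?thesis by (simp add: distinct_map)
qed

lemma finite_paths: "finite (paths P u v)"
proof (rule finite_subset)
  show "paths P u v \<subseteq> {p. set p \<subseteq> nodes P \<and> distinct p}"
    using path_distinct by (auto simp: paths_def)
  show "finite {p. set p \<subseteq> nodes P \<and> distinct p}"
    using finite_nodes by (rule finite_subset_distinct)
qed

lemma paths_append_edge:
  assumes "p \<in> paths P x u" "(u, v) \<in> edges P" "q \<in> paths P v t"
  shows "p @ q \<in> paths P x t"
  using assms by (auto simp: paths_def successively_append_iff)

lemma path_labels_Cons [simp]:
  "path_labels P [] = []" "path_labels P [a] = []"
  "path_labels P (a # b # p) = lab P a b # path_labels P (b # p)"
  by (simp_all add: path_labels_def)

lemma path_labels_append: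
  "p \<noteq> [] \<Longrightarrow> q \<noteq> [] \<Longrightarrow>
    path_labels P (p @ q) = path_labels P p @ lab P (last p) (hd q) # path_labels P q"
proof (induction p rule: induct_list012)
  case (2 a)
  then show ?case by (cases q) auto
qed auto

lemma path_singleton: "u \<in> nodes P \<Longrightarrow> [u] \<in> paths P u u"
  by (simp add: paths_def)

lemma paths_source: "paths P u (source P) \<subseteq> {[source P]}"
proof
  fix p assume p: "p \<in> paths P u (source P)"
  then have "p \<noteq> []" "last p = source P" by (auto simp: paths_def)
  then obtain q where q: "p = q @ [source P]" by (metis append_butlast_last_id)
  have "q = []"
  proof (rule ccontr)
    assume "q \<noteq> []"
    then have "(last q, source P) \<in> edges P"
      using p q by (auto simp: paths_def successively_append_iff)
    then show False using in_degree source_node by blast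
  qed
  then show "p \<in> {[source P]}" using q by simp
qed

lemma paths_sink: "paths P (sink P) v \<subseteq> {[sink P]}"
proof
  fix p assume p: "p \<in> paths P (sink P) v"
  then obtain q where q: "p = sink P # q" by (cases p) (auto simp: paths_def)
  have "q = []"
  proof (rule ccontr)
    assume "q \<noteq> []"
    then have "(sink P, hd q) \<in> edges P"
      using p q by (cases q) (auto simp: paths_def)
    then show False using out_degree sink_node by blast
  qed
  then show "p \<in> {[sink P]}" using q by simp
qed

lemma vars_between_source: "vars_between P u (source P) = {}"
  using paths_source by (fastforce simp: vars_between_def)

lemma vars_between_sink: "vars_between P (sink P) v = {}"
  using paths_sink by (fastforce simp: vars_between_def)

lemma path_edges_label:
  assumes "successively (\<lambda>a b. (a, b) \<in> edges P) p" "l \<in> set (path_labels P p)"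
  obtains a b where "(a, b) \<in> edges P" "l = lab P a b"
  using assms by (induction p rule: induct_list012) auto

lemma vars_between_subset: "vars_between P u v \<subseteq> {1..n}"
proof
  fix i assume "i \<in> vars_between P u v"
  then obtain p where p: "p \<in> paths P u v" "Var i \<in> set (path_labels P p)"
    by (auto simp: vars_between_def)
  then obtain a b where ab: "(a, b) \<in> edges P" "Var i = lab P a b"
    using path_edges_label[of p "Var i"] by (auto simp: paths_def)
  show "i \<in> {1..n}" using label_cases[OF ab(1)] ab(2) by (metis label.distinct(1) label.inject(1))
qed

text \<open>The common node \<open>a\<close> ends one list and starts the other, so it has to be
  kept only once.\<close>

lemma vars_between_concat:
  assumes p: "p \<in> paths P u a" and q: "q \<in> paths P a v"
  shows "\<exists>r\<in>paths P u v. set (path_labels P r) = set (path_labels P p) \<union> set (path_labels P q)"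
proof -
  obtain q' where q': "q = a # q'" using q by (cases q) (auto simp: paths_def)
  show ?thesis
  proof (cases "q' = []")
    case True
    then have "a = v" using q q' by (auto simp: paths_def)
    then show ?thesis using p q' True by auto
  next
    case False
    then obtain b q'' where b: "q' = b # q''" by (cases q') auto
    have e: "(a, b) \<in> edges P" "q' \<in> paths P b v" using q q' b by (auto simp: paths_def)
    have "p @ q' \<in> paths P u v" using p e by (rule paths_append_edge)
    moreover have "path_labels P (p @ q') = path_labels P p @ lab P a b # path_labels P q'"
      using p b by (subst path_labels_append) (auto simp: paths_def)
    moreover have "path_labels P q = lab P a b # path_labels P q'" using q' b by simp
    ultimately show ?thesis by (intro bexI[of _ "p @ q'"]) auto
  qed
qed

lemma vars_between_mono:
  assumes "paths P u a \<noteq> {}" "paths P b v \<noteq> {}"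
  shows "vars_between P a b \<subseteq> vars_between P u v"
proof
  fix i assume "i \<in> vars_between P a b"
  then obtain p where p: "p \<in> paths P a b" "Var i \<in> set (path_labels P p)"
    by (auto simp: vars_between_def)
  obtain q r where "q \<in> paths P u a" "r \<in> paths P b v" using assms by auto
  then show "i \<in> vars_between P u v"
    using vars_between_concat[of q u a p b] vars_between_concat[of _ u b r v] p
    unfolding vars_between_def by fastforce
qed

lemma paths_edge: "(u, v) \<in> edges P \<Longrightarrow> [u, v] \<in> paths P u v"
  using edge_nodes by (auto simp: paths_def)

lemma label_vars: "(u, v) \<in> edges P \<Longrightarrow> {i. lab P u v = Var i} \<subseteq> vars_between P u v"
  using paths_edge[of u v] by (force simp: vars_between_def)

subsection \<open>Path sums\<close>

definition path_sum :: "nat \<Rightarrow> nat \<Rightarrow> nat multiset \<Rightarrow> 'a" where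
  "path_sum u v = (\<Oplus>\<^bsub>MP\<^esub>p\<in>paths P u v. path_poly R n P p)"

lemma abp_poly_eq: "abp_poly R n P = path_sum (source P) (sink P)"
  by (simp add: abp_poly_def path_sum_def)

lemma path_poly_Cons [simp]:
  "path_poly R n P [a] = \<one>\<^bsub>MP\<^esub>"
  "path_poly R n P (a # b # p) = label_poly R (lab P a b) \<otimes>\<^bsub>MP\<^esub> path_poly R n P (b # p)"
  by (simp_all add: path_poly_def)

lemma path_poly_closed:
  assumes "successively (\<lambda>a b. (a, b) \<in> edges P) p"
  shows "path_poly R n P p \<in> carrier MP"
  using assms
proof (induction p rule: induct_list012)
  case 1
  then show ?case by (simp add: path_poly_def del: mpoly_ring_sel)
qed (auto simp del: mpoly_ring_sel intro!: M.m_closed label_poly_closed)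

lemma path_poly_closed': "p \<in> paths P u v \<Longrightarrow> path_poly R n P p \<in> carrier MP"
  by (rule path_poly_closed) (auto simp: paths_def)

lemma path_sum_closed: "path_sum u v \<in> carrier MP"
  unfolding path_sum_def by (rule M.finsum_closed) (auto intro: path_poly_closed')

lemma path_poly_append:
  assumes "p \<noteq> []" "q \<noteq> []" "successively (\<lambda>a b. (a, b) \<in> edges P) (p @ q)"
  shows "path_poly R n P (p @ q)
    = (path_poly R n P p \<otimes>\<^bsub>MP\<^esub> label_poly R (lab P (last p) (hd q))) \<otimes>\<^bsub>MP\<^esub> path_poly R n P q"
  using assms
proof (induction p rule: induct_list012)
  case (2 a)
  then obtain b q' where q: "q = b # q'" by (cases q) auto
  then have "(a, b) \<in> edges P" "successively (\<lambda>a b. (a, b) \<in> edges P) q" using 2 by auto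
  then show ?case using q by (simp add: label_poly_closed path_poly_closed del: mpoly_ring_sel)
next
  case (3 a b p)
  have s: "(a, b) \<in> edges P" "successively (\<lambda>a b. (a, b) \<in> edges P) (b # p)"
    "successively (\<lambda>a b. (a, b) \<in> edges P) q" "(last (b # p), hd q) \<in> edges P"
  proof -
    show "(a, b) \<in> edges P" using 3 by simp
    have "successively (\<lambda>a b. (a, b) \<in> edges P) ((b # p) @ q)" using 3 by simp
    from this[unfolded successively_append_iff]
    show "successively (\<lambda>a b. (a, b) \<in> edges P) (b # p)"
      "successively (\<lambda>a b. (a, b) \<in> edges P) q" "(last (b # p), hd q) \<in> edges P"
      using 3 by blast+
  qed
  have "path_poly R n P ((a # b # p) @ q) = label_poly R (lab P a b) \<otimes>\<^bsub>MP\<^esub> path_poly R n P ((b # p) @ q)"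
    by simp
  also have "path_poly R n P ((b # p) @ q) = (path_poly R n P (b # p) \<otimes>\<^bsub>MP\<^esub>
      label_poly R (lab P (last (b # p)) (hd q))) \<otimes>\<^bsub>MP\<^esub> path_poly R n P q"
    using 3 by (intro 3) auto
  also have "label_poly R (lab P a b) \<otimes>\<^bsub>MP\<^esub> (path_poly R n P (b # p) \<otimes>\<^bsub>MP\<^esub>
      label_poly R (lab P (last (b # p)) (hd q)) \<otimes>\<^bsub>MP\<^esub> path_poly R n P q)
    = (label_poly R (lab P a b) \<otimes>\<^bsub>MP\<^esub> path_poly R n P (b # p)) \<otimes>\<^bsub>MP\<^esub>
      label_poly R (lab P (last (b # p)) (hd q)) \<otimes>\<^bsub>MP\<^esub> path_poly R n P q"
    using label_poly_closed[OF s(1)] path_poly_closed[OF s(2)] path_poly_closed[OF s(3)]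
      label_poly_closed[OF s(4)] by (simp only: M.m_assoc M.m_closed)
  finally show ?case by (simp del: mpoly_ring_sel)
qed auto

lemma path_poly_support:
  assumes "successively (\<lambda>a b. (a, b) \<in> edges P) p" "path_poly R n P p m \<noteq> \<zero>"
  shows "set_mset m \<subseteq> {i. Var i \<in> set (path_labels P p)}"
  using assms
proof (induction p arbitrary: m rule: induct_list012)
  case 1
  then show ?case by (auto simp: path_poly_def split: if_splits)
next
  case (2 a)
  then show ?case by (auto split: if_splits)
next
  case (3 a b p)
  have ab: "(a, b) \<in> edges P" and s: "successively (\<lambda>a b. (a, b) \<in> edges P) (b # p)" using 3 by auto
  have c: "path_poly R n P (b # p) m \<in> carrier R" "label_poly R (lab P a b) m \<in> carrier R" for m
    using path_poly_closed[OF s] label_poly_closed[OF ab] by (auto intro: mpoly_coeff_closed)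
  obtain m1 m2 where m: "m = m1 + m2" "label_poly R (lab P a b) m1 \<noteq> \<zero>" "path_poly R n P (b # p) m2 \<noteq> \<zero>"
    using 3(4) c by (auto elim: mpoly_mult_nonzeroE)
  have "set_mset m1 \<subseteq> {i. lab P a b = Var i}"
    using m(2) by (cases "lab P a b") (auto simp: indexed_var_eq indexed_const_def split: if_splits)
  moreover have "set_mset m2 \<subseteq> {i. Var i \<in> set (path_labels P (b # p))}"
    using 3 s m(3) by blast
  ultimately show ?case using m(1) by auto
qed

lemma path_sum_support:
  assumes "path_sum u v m \<noteq> \<zero>"
  shows "set_mset m \<subseteq> vars_between P u v"
proof -
  have "(\<Oplus>p\<in>paths P u v. path_poly R n P p m) \<noteq> \<zero>"
    using assms unfolding path_sum_def
    by (subst (asm) mpoly_finsum_apply) (auto intro: path_poly_closed' finite_paths)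
  then obtain p where "p \<in> paths P u v" "path_poly R n P p m \<noteq> \<zero>" by (rule finsum_nonzeroE)
  then show ?thesis using path_poly_support[of p m] by (auto simp: vars_between_def paths_def)
qed

text \<open>Every path from \<open>x\<close> to \<open>t\<close> uses exactly one edge that enters the upward closed set \<open>C\<close>.\<close>

lemma path_sum_cut:
  assumes C: "\<And>a b. (a, b) \<in> edges P \<Longrightarrow> C a \<Longrightarrow> C b" and x: "\<not> C x" and t: "C t"
  shows "path_sum x t = (\<Oplus>\<^bsub>MP\<^esub>e\<in>{e \<in> edges P. \<not> C (fst e) \<and> C (snd e)}.
     (path_sum x (fst e) \<otimes>\<^bsub>MP\<^esub> label_poly R (lab P (fst e) (snd e))) \<otimes>\<^bsub>MP\<^esub> path_sum (snd e) t)"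
proof -
  let ?E = "{e \<in> edges P. \<not> C (fst e) \<and> C (snd e)}"
  \<comment> \<open>The edge from the last node before \<open>C\<close> is entered to the first node
    in \<open>C\<close>.\<close>
  define cut where "cut p = (last (takeWhile (\<lambda>a. \<not> C a) p), hd (dropWhile (\<lambda>a. \<not> C a) p))" for p
  have finE: "finite ?E" by (rule finite_subset[OF _ finite_edges(1)]) auto
  \<comment> \<open>Upward closure read backwards: a path that ends outside \<open>C\<close> lies
    outside \<open>C\<close> throughout.\<close>
  have lower: "\<forall>a\<in>set p. \<not> C a" if "successively (\<lambda>a b. (a, b) \<in> edges P) p" "p \<noteq> []" "\<not> C (last p)" for p
    using that
  proof (induction p rule: induct_list012)
    case (3 a b p)
    have IH: "\<forall>a\<in>set (b # p). \<not> C a" by (rule 3(2)) (use 3(3,5) in auto)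
    have "(a, b) \<in> edges P" using 3(3) by simp
    then have "\<not> C a" using C[of a b] IH by auto
    then show ?case using IH by simp
  qed auto
  \<comment> \<open>The fibre of \<open>cut\<close> over an edge is a product of two path sets;
    summing over a product set is what factors the path sum.\<close>
  have split: "{p \<in> paths P x t. cut p = (u, v)} = (\<lambda>(p, q). p @ q) ` (paths P x u \<times> paths P v t)"
    if uv: "(u, v) \<in> ?E" for u v
  proof (intro equalityI subsetI)
    fix p assume p: "p \<in> {p \<in> paths P x t. cut p = (u, v)}"
    define a where "a = takeWhile (\<lambda>a. \<not> C a) p"
    define b where "b = dropWhile (\<lambda>a. \<not> C a) p"
    have ab: "p = a @ b" by (simp add: a_def b_def)
    have "p \<noteq> []" "hd p = x" "last p = t" using p by (auto simp: paths_def)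
    then have "a \<noteq> []" "b \<noteq> []" using x t
      by (auto simp: a_def b_def takeWhile_eq_Nil_iff dropWhile_eq_Nil_conv)
    moreover have "last a = u" "hd b = v" using p by (auto simp: cut_def a_def b_def)
    ultimately have "a \<in> paths P x u" "b \<in> paths P v t"
      using p by (auto simp: ab paths_def successively_append_iff)
    then show "p \<in> (\<lambda>(p, q). p @ q) ` (paths P x u \<times> paths P v t)" using ab by auto
  next
    fix p assume "p \<in> (\<lambda>(p, q). p @ q) ` (paths P x u \<times> paths P v t)"
    then obtain a b where ab: "a \<in> paths P x u" "b \<in> paths P v t" "p = a @ b" by auto
    have "\<forall>y\<in>set a. \<not> C y" using ab(1) uv by (intro lower) (auto simp: paths_def)
    moreover obtain b' where "b = v # b'" using ab(2) by (cases b) (auto simp: paths_def)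
    ultimately have "cut p = (u, v)" using uv ab by (auto simp: cut_def paths_def)
    moreover have "p \<in> paths P x t" using ab uv by (auto intro: paths_append_edge)
    ultimately show "p \<in> {p \<in> paths P x t. cut p = (u, v)}" by simp
  qed
  have cutE: "cut ` paths P x t \<subseteq> ?E"
  proof
    fix e assume "e \<in> cut ` paths P x t"
    then obtain p where p: "p \<in> paths P x t" "e = cut p" by auto
    define a where "a = takeWhile (\<lambda>a. \<not> C a) p"
    define b where "b = dropWhile (\<lambda>a. \<not> C a) p"
    have ab: "p = a @ b" by (simp add: a_def b_def)
    have "p \<noteq> []" "hd p = x" "last p = t" using p by (auto simp: paths_def)
    then have ne: "a \<noteq> []" "b \<noteq> []" using x t
      by (auto simp: a_def b_def takeWhile_eq_Nil_iff dropWhile_eq_Nil_conv)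
    then have "(last a, hd b) \<in> edges P"
      using p by (auto simp: ab paths_def successively_append_iff)
    moreover have "\<not> C (last a)" using ne(1) last_in_set[of a] unfolding a_def by (metis set_takeWhileD)
    moreover have "C (hd b)" using ne(2) unfolding b_def by (metis hd_dropWhile)
    ultimately show "e \<in> ?E" by (simp add: p cut_def a_def b_def)
  qed
  have "path_sum x t = (\<Oplus>\<^bsub>MP\<^esub>e\<in>?E. \<Oplus>\<^bsub>MP\<^esub>p\<in>{p \<in> paths P x t. cut p = e}. path_poly R n P p)"
    unfolding path_sum_def using finE cutE path_poly_closed'
    by (intro M.finsum_group finite_paths) auto
  also have "\<dots> = (\<Oplus>\<^bsub>MP\<^esub>e\<in>?E.
     (path_sum x (fst e) \<otimes>\<^bsub>MP\<^esub> label_poly R (lab P (fst e) (snd e))) \<otimes>\<^bsub>MP\<^esub> path_sum (snd e) t)"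
  proof (intro M.finsum_cong' refl)
    fix e assume e: "e \<in> ?E"
    obtain u v where uv: "e = (u, v)" by (cases e)
    have uvE: "(u, v) \<in> edges P" using e uv by auto
    note lc = label_poly_closed[OF uvE]
    have nC: "\<not> C u" "C v" using e uv by auto
    have below: "\<forall>y\<in>set p. \<not> C y" if "p \<in> paths P x u" for p
      using that nC(1) by (intro lower) (auto simp: paths_def)
    \<comment> \<open>Both parts are recovered from the concatenation: the first is its maximal
      prefix outside \<open>C\<close>.\<close>
    have inj: "inj_on (\<lambda>(p, q). p @ q) (paths P x u \<times> paths P v t)"
    proof (rule inj_onI, clarify)
      fix p q p' q' assume h: "p \<in> paths P x u" "q \<in> paths P v t" "p' \<in> paths P x u" "q' \<in> paths P v t"
        "p @ q = p' @ q'"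
      note C' = below[OF h(1)] below[OF h(3)]
      have "C (hd q)" "q \<noteq> []" "C (hd q')" "q' \<noteq> []" using h(2,4) nC(2) by (auto simp: paths_def)
      then have "takeWhile (\<lambda>a. \<not> C a) q = []" "takeWhile (\<lambda>a. \<not> C a) q' = []"
        by (auto simp: takeWhile_eq_Nil_iff)
      then have "takeWhile (\<lambda>a. \<not> C a) (p @ q) = p" "takeWhile (\<lambda>a. \<not> C a) (p' @ q') = p'"
        using C' by (simp_all add: takeWhile_append2)
      then show "p = p' \<and> q = q'" using h(5) by auto
    qed
    have app: "path_poly R n P (p @ q) \<in> carrier MP" if "p \<in> paths P x u" "q \<in> paths P v t" for p q
      using paths_append_edge[OF that(1) uvE that(2)] by (rule path_poly_closed')
    have pp: "path_poly R n P (p @ q)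
        = (path_poly R n P p \<otimes>\<^bsub>MP\<^esub> label_poly R (lab P u v)) \<otimes>\<^bsub>MP\<^esub> path_poly R n P q"
      if "p \<in> paths P x u" "q \<in> paths P v t" for p q
      using paths_append_edge[OF that(1) uvE that(2)] that path_poly_append[of p q]
      by (auto simp: paths_def)
    have "(\<Oplus>\<^bsub>MP\<^esub>p\<in>{p \<in> paths P x t. cut p = e}. path_poly R n P p)
        = (\<Oplus>\<^bsub>MP\<^esub>pq\<in>paths P x u \<times> paths P v t. path_poly R n P (case pq of (p, q) \<Rightarrow> p @ q))"
      unfolding uv split[OF e[unfolded uv]]
      by (intro M.finsum_reindex inj) (auto intro: app)
    also have "\<dots> = (\<Oplus>\<^bsub>MP\<^esub>p\<in>paths P x u. \<Oplus>\<^bsub>MP\<^esub>pq\<in>{pq \<in> paths P x u \<times> paths P v t. fst pq = p}.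
        path_poly R n P (case pq of (p, q) \<Rightarrow> p @ q))"
      by (intro M.finsum_group) (auto intro: finite_paths app)
    also have "\<dots> = (\<Oplus>\<^bsub>MP\<^esub>p\<in>paths P x u. (path_poly R n P p \<otimes>\<^bsub>MP\<^esub> label_poly R (lab P u v)) \<otimes>\<^bsub>MP\<^esub> path_sum v t)"
    proof (intro M.finsum_cong' refl)
      fix p assume p: "p \<in> paths P x u"
      have "{pq \<in> paths P x u \<times> paths P v t. fst pq = p} = Pair p ` paths P v t" using p by auto
      then have "(\<Oplus>\<^bsub>MP\<^esub>pq\<in>{pq \<in> paths P x u \<times> paths P v t. fst pq = p}.
          path_poly R n P (case pq of (p, q) \<Rightarrow> p @ q))
        = (\<Oplus>\<^bsub>MP\<^esub>q\<in>paths P v t. path_poly R n P (p @ q))"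
        by (simp, subst M.finsum_reindex) (auto intro: app[OF p] inj_onI)
      also have "\<dots> = (\<Oplus>\<^bsub>MP\<^esub>q\<in>paths P v t.
          (path_poly R n P p \<otimes>\<^bsub>MP\<^esub> label_poly R (lab P u v)) \<otimes>\<^bsub>MP\<^esub> path_poly R n P q)"
        using p lc by (intro M.finsum_cong' refl pp) (auto intro!: M.m_closed path_poly_closed')
      also have "\<dots> = (path_poly R n P p \<otimes>\<^bsub>MP\<^esub> label_poly R (lab P u v)) \<otimes>\<^bsub>MP\<^esub> path_sum v t"
        unfolding path_sum_def using p lc
        by (intro M.finsum_rdistr[symmetric] finite_paths) (auto intro!: M.m_closed path_poly_closed')
      finally show "(\<Oplus>\<^bsub>MP\<^esub>pq\<in>{pq \<in> paths P x u \<times> paths P v t. fst pq = p}.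
          path_poly R n P (case pq of (p, q) \<Rightarrow> p @ q))
        = (path_poly R n P p \<otimes>\<^bsub>MP\<^esub> label_poly R (lab P u v)) \<otimes>\<^bsub>MP\<^esub> path_sum v t" .
    qed (use lc in \<open>auto intro!: M.m_closed path_poly_closed' path_sum_closed\<close>)
    also have "\<dots> = (\<Oplus>\<^bsub>MP\<^esub>p\<in>paths P x u. path_poly R n P p \<otimes>\<^bsub>MP\<^esub> label_poly R (lab P u v)) \<otimes>\<^bsub>MP\<^esub> path_sum v t"
      using lc by (intro M.finsum_ldistr[symmetric] finite_paths path_sum_closed) (auto intro!: M.m_closed path_poly_closed')
    also have "(\<Oplus>\<^bsub>MP\<^esub>p\<in>paths P x u. path_poly R n P p \<otimes>\<^bsub>MP\<^esub> label_poly R (lab P u v))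
        = path_sum x u \<otimes>\<^bsub>MP\<^esub> label_poly R (lab P u v)"
      unfolding path_sum_def using lc
      by (intro M.finsum_ldistr[symmetric] finite_paths) (auto intro!: path_poly_closed')
    finally show "(\<Oplus>\<^bsub>MP\<^esub>p\<in>{p \<in> paths P x t. cut p = e}. path_poly R n P p)
        = (path_sum x (fst e) \<otimes>\<^bsub>MP\<^esub> label_poly R (lab P (fst e) (snd e))) \<otimes>\<^bsub>MP\<^esub> path_sum (snd e) t"
      by (simp add: uv)
  qed (auto intro!: M.m_closed path_sum_closed label_poly_closed)
  finally show ?thesis .
qed

end

section \<open>Rank of the coefficient matrix of a path sum\<close>

context disjoint_abp
begin

text \<open>The exponent that an arbitrary polynomial in the variables \<open>A\<close> contributes
  to the rank bound.\<close>

definition small_side :: "nat set \<Rightarrow> nat set \<Rightarrow> nat set \<Rightarrow> nat" where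
  "small_side Y Z A = min (card (A \<inter> Y)) (card (A \<inter> Z))"

text \<open>The matrix is read on the part inside \<open>A\<close> only. The condition that nothing
  lies outside \<open>A\<close> is split off, so that factors with different variable sets can be
  multiplied entrywise; it is restored once, in \<open>poly_factors_rank\<close>.\<close>

definition poly_factors where
  "poly_factors Y Z p A k \<longleftrightarrow> p \<in> carrier MP \<and> (\<forall>m. p m \<noteq> \<zero> \<longrightarrow> set_mset m \<subseteq> A) \<and>
     factors Y Z (\<lambda>S T. p (mset_set ((S \<union> T) \<inter> A))) k"

lemma poly_factors_base:
  assumes "p \<in> carrier MP" "\<And>m. p m \<noteq> \<zero> \<Longrightarrow> set_mset m \<subseteq> A"
  shows "poly_factors Y Z p A (small_side Y Z A)"
  unfolding poly_factors_def small_side_def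
  using assms factors_local[of "\<lambda>D. p (mset_set D)" Y Z A] mpoly_coeff_closed[OF assms(1)] by blast

lemma poly_factors_mult:
  assumes fin: "finite Y" "finite Z"
    and p: "poly_factors Y Z p A k" and q: "poly_factors Y Z q B l" and AB: "A \<inter> B = {}"
  shows "poly_factors Y Z (p \<otimes>\<^bsub>MP\<^esub> q) (A \<union> B) (k + l)"
proof -
  have pc: "p \<in> carrier MP" and ps: "\<And>m. p m \<noteq> \<zero> \<Longrightarrow> set_mset m \<subseteq> A"
    and pf: "factors Y Z (\<lambda>S T. p (mset_set ((S \<union> T) \<inter> A))) k"
    using p unfolding poly_factors_def by blast+
  have qc: "q \<in> carrier MP" and qs: "\<And>m. q m \<noteq> \<zero> \<Longrightarrow> set_mset m \<subseteq> B"
    and qf: "factors Y Z (\<lambda>S T. q (mset_set ((S \<union> T) \<inter> B))) l"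
    using q unfolding poly_factors_def by blast+
  have c: "p m \<in> carrier R" "q m \<in> carrier R" for m using pc qc by (auto intro: mpoly_coeff_closed)
  have supp: "set_mset m \<subseteq> A \<union> B" if nz: "(p \<otimes>\<^bsub>MP\<^esub> q) m \<noteq> \<zero>" for m
  proof -
    obtain m1 m2 where "m = m1 + m2" "p m1 \<noteq> \<zero>" "q m2 \<noteq> \<zero>"
      by (rule mpoly_mult_nonzeroE[OF nz c])
    then show ?thesis using ps[of m1] qs[of m2] by auto
  qed
  obtain Y' Z' G H where g: "Y' \<subseteq> Y" "Z' \<subseteq> Z" "card Y' + card Z' \<le> k + l"
    "\<And>S T. G S T \<in> carrier R" "\<And>S T. H S T \<in> carrier R"
    "\<And>S T. S \<subseteq> Y \<Longrightarrow> T \<subseteq> Z \<Longrightarrow>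
      p (mset_set ((S \<union> T) \<inter> A)) \<otimes> q (mset_set ((S \<union> T) \<inter> B)) = G S (T \<inter> Z') \<otimes> H (S \<inter> Y') T"
    using factors_mult[OF pf qf] by (rule factorsE) (rule that)
  have "factors Y Z (\<lambda>S T. (p \<otimes>\<^bsub>MP\<^esub> q) (mset_set ((S \<union> T) \<inter> (A \<union> B)))) (k + l)"
  proof (rule factorsI[OF g(1-5)])
    fix S T assume ST: "S \<subseteq> Y" "T \<subseteq> Z"
    have f: "finite ((S \<union> T) \<inter> (A \<union> B))" using ST fin by (auto intro: finite_subset)
    have i: "(S \<union> T) \<inter> (A \<union> B) \<inter> A = (S \<union> T) \<inter> A" "(S \<union> T) \<inter> (A \<union> B) \<inter> B = (S \<union> T) \<inter> B"
      by auto
    have "(p \<otimes>\<^bsub>MP\<^esub> q) (mset_set ((S \<union> T) \<inter> (A \<union> B)))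
        = (if (S \<union> T) \<inter> (A \<union> B) \<subseteq> A \<union> B then p (mset_set ((S \<union> T) \<inter> (A \<union> B) \<inter> A))
          \<otimes> q (mset_set ((S \<union> T) \<inter> (A \<union> B) \<inter> B)) else \<zero>)"
      by (rule mpoly_mult_disjoint_support[OF c _ _ AB f]) (rule ps qs; assumption)+
    then have "(p \<otimes>\<^bsub>MP\<^esub> q) (mset_set ((S \<union> T) \<inter> (A \<union> B)))
        = p (mset_set ((S \<union> T) \<inter> A)) \<otimes> q (mset_set ((S \<union> T) \<inter> B))"
      by (simp only: i Int_lower2 if_True)
    then show "(p \<otimes>\<^bsub>MP\<^esub> q) (mset_set ((S \<union> T) \<inter> (A \<union> B))) = G S (T \<inter> Z') \<otimes> H (S \<inter> Y') T"
      using g(6)[OF ST] by (rule trans)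
  qed
  then show ?thesis unfolding poly_factors_def using M.m_closed[OF pc qc] supp by blast
qed

text \<open>Restoring the condition \<open>S \<union> T \<subseteq> A\<close> costs nothing: its
  indicator is a product of a function of \<open>S\<close> and a function of
  \<open>T\<close>.\<close>

lemma poly_factors_rank:
  assumes fin: "finite Y" "finite Z" and p: "poly_factors Y Z p A k" and kl: "k \<le> l"
  shows "col_rank_le Y Z (\<lambda>S T. p (mset_set (S \<union> T))) (2 ^ l)"
proof -
  have pc: "p \<in> carrier MP" and ps: "\<And>m. p m \<noteq> \<zero> \<Longrightarrow> set_mset m \<subseteq> A"
    and pf: "factors Y Z (\<lambda>S T. p (mset_set ((S \<union> T) \<inter> A))) k"
    using p unfolding poly_factors_def by blast+
  have c: "p m \<in> carrier R" for m using pc by (rule mpoly_coeff_closed)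
  let ?M = "\<lambda>S T. p (mset_set ((S \<union> T) \<inter> A)) \<otimes> (if S \<union> T \<subseteq> A then \<one> else \<zero>)"
  have "factors Y Z ?M l"
    using factors_mult[OF pf factors_subset[of Y Z A]] kl by (auto intro: factors_mono)
  from factors_rank[OF fin this] show ?thesis
  proof (rule col_rank_le_cong)
    fix S T assume ST: "S \<subseteq> Y" "T \<subseteq> Z"
    have f: "finite (S \<union> T)" using ST fin by (auto intro: finite_subset)
    show "p (mset_set (S \<union> T)) = ?M S T"
    proof (cases "S \<union> T \<subseteq> A")
      case True
      then show ?thesis using c by (simp add: Int_absorb2)
    next
      case False
      then have "p (mset_set (S \<union> T)) = \<zero>" using ps[of "mset_set (S \<union> T)"] f by auto
      then show ?thesis by (simp only: False if_False r_null c)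
    qed
    show "?M S T \<in> carrier R" using c by simp
  qed simp
qed

lemma small_side_le: "2 * small_side Y Z A \<le> card A" if "finite A" "Y \<inter> Z = {}"
proof -
  have "card (A \<inter> Y) + card (A \<inter> Z) = card ((A \<inter> Y) \<union> (A \<inter> Z))"
    using that by (intro card_Un_disjoint[symmetric]) auto
  also have "\<dots> \<le> card A" using that by (intro card_mono) auto
  finally show ?thesis by (simp add: small_side_def)
qed

lemma poly_factors_path_sum:
  "poly_factors Y Z (path_sum u v) (vars_between P u v) (small_side Y Z (vars_between P u v))"
  by (rule poly_factors_base[OF path_sum_closed]) (rule path_sum_support)

text \<open>A label carries at most one variable, which lies on one side of the partition. The edges
  at which paths are cut are therefore free in the exponent.\<close>

lemma poly_factors_label:
  assumes e: "(u, v) \<in> edges P" and YZ: "Y \<inter> Z = {}"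
  shows "poly_factors Y Z (label_poly R (lab P u v)) {i. lab P u v = Var i} 0"
proof -
  have "small_side Y Z {i. lab P u v = Var i} = 0"
  proof (cases "lab P u v")
    case (Var i)
    then have "{i. lab P u v = Var i} = {i}" by auto
    moreover have "{i} \<inter> Y = {} \<or> {i} \<inter> Z = {}" using YZ by auto
    ultimately show ?thesis by (auto simp: small_side_def)
  next
    case (Const c)
    then show ?thesis by (simp add: small_side_def)
  qed
  moreover have "poly_factors Y Z (label_poly R (lab P u v)) {i. lab P u v = Var i}
      (small_side Y Z {i. lab P u v = Var i})"
    using label_poly_closed[OF e]
    by (rule poly_factors_base)
      (cases "lab P u v"; auto simp: indexed_var_eq indexed_const_def split: if_splits)
  ultimately show ?thesis by simp
qed

lemma path_sum_empty: "paths P u v = {} \<Longrightarrow> path_sum u v = \<zero>\<^bsub>MP\<^esub>"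
  by (simp add: path_sum_def)

lemma finite_vars: "finite (vars_between P u v)"
  using finite_subset[OF vars_between_subset] by blast

lemma vars_between_edge_right: "(u, v) \<in> edges P \<Longrightarrow> x \<in> nodes P \<Longrightarrow> vars_between P x u \<subseteq> vars_between P x v"
  using vars_between_mono[of x x u v] paths_edge path_singleton by blast

lemma vars_between_edge_left: "(u, v) \<in> edges P \<Longrightarrow> t \<in> nodes P \<Longrightarrow> vars_between P v t \<subseteq> vars_between P u t"
  using vars_between_mono[of u v t t] paths_edge path_singleton by blast

text \<open>Two cuts split every path into three pieces, each with at most \<open>n / 3\<close> variables; one of
  them lies on one side of the partition and contributes nothing to the rank.\<close>

theorem path_sum_rank:
  assumes YZ: "Y \<union> Z = {1..n}" "Y \<inter> Z = {}" and n: "n > 0"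
    and full: "vars_between P (source P) (sink P) = {1..n}"
    and pure: "\<And>u v u' v'. (u, v) \<in> edges P \<Longrightarrow> (u', v') \<in> edges P \<Longrightarrow>
      paths P (source P) u \<noteq> {} \<Longrightarrow> paths P v u' \<noteq> {} \<Longrightarrow> paths P v' (sink P) \<noteq> {} \<Longrightarrow>
      small_side Y Z (vars_between P (source P) u) = 0 \<or> small_side Y Z (vars_between P v u') = 0 \<or>
      small_side Y Z (vars_between P v' (sink P)) = 0"
  shows "col_rank_le Y Z (\<lambda>S T. path_sum (source P) (sink P) (mset_set (S \<union> T)))
    (card (edges P) * ((1 + card (edges P)) * 2 ^ (n div 3)))"
proof -
  let ?s = "source P" and ?t = "sink P"
  let ?N = "card (edges P)"
  define V where "V = vars_between P"
  have fin: "finite Y" "finite Z" using YZ(1) by (metis finite_Un finite_atLeastAtMost)+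
  have V_le: "2 * small_side Y Z (V u v) \<le> card (V u v)" for u v
    unfolding V_def using finite_vars YZ(2) by (rule small_side_le)
  \<comment> \<open>The first cut is where the variables seen so far reach n/3, the second where
    those still to come drop to n/3. At a cut edge the lower node violates the inequality and the
    upper one satisfies it.\<close>
  define C1 where "C1 v \<longleftrightarrow> n \<le> 3 * card (V ?s v)" for v
  define C2 where "C2 v \<longleftrightarrow> 3 * card (V v ?t) \<le> n" for v
  have C1: "C1 b" if "(a, b) \<in> edges P" "C1 a" for a b
    using that card_mono[OF finite_vars vars_between_edge_right[OF that(1) source_node]]
    by (simp add: C1_def V_def)
  have C2: "C2 b" if "(a, b) \<in> edges P" "C2 a" for a b
    using that card_mono[OF finite_vars vars_between_edge_left[OF that(1) sink_node]]
    by (simp add: C2_def V_def)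
  \<comment> \<open>No variable occurs on paths into the source or out of the sink. That the first
    cut separates the source from the sink at all uses that all \<open>n\<close> variables occur
    between them.\<close>
  have ends: "\<not> C1 ?s" "C1 ?t" "C2 ?t"
    using n by (simp_all add: C1_def C2_def V_def vars_between_source vars_between_sink full)
  define E1 where "E1 = {e \<in> edges P. \<not> C1 (fst e) \<and> C1 (snd e)}"
  define E2 where "E2 = {e \<in> edges P. \<not> C2 (fst e) \<and> C2 (snd e)}"
  have finE: "finite E1" "finite E2" "card E1 \<le> ?N" "card E2 \<le> ?N"
    unfolding E1_def E2_def using finite_edges(1) by (auto intro!: card_mono)
  define l where "l e = label_poly R (lab P (fst e) (snd e))" for e
  have lc: "l e \<in> carrier MP" if "e \<in> edges P" for e
    using that by (cases e) (simp add: l_def label_poly_closed)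
  let ?term = "\<lambda>e. (path_sum ?s (fst e) \<otimes>\<^bsub>MP\<^esub> l e) \<otimes>\<^bsub>MP\<^esub> path_sum (snd e) ?t"
  have tc: "?term e \<in> carrier MP" if "e \<in> E1" for e
    using that by (intro M.m_closed path_sum_closed lc) (auto simp: E1_def)
  \<comment> \<open>In \<open>1 + ?N\<close> the 1 stands for a first cut after which at most n/3
    variables remain, \<open>?N\<close> for the edges of a second cut.\<close>
  have term_rank: "col_rank_le Y Z (\<lambda>S T. ?term e (mset_set (S \<union> T))) ((1 + ?N) * 2 ^ (n div 3))"
    if e: "e \<in> E1" for e
  proof -
    obtain u v where uv: "e = (u, v)" by (cases e)
    have uvE: "(u, v) \<in> edges P" "\<not> C1 u" "C1 v" using e by (auto simp: E1_def uv)
    have un: "u \<in> nodes P" "v \<in> nodes P" using edge_nodes[OF uvE(1)] by auto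
    let ?L = "{i. lab P u v = Var i}"
    have fac1: "poly_factors Y Z (path_sum ?s u \<otimes>\<^bsub>MP\<^esub> l e) (V ?s u \<union> ?L) (small_side Y Z (V ?s u) + 0)"
      unfolding uv l_def fst_conv snd_conv V_def
    proof (rule poly_factors_mult[OF fin poly_factors_path_sum poly_factors_label[OF uvE(1) YZ(2)]])
      show "vars_between P ?s u \<inter> ?L = {}"
        using disj[OF source_node un] label_vars[OF uvE(1)] by blast
    qed
    show ?thesis
    proof (cases "C2 v")
      case True
      have "poly_factors Y Z (?term e) ((V ?s u \<union> ?L) \<union> V v ?t)
          ((small_side Y Z (V ?s u) + 0) + small_side Y Z (V v ?t))"
      proof -
        have "(V ?s u \<union> ?L) \<inter> V v ?t = {}"
          using disj[OF source_node un(2) sink_node] disj[OF un sink_node] label_vars[OF uvE(1)]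
            vars_between_edge_right[OF uvE(1) source_node] unfolding V_def by blast
        from poly_factors_mult[OF fin fac1 poly_factors_path_sum[of Y Z v ?t, folded V_def] this]
        show ?thesis by (simp only: uv fst_conv snd_conv)
      qed
      \<comment> \<open>Two pieces of at most n/3 variables suffice here, and each contributes at
        most half of its variables to the exponent: n/6 + n/6.\<close>
      moreover have "(small_side Y Z (V ?s u) + 0) + small_side Y Z (V v ?t) \<le> n div 3"
        using V_le[of ?s u] V_le[of v ?t] uvE(2) True unfolding C1_def C2_def by linarith
      ultimately have "col_rank_le Y Z (\<lambda>S T. ?term e (mset_set (S \<union> T))) (2 ^ (n div 3))"
        by (rule poly_factors_rank[OF fin])
      then show ?thesis
        by (rule col_rank_le_cong) (use mpoly_coeff_closed[OF tc[OF e]] in auto)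
    next
      case False
      let ?term2 = "\<lambda>f. (path_sum v (fst f) \<otimes>\<^bsub>MP\<^esub> l f) \<otimes>\<^bsub>MP\<^esub> path_sum (snd f) ?t"
      let ?prod = "\<lambda>f. (path_sum ?s u \<otimes>\<^bsub>MP\<^esub> l e) \<otimes>\<^bsub>MP\<^esub> ?term2 f"
      have ec: "path_sum ?s u \<otimes>\<^bsub>MP\<^esub> l e \<in> carrier MP"
        using lc[of e] uvE(1) path_sum_closed by (auto simp: uv)
      have t2c: "?term2 f \<in> carrier MP" if "f \<in> E2" for f
        using that by (intro M.m_closed path_sum_closed lc) (auto simp: E2_def)
      have pc: "?prod f \<in> carrier MP" if "f \<in> E2" for f
        using ec t2c[OF that] by (rule M.m_closed)
      have cut2: "path_sum v ?t = (\<Oplus>\<^bsub>MP\<^esub>f\<in>E2. ?term2 f)"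
        unfolding E2_def l_def by (rule path_sum_cut[OF C2 False ends(3)])
      have te: "?term e = (\<Oplus>\<^bsub>MP\<^esub>f\<in>E2. ?prod f)"
        unfolding uv fst_conv snd_conv cut2 using ec t2c uv
        by (intro M.finsum_rdistr finE(2)) auto
      have term_eq: "?term e (mset_set (S \<union> T)) = (\<Oplus>f\<in>E2. ?prod f (mset_set (S \<union> T)))" for S T
        unfolding te using finE(2) pc by (rule mpoly_finsum_apply)
      have prod_rank: "col_rank_le Y Z (\<lambda>S T. ?prod f (mset_set (S \<union> T))) (2 ^ (n div 3))"
        if f: "f \<in> E2" for f
      proof -
        obtain u' v' where uv': "f = (u', v')" by (cases f)
        have uvE': "(u', v') \<in> edges P" "\<not> C2 u'" "C2 v'" using f by (auto simp: E2_def uv')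
        have un': "u' \<in> nodes P" "v' \<in> nodes P" using edge_nodes[OF uvE'(1)] by auto
        let ?L' = "{i. lab P u' v' = Var i}"
        show ?thesis
        \<comment> \<open>If one of the three pieces has no path, its sum and hence the product is
          zero; otherwise the pieces can be joined, and the variable sets of subpaths are contained
          in those of the longer paths.\<close>
        proof (cases "paths P ?s u \<noteq> {} \<and> paths P v u' \<noteq> {} \<and> paths P v' ?t \<noteq> {}")
          case True
          have e1: "paths P u v \<noteq> {}" "paths P u' v' \<noteq> {}" using paths_edge uvE(1) uvE'(1) by blast+
          have ne: "paths P ?s ?s \<noteq> {}" "paths P ?t ?t \<noteq> {}" "paths P v v \<noteq> {}" "paths P v' v' \<noteq> {}"
            "paths P u' u' \<noteq> {}"
            using path_singleton source_node sink_node un un' by blast+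
          have ap: "paths P a c \<noteq> {}" if "paths P a b \<noteq> {}" "paths P b c \<noteq> {}" for a b c
            using that vars_between_concat by blast
          have p1: "paths P u' ?t \<noteq> {}" "paths P v v' \<noteq> {}" "paths P ?s v \<noteq> {}" "paths P v ?t \<noteq> {}"
            using True e1 ap by blast+
          have d1: "V v u' \<inter> ?L' = {}"
            using disj[OF un(2) un'] label_vars[OF uvE'(1)] unfolding V_def by blast
          have sub: "V v u' \<subseteq> V v v'" "?L' \<subseteq> V v v'"
            using vars_between_edge_right[OF uvE'(1) un(2)] label_vars[OF uvE'(1)]
              vars_between_mono[of v u' v' v'] True ne unfolding V_def by blast+
          have d2: "(V v u' \<union> ?L') \<inter> V v' ?t = {}"
            using sub disj[OF un(2) un'(2) sink_node] unfolding V_def by blast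
          have sub2: "V v v' \<subseteq> V v ?t" "V v' ?t \<subseteq> V v ?t"
            using vars_between_mono[of v v v' ?t] vars_between_mono[of v v' ?t ?t] True ne p1
            unfolding V_def by blast+
          have sub3: "V ?s u \<subseteq> V ?s v" "?L \<subseteq> V ?s v"
            using vars_between_edge_right[OF uvE(1) source_node] label_vars[OF uvE(1)]
              vars_between_mono[of ?s u v v] True ne unfolding V_def by blast+
          have d3: "(V ?s u \<union> ?L) \<inter> ((V v u' \<union> ?L') \<union> V v' ?t) = {}"
            using sub sub2 sub3 disj[OF source_node un(2) sink_node] unfolding V_def by blast
          have "poly_factors Y Z (path_sum v u' \<otimes>\<^bsub>MP\<^esub> l f) (V v u' \<union> ?L') (small_side Y Z (V v u') + 0)"
            unfolding uv' l_def fst_conv snd_conv using d1 unfolding V_def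
            by (rule poly_factors_mult[OF fin poly_factors_path_sum poly_factors_label[OF uvE'(1) YZ(2)]])
          from poly_factors_mult[OF fin this poly_factors_path_sum[of Y Z v' ?t, folded V_def] d2]
          have "poly_factors Y Z (?term2 f) ((V v u' \<union> ?L') \<union> V v' ?t)
             ((small_side Y Z (V v u') + 0) + small_side Y Z (V v' ?t))"
            by (simp only: uv' fst_conv snd_conv)
          from poly_factors_mult[OF fin fac1 this d3]
          have "poly_factors Y Z (?prod f) ((V ?s u \<union> ?L) \<union> ((V v u' \<union> ?L') \<union> V v' ?t))
             ((small_side Y Z (V ?s u) + 0) + ((small_side Y Z (V v u') + 0) + small_side Y Z (V v' ?t)))" .
          moreover have "(small_side Y Z (V ?s u) + 0) + ((small_side Y Z (V v u') + 0) + small_side Y Z (V v' ?t))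
              \<le> n div 3"
          proof -
            have sub4: "V v u' \<subseteq> V v ?t" "V u' ?t \<subseteq> V v ?t"
              using vars_between_mono[of v v u' ?t] vars_between_mono[of v u' ?t ?t] True ne p1
              unfolding V_def by blast+
            \<comment> \<open>For the middle piece the neighbours are counted up to \<open>v\<close>
              and from \<open>u'\<close>, the nodes at which they have at least n/3 variables; at
              most n/3 are left in between.\<close>
            have "V ?s v \<inter> V v u' = {}" "V ?s v \<inter> V u' ?t = {}" "V v u' \<inter> V u' ?t = {}"
              using sub4 disj[OF source_node un(2) sink_node] disj[OF un(2) un'(1) sink_node]
              unfolding V_def by blast+
            then have "card (V ?s v) + card (V v u') + card (V u' ?t) = card (V ?s v \<union> V v u' \<union> V u' ?t)"
              unfolding V_def by (simp add: card_Un_disjoint finite_vars Int_Un_distrib2)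
            also have "\<dots> \<le> card {1..n}"
              unfolding V_def using vars_between_subset by (intro card_mono) auto
            finally have "card (V ?s v) + card (V v u') + card (V u' ?t) \<le> n" by simp
            then have "3 * card (V v u') \<le> n" using uvE(3) uvE'(2) unfolding C1_def C2_def by linarith
            moreover have "small_side Y Z (V ?s u) = 0 \<or> small_side Y Z (V v u') = 0 \<or>
                small_side Y Z (V v' ?t) = 0"
              unfolding V_def using True by (intro pure[OF uvE(1) uvE'(1)]) simp_all
            \<comment> \<open>One of the three summands is 0, and each of the other two is at most
              n/6.\<close>
            ultimately show ?thesis
              using V_le[of ?s u] V_le[of v u'] V_le[of v' ?t] uvE(2) uvE'(3)
              unfolding C1_def C2_def by linarith
          qed
          ultimately show ?thesis by (rule poly_factors_rank[OF fin])
        next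
          case False
          then have "path_sum ?s u = \<zero>\<^bsub>MP\<^esub> \<or> path_sum v u' = \<zero>\<^bsub>MP\<^esub> \<or> path_sum v' ?t = \<zero>\<^bsub>MP\<^esub>"
            using path_sum_empty by blast
          moreover have "l f \<in> carrier MP" "l e \<in> carrier MP" using lc uvE(1) uvE'(1) uv uv' by auto
          ultimately have "?prod f = \<zero>\<^bsub>MP\<^esub>"
            using path_sum_closed unfolding uv' fst_conv snd_conv by (elim disjE) simp_all
          then have "poly_factors Y Z (?prod f) {} (small_side Y Z {})"
            by (intro poly_factors_base) simp_all
          then show ?thesis by (rule poly_factors_rank[OF fin]) (simp add: small_side_def)
        qed
      qed
      have "col_rank_le Y Z (\<lambda>S T. \<Oplus>f\<in>E2. ?prod f (mset_set (S \<union> T))) (card E2 * 2 ^ (n div 3))"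
        using finE(2) fin(1) prod_rank by (rule col_rank_le_sum) (assumption, rule mpoly_coeff_closed[OF pc], assumption)
      then show ?thesis
      proof (rule col_rank_le_cong)
        show "card E2 * 2 ^ (n div 3) \<le> (1 + ?N) * 2 ^ (n div 3)" using finE(4) by simp
        show "?term e (mset_set (S \<union> T)) = (\<Oplus>f\<in>E2. ?prod f (mset_set (S \<union> T)))" for S T
          by (rule term_eq)
        show "(\<Oplus>f\<in>E2. ?prod f (mset_set (S \<union> T))) \<in> carrier R" for S T
          unfolding term_eq[symmetric] by (rule mpoly_coeff_closed[OF tc[OF e]])
      qed
    qed
  qed
  have cut1: "path_sum ?s ?t = (\<Oplus>\<^bsub>MP\<^esub>e\<in>E1. ?term e)"
    unfolding E1_def l_def by (rule path_sum_cut[OF C1 ends(1,2)])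
  have "col_rank_le Y Z (\<lambda>S T. \<Oplus>e\<in>E1. ?term e (mset_set (S \<union> T))) (card E1 * ((1 + ?N) * 2 ^ (n div 3)))"
    using finE(1) fin(1) term_rank by (rule col_rank_le_sum) (assumption, rule mpoly_coeff_closed[OF tc], assumption)
  then show ?thesis
  proof (rule col_rank_le_cong)
    show "card E1 * ((1 + ?N) * 2 ^ (n div 3)) \<le> ?N * ((1 + ?N) * 2 ^ (n div 3))"
      using finE(3) by (rule mult_le_mono1)
    have eq: "path_sum ?s ?t (mset_set (S \<union> T)) = (\<Oplus>e\<in>E1. ?term e (mset_set (S \<union> T)))" for S T
      unfolding cut1 using finE(1) tc by (rule mpoly_finsum_apply)
    show "path_sum ?s ?t (mset_set (S \<union> T)) = (\<Oplus>e\<in>E1. ?term e (mset_set (S \<union> T)))" for S T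
      by (rule eq)
    show "(\<Oplus>e\<in>E1. ?term e (mset_set (S \<union> T))) \<in> carrier R" for S T
      unfolding eq[symmetric] using path_sum_closed by (rule mpoly_coeff_closed)
  qed
qed

end

section \<open>Circular intervals\<close>

text \<open>An arc that wraps around contains \<open>n\<close>; one that misses \<open>n\<close> is
  an ordinary interval and hence convex.\<close>

lemma arc_low:
  assumes "I \<in> {1..n} \<times> {1..n}" "n \<notin> arc n I" "y \<in> arc n I" "z \<in> arc n I" "y < z"
  shows "{y..z} \<subseteq> arc n I"
  using assms by (cases I) (auto simp: arc_def split: if_splits)

text \<open>An arc that meets both halves without containing \<open>h\<close> must wrap around, so
  within the lower half it is an initial segment.\<close>

lemma arc_high:
  assumes "I \<in> {1..n} \<times> {1..n}" "h \<notin> arc n I" "y \<in> arc n I" "z \<in> arc n I" "y \<le> h" "h < z"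
  shows "{1..y} \<subseteq> arc n I"
  using assms by (cases I) (auto simp: arc_def split: if_splits)

text \<open>To pass from one half to the other, an arc crosses the boundary after \<open>h\<close>
  or the one after \<open>n\<close>.\<close>

lemma arc_pivot:
  assumes "I \<in> {1..n} \<times> {1..n}" "y \<in> arc n I" "z \<in> arc n I" "y \<le> h" "h < z"
  shows "h \<in> arc n I \<or> n \<in> arc n I"
  using assms by (cases I) (auto simp: arc_def split: if_splits)

text \<open>If three arcs in a row all met both halves \<open>{1..h}\<close> and \<open>{h+1..n}\<close>, each would contain one of
  the two points where the halves meet. The middle one excludes one of these points from both
  neighbours, and the positions of the first and the last piece then exclude each other.\<close>

lemma no_three_mixed_arcs:
  assumes I: "I1 \<in> {1..n} \<times> {1..n}" "I12 \<in> {1..n} \<times> {1..n}" "I2 \<in> {1..n} \<times> {1..n}"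
      "I23 \<in> {1..n} \<times> {1..n}" "I3 \<in> {1..n} \<times> {1..n}"
    and disj: "arc n I12 \<inter> arc n I3 = {}" "arc n I1 \<inter> arc n I23 = {}"
      "arc n I1 \<inter> arc n I2 = {}" "arc n I2 \<inter> arc n I3 = {}"
    and yz: "1 \<le> y1" "y1 \<le> h" "y2 \<le> h" "1 \<le> y3" "y3 \<le> h" "h < z1" "h < z2" "h < z3"
    and mem: "y1 \<in> arc n I1" "z1 \<in> arc n I1" "y1 \<in> arc n I12" "z1 \<in> arc n I12"
      "y2 \<in> arc n I2" "z2 \<in> arc n I2" "y3 \<in> arc n I23" "z3 \<in> arc n I23"
      "y3 \<in> arc n I3" "z3 \<in> arc n I3"
  shows False
\<comment> \<open>The intervals chosen for a short and a longer stretch need not be nested, so only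
  the points known to lie in both can link \<open>I1\<close> with \<open>I12\<close> and
  \<open>I3\<close> with \<open>I23\<close>. If \<open>I12\<close> takes \<open>h\<close>, the
  points \<open>h\<close> and \<open>n\<close> are forced for the other arcs in turn. Then
  \<open>I12\<close> and \<open>I23\<close> are ordinary intervals reaching beyond \<open>h\<close>,
  and of \<open>y1\<close> and \<open>y3\<close> the larger one lies in an arc that must avoid
  it.\<close>
proof (cases "h \<in> arc n I12")
  case True
  then have "h \<notin> arc n I3" using disj by auto
  then have "n \<in> arc n I3" using arc_pivot[OF I(5)] mem yz by blast
  then have "n \<notin> arc n I12" "n \<notin> arc n I2" using disj by auto
  have "{y1..z1} \<subseteq> arc n I12"
    using arc_low[OF I(2) \<open>n \<notin> arc n I12\<close>] mem yz by (meson le_less_trans)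
  moreover have "y3 \<notin> arc n I12" using disj mem by auto
  ultimately have "y3 \<notin> {y1..z1}" by blast
  then have "y3 < y1" using yz by auto
  have "h \<in> arc n I2" using arc_pivot[OF I(3)] mem yz \<open>n \<notin> arc n I2\<close> by blast
  then have "h \<notin> arc n I1" using disj by auto
  then have "n \<in> arc n I1" using arc_pivot[OF I(1)] mem yz by blast
  then have "n \<notin> arc n I23" using disj by auto
  then have "{y3..z3} \<subseteq> arc n I23"
    using arc_low[OF I(4)] mem yz by (meson le_less_trans)
  moreover have "y1 \<in> {y3..z3}" using \<open>y3 < y1\<close> yz by auto
  ultimately show False using disj mem by auto
next
  case False
  \<comment> \<open>The same chain with \<open>h\<close> and \<open>n\<close> exchanged. Now
    \<open>I12\<close> and \<open>I23\<close> wrap around, and initial segments of the lower half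
    replace the intervals up to \<open>h\<close>.\<close>
  then have "n \<in> arc n I12" using arc_pivot[OF I(2)] mem yz by blast
  then have "n \<notin> arc n I3" using disj by auto
  then have "h \<in> arc n I3" using arc_pivot[OF I(5)] mem yz by blast
  then have "h \<notin> arc n I2" using disj by auto
  then have "n \<in> arc n I2" using arc_pivot[OF I(3)] mem yz by blast
  then have "n \<notin> arc n I1" using disj by auto
  then have "h \<in> arc n I1" using arc_pivot[OF I(1)] mem yz by blast
  then have "h \<notin> arc n I23" using disj by auto
  then have "{1..y3} \<subseteq> arc n I23" using arc_high[OF I(4)] mem yz by blast
  then have "y1 \<notin> {1..y3}" using disj(2) mem(1) by blast
  then have "y3 < y1" using yz by auto
  moreover have "{1..y1} \<subseteq> arc n I12" using arc_high[OF I(2) False] mem yz by blast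
  ultimately have "y3 \<in> arc n I12" using yz by auto
  then show False using disj mem by auto
qed

section \<open>The lower bound\<close>

lemma disc_eq_card:
  assumes "Y \<subseteq> {1..n}"
  shows "disc Y 1 n = 2 * int (card Y) - int n"
proof -
  have "disc Y 1 n = (\<Sum>x\<in>{1..n}. 2 * (if x \<in> Y then 1 else 0) - 1)"
    unfolding disc_def by (intro sum.cong) auto
  also have "\<dots> = 2 * (\<Sum>x\<in>{1..n}. if x \<in> Y then 1 else 0) - int n"
    by (simp add: sum_subtractf sum_distrib_left)
  also have "(\<Sum>x\<in>{1..n}. if x \<in> Y then 1 else 0 :: int) = int (card ({1..n} \<inter> Y))"
    by (subst sum.inter_restrict[symmetric]) auto
  finally show ?thesis using assms by (simp add: Int_absorb1)
qed

text \<open>Nonsingularity asks for rank \<open>2 ^ (n div 2)\<close>. The cuts provide at most this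
  right-hand side, since a program with \<open>s\<close> nodes has at most \<open>s\<^sup>2\<close>
  edges.\<close>

theorem strict_circular_interval_size:
  fixes F :: "'a ring" and P :: "'a wfrac abp"
  assumes F: "field F" and n: "even n" "n > 0"
    and P: "strict_circular_interval_abp (Wfield F n) n P"
    and comp: "abp_poly (Wfield F n) n P = RY F n"
  shows "2 ^ (n div 2) \<le> abp_size P ^ 2 * ((1 + abp_size P ^ 2) * 2 ^ (n div 3))"
proof -
  interpret F: field F by (rule F)
  interpret K: field "Wfield F n" by (rule F.Wfield_field)
  define h where "h = n div 2"
  have h: "n = 2 * h" "1 \<le> h" "h < n" using n by (auto simp: h_def)
  obtain \<pi> where \<pi>: "\<pi> permutes {1..n}" and strict: "strict_circular_interval_wrt n \<pi> P"
    and abp: "is_abp (Wfield F n) n P"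
    using P unfolding strict_circular_interval_abp_def by blast
  obtain Ivl where Ivl: "\<And>u v. u \<in> nodes P \<Longrightarrow> v \<in> nodes P \<Longrightarrow> vars_between P u v \<noteq> {} \<Longrightarrow>
      Ivl u v \<in> {1..n} \<times> {1..n} \<and> vars_between P u v \<subseteq> circular_interval n \<pi> (Ivl u v)"
    and ov: "\<And>u a v. u \<in> nodes P \<Longrightarrow> a \<in> nodes P \<Longrightarrow> v \<in> nodes P \<Longrightarrow> vars_between P u a \<noteq> {} \<Longrightarrow>
      vars_between P a v \<noteq> {} \<Longrightarrow> \<not> overlapping n (Ivl u a) (Ivl a v)"
    using strict unfolding strict_circular_interval_wrt_def by blast
  have inj: "inj \<pi>" using \<pi> by (rule permutes_inj)
  have arcs_disj: "arc n (Ivl u a) \<inter> arc n (Ivl a v) = {}"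
    if "u \<in> nodes P" "a \<in> nodes P" "v \<in> nodes P" "vars_between P u a \<noteq> {}" "vars_between P a v \<noteq> {}" for u a v
    using ov[OF that] by (simp add: overlapping_def)
  have in_arc: "x \<in> arc n (Ivl u v)"
    if "u \<in> nodes P" "v \<in> nodes P" "\<pi> x \<in> vars_between P u v" for u v x
  proof -
    have "\<pi> x \<in> \<pi> ` arc n (Ivl u v)" using Ivl[OF that(1,2)] that(3) by (auto simp: circular_interval_def)
    then show ?thesis using inj by (simp add: inj_image_mem_iff)
  qed
  interpret A: disjoint_abp "Wfield F n" n P
  proof
    show "is_abp (Wfield F n) n P" by (rule abp)
    fix u a v assume uav: "u \<in> nodes P" "a \<in> nodes P" "v \<in> nodes P"
    show "vars_between P u a \<inter> vars_between P a v = {}"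
    proof (rule ccontr)
      assume "vars_between P u a \<inter> vars_between P a v \<noteq> {}"
      then obtain i where i: "i \<in> vars_between P u a" "i \<in> vars_between P a v" by blast
      obtain x where "i = \<pi> x" using permutes_surj[OF \<pi>] by blast
      then have "x \<in> arc n (Ivl u a)" "x \<in> arc n (Ivl a v)"
        using in_arc uav i by auto
      moreover have "arc n (Ivl u a) \<inter> arc n (Ivl a v) = {}" using arcs_disj uav i by blast
      ultimately show False by blast
    qed
  qed
  \<comment> \<open>Arcs consist of positions, which \<open>\<pi>\<close> translates into variables.
    Half circles therefore have to be taken among the positions, and their images split the
    variables evenly.\<close>
  define Y where "Y = \<pi> ` {1..h}"
  define Z where "Z = \<pi> ` {h + 1..n}"
  have YZ: "Y \<union> Z = {1..n}" "Y \<inter> Z = {}"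
  proof -
    have "{1..h} \<union> {h + 1..n} = {1..n}" using h by auto
    then show "Y \<union> Z = {1..n}" unfolding Y_def Z_def image_Un[symmetric] using permutes_image[OF \<pi>] by simp
    have "{1..h} \<inter> {h + 1..n} = {}" by auto
    then show "Y \<inter> Z = {}" unfolding Y_def Z_def image_Int[OF inj, symmetric] by simp
  qed
  have cY: "card Y = h" unfolding Y_def using inj by (subst card_image) (auto intro: inj_on_subset)
  have disc: "disc Y 1 n = 0" using disc_eq_card[of Y n] YZ(1) cY h(1) by auto
  have ZY: "Z = {1..n} - Y" using YZ by auto
  have s: "source P \<in> nodes P" and t: "sink P \<in> nodes P" by (rule A.source_node A.sink_node)+
  have RY_eq: "RY F n = A.path_sum (source P) (sink P)" using comp A.abp_poly_eq by simp
  have full: "vars_between P (source P) (sink P) = {1..n}"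
  proof
    have "A.path_sum (source P) (sink P) (mset_set {1..n}) \<noteq> \<zero>\<^bsub>Wfield F n\<^esub>"
      using F.RY_full_nonzero[OF disc] RY_eq by simp
    then show "{1..n} \<subseteq> vars_between P (source P) (sink P)" using A.path_sum_support by fastforce
  qed (rule A.vars_between_subset)
  have mixed: "\<exists>y z. y \<in> {1..h} \<and> z \<in> {h + 1..n} \<and> \<pi> y \<in> V \<and> \<pi> z \<in> V" if "A.small_side Y Z V \<noteq> 0" for V
  proof -
    have "V \<inter> Y \<noteq> {}" "V \<inter> Z \<noteq> {}" using that by (auto simp: A.small_side_def)
    then show ?thesis unfolding Y_def Z_def by blast
  qed
  have pure: "A.small_side Y Z (vars_between P (source P) u) = 0 \<or> A.small_side Y Z (vars_between P v u') = 0 \<or>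
      A.small_side Y Z (vars_between P v' (sink P)) = 0"
    if e: "(u, v) \<in> edges P" "(u', v') \<in> edges P"
      and ne: "paths P (source P) u \<noteq> {}" "paths P v u' \<noteq> {}" "paths P v' (sink P) \<noteq> {}" for u v u' v'
  proof (rule ccontr)
    assume "\<not> ?thesis"
    then obtain y1 z1 y2 z2 y3 z3 where
      1: "y1 \<in> {1..h}" "z1 \<in> {h + 1..n}" "\<pi> y1 \<in> vars_between P (source P) u" "\<pi> z1 \<in> vars_between P (source P) u" and
      2: "y2 \<in> {1..h}" "z2 \<in> {h + 1..n}" "\<pi> y2 \<in> vars_between P v u'" "\<pi> z2 \<in> vars_between P v u'" and
      3: "y3 \<in> {1..h}" "z3 \<in> {h + 1..n}" "\<pi> y3 \<in> vars_between P v' (sink P)" "\<pi> z3 \<in> vars_between P v' (sink P)"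
      using mixed by meson
    have nd: "u \<in> nodes P" "v \<in> nodes P" "u' \<in> nodes P" "v' \<in> nodes P" using A.edge_nodes e by blast+
    have m1: "vars_between P (source P) u \<subseteq> vars_between P (source P) v"
      using e(1) s by (rule A.vars_between_edge_right)
    have m12: "vars_between P (source P) v \<subseteq> vars_between P (source P) u'"
      using A.vars_between_mono[of "source P" "source P" v u'] A.path_singleton[OF s] ne by blast
    have m3: "vars_between P v' (sink P) \<subseteq> vars_between P u' (sink P)"
      using e(2) t by (rule A.vars_between_edge_left)
    have m23: "vars_between P u' (sink P) \<subseteq> vars_between P v (sink P)"
      using A.vars_between_mono[of v u' "sink P" "sink P"] A.path_singleton[OF t] ne by blast
    have n1: "vars_between P (source P) v \<noteq> {}" "vars_between P (source P) u' \<noteq> {}" using 1 m1 m12 by blast+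
    have n3: "vars_between P u' (sink P) \<noteq> {}" "vars_between P v (sink P) \<noteq> {}" using 3 m3 m23 by blast+
    have n2: "vars_between P v u' \<noteq> {}" using 2 by blast
    show False
    \<comment> \<open>The pieces are separated by edges, whereas strictness speaks of intervals that
      share a node. The outer pieces are therefore extended to \<open>v\<close> and back to
      \<open>u'\<close>, so that both border on the middle piece; the two longer stretches end and
      begin at the same nodes.\<close>
    proof (rule no_three_mixed_arcs)
      show "Ivl (source P) v \<in> {1..n} \<times> {1..n}" "Ivl (source P) u' \<in> {1..n} \<times> {1..n}"
        "Ivl v u' \<in> {1..n} \<times> {1..n}" "Ivl v (sink P) \<in> {1..n} \<times> {1..n}" "Ivl u' (sink P) \<in> {1..n} \<times> {1..n}"
        using Ivl s t nd n1 n2 n3 by blast+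
      show "arc n (Ivl (source P) u') \<inter> arc n (Ivl u' (sink P)) = {}"
        "arc n (Ivl (source P) v) \<inter> arc n (Ivl v (sink P)) = {}"
        "arc n (Ivl (source P) v) \<inter> arc n (Ivl v u') = {}"
        "arc n (Ivl v u') \<inter> arc n (Ivl u' (sink P)) = {}"
        using arcs_disj s t nd n1 n2 n3 by blast+
      show "1 \<le> y1" "y1 \<le> h" "y2 \<le> h" "1 \<le> y3" "y3 \<le> h" "h < z1" "h < z2" "h < z3"
        using 1 2 3 by auto
      show "y1 \<in> arc n (Ivl (source P) v)" "z1 \<in> arc n (Ivl (source P) v)"
        using 1 m1 s nd by (auto intro!: in_arc)
      show "y1 \<in> arc n (Ivl (source P) u')" "z1 \<in> arc n (Ivl (source P) u')"
        using 1 m1 m12 s nd by (auto intro!: in_arc)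
      show "y2 \<in> arc n (Ivl v u')" "z2 \<in> arc n (Ivl v u')"
        using 2 nd by (auto intro!: in_arc)
      show "y3 \<in> arc n (Ivl v (sink P))" "z3 \<in> arc n (Ivl v (sink P))"
        using 3 m3 m23 t nd by (auto intro!: in_arc)
      show "y3 \<in> arc n (Ivl u' (sink P))" "z3 \<in> arc n (Ivl u' (sink P))"
        using 3 m3 t nd by (auto intro!: in_arc)
    qed
  qed
  let ?N = "card (edges P)"
  have "K.col_rank_le Y Z (\<lambda>S T. RY F n (mset_set (S \<union> T))) (?N * ((1 + ?N) * 2 ^ (n div 3)))"
    unfolding RY_eq using YZ n(2) full pure by (rule A.path_sum_rank)
  then have "2 ^ card Y \<le> ?N * ((1 + ?N) * 2 ^ (n div 3))"
  proof (rule K.nonsingular_rank[rotated])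
    show "finite Y" by (simp add: Y_def)
    fix c assume c: "\<And>S. S \<subseteq> Y \<Longrightarrow> c S \<in> carrier (Wfield F n)"
      and rel: "\<And>T. T \<subseteq> Z \<Longrightarrow> (\<Oplus>\<^bsub>Wfield F n\<^esub>S\<in>Pow Y. c S \<otimes>\<^bsub>Wfield F n\<^esub> RY F n (mset_set (S \<union> T))) = \<zero>\<^bsub>Wfield F n\<^esub>"
    show "\<forall>S\<subseteq>Y. c S = \<zero>\<^bsub>Wfield F n\<^esub>"
    proof (intro allI impI)
      fix S assume "S \<subseteq> Y"
      with _ disc c rel[unfolded ZY] show "c S = \<zero>\<^bsub>Wfield F n\<^esub>"
        by (rule F.RY_nonsingular) (use YZ in auto)
    qed
  qed
  also have "\<dots> \<le> abp_size P ^ 2 * ((1 + abp_size P ^ 2) * 2 ^ (n div 3))"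
    using A.finite_edges(2) unfolding abp_size_def by (intro mult_mono) auto
  finally show ?thesis unfolding cY h_def .
qed

text \<open>With \<open>1 + s\<^sup>2 \<le> 2 s\<^sup>2\<close>, logarithms give n/2 at most 1 + 4
  log s + n/3, so log s is at least n/24 - 1/4. The constants 1/100 and 16 leave room in this
  estimate.\<close>

lemma size_bound_numeric:
  assumes n: "even n" "n \<ge> 16" and s: "2 ^ (n div 2) \<le> s ^ 2 * ((1 + s ^ 2) * 2 ^ (n div 3))"
  shows "2 powr (1 / 100 * sqrt (real n) / log 2 (real n)) \<le> real s"
proof -
  have "s \<noteq> 0"
  proof
    assume "s = 0"
    then show False using s by simp
  qed
  then have s1: "1 \<le> real s" by simp
  have "(2::real) ^ (n div 2) \<le> real s ^ 2 * ((1 + real s ^ 2) * 2 ^ (n div 3))"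
    using s by (metis (mono_tags, lifting) of_nat_1 of_nat_add of_nat_le_iff of_nat_mult of_nat_numeral of_nat_power)
  also have "\<dots> \<le> real s ^ 2 * ((real s ^ 2 + real s ^ 2) * 2 ^ (n div 3))"
    using s1 by (intro mult_left_mono mult_right_mono add_right_mono) auto
  also have "\<dots> = 2 * real s ^ 4 * 2 ^ (n div 3)" by (simp add: power2_eq_square power4_eq_xxxx)
  finally have "log 2 (2 ^ (n div 2)) \<le> log 2 (2 * real s ^ 4 * 2 ^ (n div 3))"
    using s1 by (subst log_le_cancel_iff) auto
  also have "\<dots> = 1 + 4 * log 2 (real s) + real (n div 3)"
    using s1 by (simp add: log_mult log_nat_power)
  finally have "real (n div 2) \<le> 1 + 4 * log 2 (real s) + real (n div 3)"
    by (simp add: log_nat_power)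
  moreover have "real (n div 2) = real n / 2" using n(1) by (simp add: real_of_nat_div)
  moreover have "real (3 * (n div 3)) \<le> real n" by (simp only: of_nat_le_iff)
  then have "real (n div 3) \<le> real n / 3" by simp
  moreover have "real n \<ge> 16" using n by simp
  ultimately have L: "real n / 100 \<le> log 2 (real s)" by linarith
  \<comment> \<open>From here the linear exponent is only weakened to the stated one: the logarithm
    is at least 1, and the root of \<open>n\<close> is at most \<open>n\<close>.\<close>
  have "1 \<le> log 2 (real n)" using n by (simp add: le_log_iff)
  then have "1 / 100 * sqrt (real n) / log 2 (real n) \<le> 1 / 100 * sqrt (real n) / 1"
    by (intro divide_left_mono) auto
  also have "\<dots> \<le> real n / 100"
    using n real_sqrt_le_mono[of "real n" "real n ^ 2"] by (simp add: power2_eq_square)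
  also note L
  finally have "2 powr (1 / 100 * sqrt (real n) / log 2 (real n)) \<le> 2 powr (log 2 (real s))"
    by (intro powr_mono) auto
  then show ?thesis using s1 by simp
qed

theorem theorem2:
  shows "\<exists>c::real. c > 0 \<and> (\<exists>n0::nat. \<forall>F :: 'a ring. field F \<longrightarrow>
    (\<forall>n\<ge>n0. even n \<longrightarrow>
      (\<forall>P :: 'a wfrac abp.
         strict_circular_interval_abp (Wfield F n) n P \<and>
         abp_poly (Wfield F n) n P = RY F n \<longrightarrow>
         real (abp_size P) \<ge> 2 powr (c * sqrt (real n) / log 2 (real n)))))"
proof (intro exI[of _ "1 / 100"] conjI exI[of _ 16] allI impI)
  fix F :: "'a ring" and n :: nat and P :: "'a wfrac abp"
  assume h: "field F" "16 \<le> n" "even n"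
    "strict_circular_interval_abp (Wfield F n) n P \<and> abp_poly (Wfield F n) n P = RY F n"
  have "2 ^ (n div 2) \<le> abp_size P ^ 2 * ((1 + abp_size P ^ 2) * 2 ^ (n div 3))"
    by (rule strict_circular_interval_size[of F]) (use h in auto)
  then show "2 powr (1 / 100 * sqrt (real n) / log 2 (real n)) \<le> real (abp_size P)"
    using h by (intro size_bound_numeric) auto
qed simp

end
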